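(* Let $G$ be a strongly balanced connected graph with $v(G)=k\ge2$ vertices and $e(G)$ edges, and let $N_G$ be the number of copies of $G$ in the binomial random-connection model $G_H(\mathcal{X}_n)$ with connection probabilities $p_nH(X_i,X_j)$. Suppose that $$\mathrm{Var}\Big[\sum_{\ell=1}^k f_{(\ell)}(X_1)\Big]>0 .$$ Then there is a constant $C>0$ (independent of $n$) such that for $n$ large enough the normalized subgraph count $$\overline{N}_G:=\frac{N_G-\kappa_1(N_G)}{\sqrt{\kappa_2(N_G)}}$$ satisfies $$\sup_{x\in\mathbb{R}}\big|\mathbb{P}(\overline{N}_G\le x)-\Phi(x)\big|\le\begin{cases}\dfrac{C}{n^{1/(2+4v(G))}} & \text{when } n^{-(v(G)-1)/e(G)}\ll p_n,\\[3mm] \dfrac{C}{\big(n^{v(G)}p_n^{e(G)}\big)^{1/(2+4v(G))}} & \text{when } p_n\ll n^{-(v(G)-1)/e(G)}.\end{cases}$$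
   Context: Binomial random-connection model. $X_1,\dots,X_n$ are i.i.d. random points of $\mathbb{R}^d$ with common continuous (atomless) distribution $\mu$, $\mathcal{X}_n=\{X_1,\dots,X_n\}$, $H:\mathbb{R}^d\times\mathbb{R}^d\to[0,1]$ is a symmetric measurable function, and $p_n\in(0,1)$ for each $n$; $\mu$ and $H$ do not depend on $n$. Given $\mathcal{X}_n$, each pair $X_i,X_j$ ($i\ne j$) is connected by an edge (written $X_i\sim X_j$) independently with probability $p_nH(X_i,X_j)$. The resulting random graph is $G_H(\mathcal{X}_n)$. Subgraph count. $G=(V_G,E_G)$ is a simple graph with $v(G)=|V_G|=k$, vertex set identified with $[k]=\{1,\dots,k\}$, $e(G)=|E_G|$, and $a(G)$ is the number of automorphisms of $G$. With $[n]^k_{\neq}:=\{\beta\in[n]^k:\beta(i)\ne\beta(j)\text{ for }i\ne j\}$, $$N_G:=\frac{1}{a(G)}\sum_{\beta\in[n]^k_{\neq}}\ \prod_{\{u,v\}\in E_G}\mathbf{1}_{\{X_{\beta(u)}\sim X_{\beta(v)}\}}.$$ For $1\le\ell\le k$, $$f_{(\ell)}(x):=\frac{p_n^{e(G)}}{a(G)}\int_{(\mathbb{R}^d)^{k-1}}\prod_{\{u,v\}\in E_G}H(x_u,x_v)\,\mu^{\otimes(k-1)}(\mathrm{d}x_1,\dots,\mathrm{d}x_{\ell-1},\mathrm{d}x_{\ell+1},\dots,\mathrm{d}x_k),\qquad x_\ell:=x.$$ Since $p_n\in(0,1)$, the variance condition does not depend on $n$. $G$ is strongly balanced if $\dfrac{e(G')}{v(G')-1}\le\dfrac{e(G)}{v(G)-1}$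 for every subgraph $G'\subset G$ with $v(G')\ge2$. $f(n)\ll g(n)$ means $f(n)\ge0$, $g(n)>0$ and $\lim_{n\to\infty}f(n)/g(n)=0$. $\kappa_1,\kappa_2$ denote mean and variance, and $\Phi$ is the standard normal cumulative distribution function. *)

theory Defs
  imports "HOL-Probability.Probability"
begin

section \<open>Finite simple graphs\<close>

definition vertex_pairs :: "'v set \<Rightarrow> 'v set set" where
  "vertex_pairs V = {{u, v} | u v. u \<in> V \<and> v \<in> V \<and> u \<noteq> v}"

definition simple_graph :: "'v set \<Rightarrow> 'v set set \<Rightarrow> bool" where
  "simple_graph V E \<longleftrightarrow> finite V \<and> E \<subseteq> vertex_pairs V"

definition subgraph :: "'v set \<Rightarrow> 'v set set \<Rightarrow> 'v set \<Rightarrow> 'v set set \<Rightarrow> bool" where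
  "subgraph V' E' V E \<longleftrightarrow> simple_graph V' E' \<and> V' \<subseteq> V \<and> E' \<subseteq> E"

definition connected_graph :: "'v set \<Rightarrow> 'v set set \<Rightarrow> bool" where
  "connected_graph V E \<longleftrightarrow> V \<noteq> {} \<and> (\<forall>u\<in>V. \<forall>v\<in>V. (u, v) \<in> {(a, b). {a, b} \<in> E}\<^sup>*)"

definition strongly_balanced :: "'v set \<Rightarrow> 'v set set \<Rightarrow> bool" where
  "strongly_balanced V E \<longleftrightarrow>
     (\<forall>V' E'. subgraph V' E' V E \<and> card V' \<ge> 2 \<longrightarrow>
        real (card E') / (real (card V') - 1) \<le> real (card E) / (real (card V) - 1))"

definition automorphisms :: "'v set \<Rightarrow> 'v set set \<Rightarrow> ('v \<Rightarrow> 'v) set" where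
  "automorphisms V E =
     {\<pi>. \<pi> permutes V \<and> (\<forall>u\<in>V. \<forall>v\<in>V. {\<pi> u, \<pi> v} \<in> E \<longleftrightarrow> {u, v} \<in> E)}"

text \<open>
  Products over unordered pairs \<open>{u, v}\<close> of a symmetric function of \<open>(u, v)\<close> are taken
  over the representatives with \<open>u < v\<close>.
\<close>

definition oriented_edges :: "nat set set \<Rightarrow> (nat \<times> nat) set" where
  "oriented_edges E = {(u, v). u < v \<and> {u, v} \<in> E}"


section \<open>The binomial random-connection model\<close>

definition points_algebra :: "'w measure \<Rightarrow> nat \<Rightarrow> (nat \<Rightarrow> 'w \<Rightarrow> real ^ 'd) \<Rightarrow> 'w measure" where
  "points_algebra M n X =
     vimage_algebra (space M) (\<lambda>\<omega>. \<lambda>i\<in>{1..n}. X i \<omega>) (\<Pi>\<^sub>M i\<in>{1..n}. borel)"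

definition connection_setting ::
    "(real ^ 'd) measure \<Rightarrow> (real ^ 'd \<Rightarrow> real ^ 'd \<Rightarrow> real) \<Rightarrow> bool" where
  "connection_setting \<mu> H \<longleftrightarrow>
     prob_space \<mu> \<and> sets \<mu> = sets borel \<and> (\<forall>x. measure \<mu> {x} = 0) \<and>
     (\<lambda>(x, y). H x y) \<in> borel_measurable (borel \<Otimes>\<^sub>M borel) \<and>
     (\<forall>x y. 0 \<le> H x y \<and> H x y \<le> 1) \<and> (\<forall>x y. H x y = H y x)"

text \<open>
  \<open>\<E> \<omega>\<close> is the edge set of the random graph on the index set \<open>{1..n}\<close>: \<open>X i\<close> and \<open>X j\<close> are
  connected iff \<open>{i, j} \<in> \<E> \<omega>\<close>. In \<open>edge_law\<close>, singletons \<open>S = {{i, j}}\<close> give the conditional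
  connection probabilities \<open>p * H (X i) (X j)\<close> given the points; general \<open>S\<close> give the
  product formula, i.e. the conditional independence of the edges.
\<close>

locale binomial_rcm = prob_space M
  for M :: "'w measure" and n :: nat and \<mu> :: "(real ^ 'd) measure"
    and H :: "real ^ 'd \<Rightarrow> real ^ 'd \<Rightarrow> real" and p :: real
    and X :: "nat \<Rightarrow> 'w \<Rightarrow> real ^ 'd" and \<E> :: "'w \<Rightarrow> nat set set" +
  assumes points_indep: "indep_vars (\<lambda>_. borel) X {1..n}"
    and points_law: "\<And>i. i \<in> {1..n} \<Longrightarrow> distr M borel (X i) = \<mu>"
    and edges_simple: "\<And>\<omega>. \<omega> \<in> space M \<Longrightarrow> simple_graph {1..n} (\<E> \<omega>)"
    and edge_events: "\<And>e. e \<in> vertex_pairs {1..n} \<Longrightarrow> {\<omega> \<in> space M. e \<in> \<E> \<omega>} \<in> events"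
    and edge_law: "\<And>S. S \<subseteq> vertex_pairs {1..n} \<Longrightarrow>
      AE \<omega> in M.
        real_cond_exp M (points_algebra M n X) (indicator {\<omega> \<in> space M. S \<subseteq> \<E> \<omega>}) \<omega> =
          (\<Prod>(i, j)\<in>oriented_edges S. p * H (X i \<omega>) (X j \<omega>))"


section \<open>Subgraph counts\<close>

text \<open>The pattern graph has vertex set \<open>{1..k}\<close> and edge set \<open>E\<close>.\<close>

definition subgraph_count ::
    "nat \<Rightarrow> nat set set \<Rightarrow> nat \<Rightarrow> ('w \<Rightarrow> nat set set) \<Rightarrow> 'w \<Rightarrow> real" where
  "subgraph_count k E n \<E> \<omega> =
     1 / real (card (automorphisms {1..k} E)) *
     (\<Sum>\<beta> \<in> {\<beta> \<in> {1..k} \<rightarrow>\<^sub>E {1..n}. inj_on \<beta> {1..k}}.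
        \<Prod>(u, v)\<in>oriented_edges E. of_bool ({\<beta> u, \<beta> v} \<in> \<E> \<omega>))"

definition first_order_fun ::
    "(real ^ 'd) measure \<Rightarrow> (real ^ 'd \<Rightarrow> real ^ 'd \<Rightarrow> real) \<Rightarrow> real \<Rightarrow> nat \<Rightarrow> nat set set \<Rightarrow>
     nat \<Rightarrow> real ^ 'd \<Rightarrow> real" where
  "first_order_fun \<mu> H p k E l x =
     p ^ card E / real (card (automorphisms {1..k} E)) *
     (\<integral>y. (\<Prod>(u, v)\<in>oriented_edges E. H ((y(l := x)) u) ((y(l := x)) v))
        \<partial>(\<Pi>\<^sub>M i\<in>{1..k} - {l}. \<mu>))"

definition normalized :: "'w measure \<Rightarrow> ('w \<Rightarrow> real) \<Rightarrow> 'w \<Rightarrow> real" where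
  "normalized M Y \<omega> = (Y \<omega> - prob_space.expectation M Y) / sqrt (prob_space.variance M Y)"

definition kolmogorov_dist_normal :: "'w measure \<Rightarrow> ('w \<Rightarrow> real) \<Rightarrow> real" where
  "kolmogorov_dist_normal M Y =
     (\<Squnion>x. \<bar>\<P>(\<omega> in M. Y \<omega> \<le> x) - cdf std_normal_distribution x\<bar>)"

text \<open>Sequences are indexed from 1.\<close>

definition much_less :: "(nat \<Rightarrow> real) \<Rightarrow> (nat \<Rightarrow> real) \<Rightarrow> bool" where
  "much_less f g \<longleftrightarrow> (\<forall>n\<ge>1. 0 \<le> f n \<and> 0 < g n) \<and> (\<lambda>n. f n / g n) \<longlonglongrightarrow> 0"

end

theory Submission
  imports Defs
begin

text \<open>
  Stein's method for locally dependent sums. Copies of the pattern placed on disjoint vertex sets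
  are independent, so the Stein error is governed by sums over triples of placements linked by
  common vertices. Let \<open>\<Psi>\<close> be a lower bound for the expected number of copies of every induced
  subgraph of the pattern. With \<open>m = n ^ k * p ^ card E\<close> the triple sum is at most a constant times
  \<open>m ^ 3 / \<Psi>\<^sup>2\<close>, so a variance of order at least \<open>m\<^sup>2 / \<Psi>\<close> gives a smooth-test-function error of
  order \<open>\<Psi> powr (-1/2)\<close> and, after smoothing the indicator, a Kolmogorov distance of order
  \<open>\<Psi> powr (-1/4)\<close>. This is stronger than required because \<open>2 + 4 * k \<ge> 4\<close>.

  For a strongly balanced pattern one may take \<open>\<Psi> = n\<close> in the dense regime, where the variance is
  bounded below by that of the first-order projection, and \<open>\<Psi> = m\<close> in the sparse regime, where it
  is bounded below by the diagonal of the covariance sum. If \<open>m < 1\<close> the claim is trivial.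
\<close>

section \<open>Stein's equation for the standard normal law\<close>

text \<open>One parameter \<open>\<Psi>\<close> suffices for the following reason. A placement
  linked to a fixed vertex set lands in it along some nonempty \<open>I\<close>. This leaves about
  \<open>n ^ (k - card I)\<close> choices and adds at least
  \<open>card E - card (E \<inter> vertex_pairs I)\<close> new edges, so all such placements
  together weigh at most a constant times \<open>m / \<Psi>\<close>. Two links give
  \<open>m * (m / \<Psi>)\<^sup>2\<close>, and dividing by the cube of the standard deviation, of
  order \<open>m ^ 3 / \<Psi> powr (3/2)\<close>, leaves \<open>\<Psi> powr (-1/2)\<close>.

  The probabilistic obstacle is that Stein's argument needs a copy, or a product of two copies, to
  be independent of a whole sum of others, while the model only prescribes conditional probabilities
  of the events \<open>S \<subseteq> \<E> \<omega>\<close>. Independence is therefore proved for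
  entire edge configurations on disjoint vertex sets.

  Strong balance makes a single vertex the rarest subgraph above the threshold and the whole pattern
  the rarest one below it. The variance hypothesis serves twice: it makes the projection
  nondegenerate, and it forces the pattern to have positive density, without which the diagonal
  bound would be void.\<close>

lemma std_normal_density_deriv:
  "(std_normal_density has_real_derivative - x * std_normal_density x) (at x)"
proof -
  have "((\<lambda>x::real. (1 / sqrt (2 * pi)) * exp (- x\<^sup>2 / 2)) has_real_derivative
      - x * ((1 / sqrt (2 * pi)) * exp (- x\<^sup>2 / 2))) (at x)"
    by (auto intro!: derivative_eq_intros) (simp add: field_simps)
  then show ?thesis
    unfolding std_normal_density_def[abs_def] .
qed

lemma isCont_std_normal_density: "isCont std_normal_density x"
  using std_normal_density_deriv DERIV_isCont by blast

lemma std_normal_density_le_1: "std_normal_density x \<le> 1"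
proof -
  have "1 \<le> sqrt (2 * pi)"
    using pi_ge_two by simp
  moreover have "exp (- x\<^sup>2 / 2) \<le> 1"
    by simp
  ultimately have "exp (- x\<^sup>2 / 2) \<le> 1 * sqrt (2 * pi)"
    by linarith
  then show ?thesis
    unfolding std_normal_density_def by (simp add: field_simps)
qed

lemma std_normal_density_at_top: "(std_normal_density \<longlongrightarrow> 0) at_top"
  unfolding std_normal_density_def[abs_def] by real_asymp

lemma std_normal_density_at_bot: "(std_normal_density \<longlongrightarrow> 0) at_bot"
  unfolding std_normal_density_def[abs_def] by real_asymp

interpretation std_normal: real_distribution std_normal_distribution
  by (rule real_dist_normal_dist)

lemma integrable_bounded_std_normal:
  fixes h :: "real \<Rightarrow> real"
  assumes "h \<in> borel_measurable borel" and "\<And>x. \<bar>h x\<bar> \<le> B"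
  shows "integrable std_normal_distribution h"
  using assms by (intro std_normal.integrable_const_bound[of _ B]) auto

text \<open>The product of \<open>h\<close> and the density is continuous, so it has a global
  antiderivative, from which the partial integral differs by a constant. With \<open>h = 1\<close>
  this differentiates the distribution function; with a centred test function it differentiates the
  numerator of Stein's solution.\<close>

lemma std_normal_partial_integral_deriv:
  fixes h :: "real \<Rightarrow> real"
  assumes cont: "\<And>x. isCont h x" and bnd: "\<And>x. \<bar>h x\<bar> \<le> B"
  shows "((\<lambda>w. \<integral>x. indicator {..w} x * h x \<partial>std_normal_distribution)
      has_real_derivative h w * std_normal_density w) (at w)"
proof -
  define F where "F w = (\<integral>x. indicator {..w} x * h x \<partial>std_normal_distribution)" for w :: real
  have contf: "isCont (\<lambda>x. h x * std_normal_density x) x" for x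
    by (intro isCont_mult cont isCont_std_normal_density)
  have [measurable]: "h \<in> borel_measurable borel"
    using cont by (intro borel_measurable_continuous_onI continuous_at_imp_continuous_on) auto
  obtain A where A: "\<And>x. (A has_vector_derivative h x * std_normal_density x) (at x)"
    using einterval_antiderivative[of "-\<infinity>" "\<infinity>" "\<lambda>x. h x * std_normal_density x"] contf by auto
  have int: "integrable std_normal_distribution (\<lambda>x. indicator S x * h x)"
    if [measurable]: "S \<in> sets borel" for S :: "real set"
  proof (rule integrable_bounded_std_normal[of _ B])
    show "\<bar>indicator S x * h x\<bar> \<le> B" for x
      using bnd[of x] abs_ge_zero[of "h x"] by (auto simp: indicator_def)
  qed auto
  have diff: "F b - F a = A b - A a" if "a \<le> b" for a b
  proof -
    have "F b - F a = (\<integral>x. indicator {..b} x * h x - indicator {..a} x * h x \<partial>std_normal_distribution)"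
      unfolding F_def by (rule Bochner_Integration.integral_diff[symmetric]; rule int; simp)
    also have "\<dots> = (\<integral>x. indicator {a<..b} x * h x \<partial>std_normal_distribution)"
      using that by (intro Bochner_Integration.integral_cong) (auto simp: indicator_def)
    also have "\<dots> = (\<integral>x. std_normal_density x * (indicator {a<..b} x * h x) \<partial>lborel)"
      by (subst integral_density) (simp_all add: mult.commute)
    also have "\<dots> = (\<integral>x. indicator {a..b} x *\<^sub>R (h x * std_normal_density x) \<partial>lborel)"
    proof (rule integral_cong_AE)
      show "AE x in lborel. std_normal_density x * (indicator {a<..b} x * h x)
          = indicator {a..b} x *\<^sub>R (h x * std_normal_density x)"
        using AE_lborel_singleton[of a] by eventually_elim (auto simp: indicator_def)
    qed auto
    also have "\<dots> = A b - A a"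
      using that A contf
      by (intro integral_FTC_atLeastAtMost continuous_at_imp_continuous_on)
        (auto intro: has_vector_derivative_at_within)
    finally show ?thesis .
  qed
  have "F = (\<lambda>w. A w + (F 0 - A 0))"
  proof
    fix w show "F w = A w + (F 0 - A 0)"
      using diff[of 0 w] diff[of w 0] by (cases "0 \<le> w") auto
  qed
  moreover have "((\<lambda>w. A w + (F 0 - A 0)) has_real_derivative h w * std_normal_density w) (at w)"
    using A[of w] unfolding has_real_derivative_iff_has_vector_derivative[symmetric]
    by (auto intro!: derivative_eq_intros)
  ultimately show ?thesis
    unfolding F_def[abs_def] by simp
qed

lemma cdf_std_normal_deriv:
  "(cdf std_normal_distribution has_real_derivative std_normal_density w) (at w)"
proof -
  have "cdf std_normal_distribution = (\<lambda>w. \<integral>x. indicator {..w} x * 1 \<partial>std_normal_distribution)"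
    by (auto simp: cdf_def fun_eq_iff)
  then show ?thesis
    using std_normal_partial_integral_deriv[of "\<lambda>_. 1" 1 w] by simp
qed

section \<open>Lipschitz constant and tails of the normal distribution function\<close>

lemma cdf_std_normal_lipschitz:
  assumes "a \<le> b"
  shows "cdf std_normal_distribution b - cdf std_normal_distribution a \<le> b - a"
proof (cases "a = b")
  case False
  with assms obtain z where
    "cdf std_normal_distribution b - cdf std_normal_distribution a = (b - a) * std_normal_density z"
    using MVT2[of a b "cdf std_normal_distribution" std_normal_density] cdf_std_normal_deriv by auto
  then show ?thesis
    using assms std_normal_density_le_1[of z] by (simp add: mult_left_le)
qed simp

text \<open>On the tail \<open>w \<le> x\<close>, so \<open>w\<close> times the tail integral of the
  density is at most the integral of \<open>x * std_normal_density x\<close>, whose antiderivative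
  is minus the density.\<close>

lemma mills_ratio:
  assumes "0 \<le> w"
  shows "w * (1 - cdf std_normal_distribution w) \<le> std_normal_density w"
proof -
  have "ennreal (w * (1 - cdf std_normal_distribution w))
      = ennreal w * emeasure std_normal_distribution {w<..}"
  proof -
    have "measure std_normal_distribution {w<..} = 1 - cdf std_normal_distribution w"
      using std_normal.prob_compl[of "{..w}"] by (simp add: cdf_def Compl_eq_Diff_UNIV[symmetric])
    then show ?thesis
      using assms by (simp add: std_normal.emeasure_eq_measure ennreal_mult')
  qed
  also have "\<dots> = (\<integral>\<^sup>+x. ennreal w * (ennreal (std_normal_density x) * indicator {w<..} x) \<partial>lborel)"
    by (subst emeasure_density, simp, simp, subst nn_integral_cmult, auto)
  also have "\<dots> \<le> (\<integral>\<^sup>+x. ennreal (x * std_normal_density x) * indicator {w..} x \<partial>lborel)"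
    using assms by (intro nn_integral_mono)
      (auto simp: indicator_def ennreal_mult'[symmetric] intro!: ennreal_leI mult_right_mono)
  also have "\<dots> = ennreal (0 - (- std_normal_density w))"
  proof (rule nn_integral_FTC_atLeast)
    show "((\<lambda>x. - std_normal_density x) has_real_derivative x * std_normal_density x) (at x)" for x
      using DERIV_minus[OF std_normal_density_deriv[of x]] by simp
    show "((\<lambda>x. - std_normal_density x) \<longlongrightarrow> 0) at_top"
      using tendsto_minus[OF std_normal_density_at_top] by simp
  qed (use assms in auto)
  finally show ?thesis
    by (simp add: ennreal_le_iff)
qed

text \<open>Beyond 1 this is Mills' bound. On \<open>[0, 1]\<close> the tail is at most 1, and 5 is
  large enough because \<open>sqrt (2 * pi) * exp (1/2)\<close> has square at most
  \<open>8 * 3\<close>, which is below \<open>5\<^sup>2\<close>.\<close>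

lemma normal_tail_le:
  assumes "0 \<le> w"
  shows "1 - cdf std_normal_distribution w \<le> 5 * std_normal_density w"
proof (cases "w \<le> 1")
  case True
  have "w\<^sup>2 \<le> 1"
    using True assms by (simp add: power_le_one)
  have "exp (1/2::real) ^ 2 \<le> 3"
    using exp_le by (simp add: exp_double[symmetric] power2_eq_square exp_add[symmetric])
  moreover have "(sqrt (2 * pi))\<^sup>2 \<le> 8"
    using pi_less_4 by simp
  ultimately have "(sqrt (2 * pi))\<^sup>2 * exp (1/2::real)^2 \<le> 8 * 3"
    by (intro mult_mono) auto
  then have "(sqrt (2 * pi) * exp (1/2))\<^sup>2 \<le> 5\<^sup>2"
    by (simp add: power_mult_distrib)
  then have 1: "sqrt (2 * pi) * exp (1/2) \<le> 5"
    by (rule power2_le_imp_le) simp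
  have "sqrt (2 * pi) * exp (w\<^sup>2 / 2) \<le> sqrt (2 * pi) * exp (1/2)"
    using \<open>w\<^sup>2 \<le> 1\<close> by (intro mult_left_mono) auto
  with 1 have "sqrt (2 * pi) * exp (w\<^sup>2 / 2) \<le> 5"
    by linarith
  then have "1 \<le> 5 * std_normal_density w"
    unfolding std_normal_density_def by (simp add: field_simps exp_minus)
  then show ?thesis
    using std_normal.cdf_nonneg[of w] by linarith
next
  case False
  then have "1 * (1 - cdf std_normal_distribution w) \<le> w * (1 - cdf std_normal_distribution w)"
    using std_normal.cdf_bounded_prob[of w] by (intro mult_right_mono) auto
  then show ?thesis
    using mills_ratio[OF assms] normal_density_nonneg[of 0 1 w] by (simp del: normal_density_nonneg)
qed

section \<open>A priori bounds for the equation g' = w g + k\<close>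

text \<open>The density is an integrating factor: \<open>g\<close> times the density has derivative
  \<open>k\<close> times the density. A bound on \<open>k\<close> thus compares \<open>g\<close>
  times the density with \<open>K\<close> times the normal tail, and the tail bounds turn this into
  bounds on \<open>g\<close> and \<open>w * g w\<close>. Keeping \<open>k\<close> general allows a
  second use for the differentiated Stein equation.\<close>

lemma stein_ode_bound_nonneg:
  fixes g k :: "real \<Rightarrow> real"
  assumes ode: "\<And>w. (g has_real_derivative w * g w + k w) (at w)"
    and k: "\<And>w. \<bar>k w\<bar> \<le> K"
    and lim: "((\<lambda>w. g w * std_normal_density w) \<longlongrightarrow> 0) at_top"
    and w: "0 \<le> w"
  shows "\<bar>w * g w\<bar> \<le> K" and "\<bar>g w\<bar> \<le> 5 * K"
proof -
  let ?\<Phi> = "cdf std_normal_distribution" and ?\<phi> = std_normal_density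
  have K0: "0 \<le> K"
    using k[of 0] abs_ge_zero[of "k 0"] by linarith
  have pos: "0 < ?\<phi> x" for x
    by (rule normal_density_pos) simp
  have der: "((\<lambda>x. g x * ?\<phi> x) has_real_derivative k x * ?\<phi> x) (at x)" for x
    by (rule derivative_eq_intros ode std_normal_density_deriv refl)+ (simp add: algebra_simps)
  have lim\<Phi>: "(?\<Phi> \<longlongrightarrow> 1) at_top"
    by (rule std_normal.cdf_lim_at_top_prob)
  have bnd: "\<bar>k x * ?\<phi> x\<bar> \<le> K * ?\<phi> x" for x
    using k[of x] pos[of x] by (simp add: abs_mult mult_right_mono)
  \<comment> \<open>The difference is nondecreasing because its derivative is \<open>(k + K)\<close>
    times the density, and it tends to 0 at infinity, so it is nonpositive throughout. The lower
    bound is the mirror image.\<close>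
  have up: "g w * ?\<phi> w - K * (1 - ?\<Phi> w) \<le> 0"
  proof -
    have "((\<lambda>x. g x * ?\<phi> x - K * (1 - ?\<Phi> x)) \<longlongrightarrow> 0 - K * (1 - 1)) at_top"
      by (intro tendsto_intros lim lim\<Phi>)
    moreover have "g w * ?\<phi> w - K * (1 - ?\<Phi> w) \<le> g x * ?\<phi> x - K * (1 - ?\<Phi> x)" if "w \<le> x" for x
    proof (rule DERIV_nonneg_imp_nondecreasing[OF that])
      fix y
      have "((\<lambda>x. g x * ?\<phi> x - K * (1 - ?\<Phi> x)) has_real_derivative (k y * ?\<phi> y + K * ?\<phi> y)) (at y)"
        by (rule derivative_eq_intros der cdf_std_normal_deriv refl)+ simp
      then show "\<exists>z. ((\<lambda>x. g x * ?\<phi> x - K * (1 - ?\<Phi> x)) has_real_derivative z) (at y) \<and> 0 \<le> z"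
        using bnd[of y] by (intro exI[of _ "k y * ?\<phi> y + K * ?\<phi> y"]) auto
    qed
    ultimately show ?thesis
      by (intro tendsto_lowerbound[where F=at_top and f="\<lambda>x. g x * ?\<phi> x - K * (1 - ?\<Phi> x)"])
        (auto simp: eventually_at_top_linorder)
  qed
  have lo: "g w * ?\<phi> w + K * (1 - ?\<Phi> w) \<ge> 0"
  proof -
    have "((\<lambda>x. g x * ?\<phi> x + K * (1 - ?\<Phi> x)) \<longlongrightarrow> 0 + K * (1 - 1)) at_top"
      by (intro tendsto_intros lim lim\<Phi>)
    moreover have "g w * ?\<phi> w + K * (1 - ?\<Phi> w) \<ge> g x * ?\<phi> x + K * (1 - ?\<Phi> x)" if "w \<le> x" for x
    proof (rule DERIV_nonpos_imp_nonincreasing[OF that])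
      fix y
      have "((\<lambda>x. g x * ?\<phi> x + K * (1 - ?\<Phi> x)) has_real_derivative (k y * ?\<phi> y - K * ?\<phi> y)) (at y)"
        by (rule derivative_eq_intros der cdf_std_normal_deriv refl)+ simp
      then show "\<exists>z. ((\<lambda>x. g x * ?\<phi> x + K * (1 - ?\<Phi> x)) has_real_derivative z) (at y) \<and> z \<le> 0"
        using bnd[of y] by (intro exI[of _ "k y * ?\<phi> y - K * ?\<phi> y"]) auto
    qed
    ultimately show ?thesis
      by (intro tendsto_upperbound[where F=at_top and f="\<lambda>x. g x * ?\<phi> x + K * (1 - ?\<Phi> x)"])
        (auto simp: eventually_at_top_linorder)
  qed
  have main: "\<bar>g w\<bar> * ?\<phi> w \<le> K * (1 - ?\<Phi> w)"
    using up lo pos[of w] by (cases "g w \<ge> 0") auto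
  have "\<bar>w * g w\<bar> * ?\<phi> w = w * (\<bar>g w\<bar> * ?\<phi> w)"
    using w by (simp add: abs_mult)
  also have "\<dots> \<le> K * (w * (1 - ?\<Phi> w))"
    using mult_left_mono[OF main w] by (simp add: ac_simps)
  also have "\<dots> \<le> K * ?\<phi> w"
    by (intro mult_left_mono mills_ratio w K0)
  finally show "\<bar>w * g w\<bar> \<le> K"
    using pos[of w] by (meson mult_le_cancel_right_pos)
  have "\<bar>g w\<bar> * ?\<phi> w \<le> K * (5 * ?\<phi> w)"
    using main mult_left_mono[OF normal_tail_le[OF w] K0] by linarith
  then have "\<bar>g w\<bar> * ?\<phi> w \<le> (5 * K) * ?\<phi> w"
    by simp
  then show "\<bar>g w\<bar> \<le> 5 * K"
    using pos[of w] by (meson mult_le_cancel_right_pos)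
qed

text \<open>Reflection in the origin preserves the form of the equation, with \<open>k w\<close>
  replaced by \<open>- k (- w)\<close>; the negative half-line therefore reduces to the positive
  one.\<close>

lemma stein_ode_bound:
  fixes g k :: "real \<Rightarrow> real"
  assumes ode: "\<And>w. (g has_real_derivative w * g w + k w) (at w)"
    and k: "\<And>w. \<bar>k w\<bar> \<le> K"
    and lim_top: "((\<lambda>w. g w * std_normal_density w) \<longlongrightarrow> 0) at_top"
    and lim_bot: "((\<lambda>w. g w * std_normal_density w) \<longlongrightarrow> 0) at_bot"
  shows "\<bar>g w\<bar> \<le> 5 * K" and "\<bar>w * g w + k w\<bar> \<le> 2 * K"
proof -
  have *: "\<bar>w * g w\<bar> \<le> K \<and> \<bar>g w\<bar> \<le> 5 * K"
  proof (cases "0 \<le> w")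
    case True
    then show ?thesis
      using stein_ode_bound_nonneg[OF ode k lim_top] by auto
  next
    case False
    have sym: "std_normal_density (- x) = std_normal_density x" for x
      by (simp add: std_normal_density_def)
    have ode': "((\<lambda>w. g (- w)) has_real_derivative w * g (- w) + (- k (- w))) (at w)" for w
      by (rule DERIV_cong[OF DERIV_chain2[OF ode]]) (auto intro!: derivative_eq_intros)
    have "((\<lambda>w. g (- w) * std_normal_density w) \<longlongrightarrow> 0) at_top"
      using lim_bot unfolding filterlim_at_bot_mirror by (simp add: sym)
    from stein_ode_bound_nonneg[of "\<lambda>w. g (- w)" "\<lambda>w. - k (- w)" K "- w", OF ode' _ this] k False
    show ?thesis
      by auto
  qed
  then show "\<bar>g w\<bar> \<le> 5 * K"
    by simp
  show "\<bar>w * g w + k w\<bar> \<le> 2 * K"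
    using * k[of w] by linarith
qed

text \<open>The solution is the partial integral of the centred test function divided by the
  density. It satisfies the equation with \<open>k = h0\<close>, bounded by 1. Differentiating shows
  that \<open>f'\<close> satisfies the same equation with \<open>k = f + h'\<close>, bounded by
  \<open>5 + L\<close>, so the same a priori estimate also bounds \<open>f''\<close>.\<close>

lemma stein_solution:
  fixes h h' :: "real \<Rightarrow> real"
  assumes der: "\<And>x. (h has_real_derivative h' x) (at x)"
    and bnd: "\<And>x. 0 \<le> h x \<and> h x \<le> 1"
    and bnd': "\<And>x. \<bar>h' x\<bar> \<le> L"
  obtains f f' f'' :: "real \<Rightarrow> real" where
    "\<And>w. (f has_real_derivative f' w) (at w)"
    "\<And>w. (f' has_real_derivative f'' w) (at w)"
    "\<And>w. f' w - w * f w = h w - (\<integral>x. h x \<partial>std_normal_distribution)"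
    "\<And>w. \<bar>f w\<bar> \<le> 5" "\<And>w. \<bar>f' w\<bar> \<le> 2" "\<And>w. \<bar>f'' w\<bar> \<le> 2 * (5 + L)"
proof -
  let ?\<phi> = std_normal_density and ?N = std_normal_distribution
  define m where "m = (\<integral>x. h x \<partial>?N)"
  define h0 where "h0 x = h x - m" for x
  define F where "F w = (\<integral>x. indicator {..w} x * h0 x \<partial>?N)" for w :: real
  define f where "f w = F w / ?\<phi> w" for w
  define f' where "f' w = w * f w + h0 w" for w
  define f'' where "f'' w = w * f' w + (f w + h' w)" for w
  have pos: "0 < ?\<phi> x" for x
    by (rule normal_density_pos) simp
  have conth: "isCont h x" for x
    using der DERIV_isCont by blast
  have [measurable]: "h \<in> borel_measurable borel"
    using conth by (intro borel_measurable_continuous_onI continuous_at_imp_continuous_on) auto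
  have inth: "integrable ?N h"
    using bnd by (intro integrable_bounded_std_normal[of _ 1]) auto
  have "0 \<le> m"
    unfolding m_def using bnd by (intro integral_nonneg_AE) auto
  moreover have "m \<le> (\<integral>x. 1 \<partial>?N)"
    unfolding m_def using bnd inth by (intro integral_mono) auto
  ultimately have m: "0 \<le> m" "m \<le> 1"
    using std_normal.prob_space by auto
  have h0: "\<bar>h0 x\<bar> \<le> 1" for x
    using m bnd[of x] unfolding h0_def by (auto simp: abs_le_iff)
  have conth0: "isCont h0 x" for x
    unfolding h0_def[abs_def] using conth by (intro continuous_intros) auto
  have [measurable]: "h0 \<in> borel_measurable borel"
    unfolding h0_def[abs_def] by measurable
  have derF: "(F has_real_derivative h0 w * ?\<phi> w) (at w)" for w
    unfolding F_def[abs_def] by (rule std_normal_partial_integral_deriv[OF conth0 h0])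
  have der_f: "(f has_real_derivative f' w) (at w)" for w
    unfolding f_def[abs_def]
    by (rule derivative_eq_intros derF std_normal_density_deriv refl)+
      (use pos[of w] in \<open>auto simp: f'_def f_def field_simps\<close>)
  have der_f': "(f' has_real_derivative f'' w) (at w)" for w
    unfolding f'_def[abs_def] h0_def
    by (rule derivative_eq_intros der_f der refl)+ (auto simp: f''_def f'_def h0_def algebra_simps)
  have int_ind: "integrable ?N (\<lambda>x. indicator S x * h0 x)" if [measurable]: "S \<in> sets borel" for S
    using h0 by (intro integrable_bounded_std_normal[of _ 1]) (auto simp: indicator_def)
  have F_le: "\<bar>\<integral>x. indicator S x * h0 x \<partial>?N\<bar> \<le> measure ?N S"
    if [measurable]: "S \<in> sets borel" for S
  proof -
    have "\<bar>\<integral>x. indicator S x * h0 x \<partial>?N\<bar> \<le> (\<integral>x. \<bar>indicator S x * h0 x\<bar> \<partial>?N)"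
      by (rule integral_abs_bound)
    also have "\<dots> \<le> (\<integral>x. indicator S x \<partial>?N)"
    proof (intro integral_mono integrable_abs int_ind)
      show "integrable ?N (indicat_real S)"
        by (rule integrable_bounded_std_normal[of _ 1]) (auto simp: indicator_def)
    qed (use h0 in \<open>auto simp: indicator_def\<close>)
    finally show ?thesis
      by simp
  qed
  have F_bot: "\<bar>F w\<bar> \<le> cdf ?N w" for w
    unfolding F_def cdf_def by (rule F_le) simp
  \<comment> \<open>Centring makes the total integral vanish, so \<open>F\<close> is also minus an
    upper tail integral. This provides the decay at plus infinity that the a priori bound asks
    for.\<close>
  have F_top: "\<bar>F w\<bar> \<le> 1 - cdf ?N w" for w
  proof -
    have "(\<integral>x. h0 x \<partial>?N) = 0"
      unfolding h0_def m_def using inth std_normal.prob_space by simp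
    moreover have "(\<integral>x. h0 x \<partial>?N)
        = (\<integral>x. indicator {..w} x * h0 x + indicator {w<..} x * h0 x \<partial>?N)"
      by (intro Bochner_Integration.integral_cong) (auto simp: indicator_def)
    moreover have "\<dots> = F w + (\<integral>x. indicator {w<..} x * h0 x \<partial>?N)"
      unfolding F_def by (intro Bochner_Integration.integral_add int_ind) auto
    ultimately have "\<bar>F w\<bar> = \<bar>\<integral>x. indicator {w<..} x * h0 x \<partial>?N\<bar>"
      by linarith
    also have "\<dots> \<le> measure ?N {w<..}"
      by (rule F_le) simp
    also have "\<dots> = 1 - cdf ?N w"
      using std_normal.prob_compl[of "{..w}"] by (simp add: cdf_def Compl_eq_Diff_UNIV[symmetric])
    finally show ?thesis .
  qed
  have "(\<lambda>w. f w * ?\<phi> w) = F"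
    unfolding f_def by (auto simp: fun_eq_iff less_imp_neq[OF pos, symmetric])
  moreover have "(F \<longlongrightarrow> 0) at_bot"
    by (rule Lim_null_comparison[OF _ std_normal.cdf_lim_at_bot]) (auto simp: F_bot)
  moreover have "(F \<longlongrightarrow> 0) at_top"
  proof (rule Lim_null_comparison)
    show "((\<lambda>w. 1 - cdf ?N w) \<longlongrightarrow> 0) at_top"
      using tendsto_diff[OF tendsto_const std_normal.cdf_lim_at_top_prob, of 1] by simp
  qed (auto simp: F_top)
  ultimately have f: "\<bar>f w\<bar> \<le> 5" "\<bar>f' w\<bar> \<le> 2" for w
    using stein_ode_bound[of f h0 1 w] der_f h0 unfolding f'_def by auto
  \<comment> \<open>The boundary condition for the second use of the a priori bound costs nothing,
    since \<open>f'\<close> is already known to be bounded.\<close>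
  have lim: "((\<lambda>w. f' w * ?\<phi> w) \<longlongrightarrow> 0) G" if "(?\<phi> \<longlongrightarrow> 0) G" for G
  proof (rule Lim_null_comparison)
    show "\<forall>\<^sub>F w in G. norm (f' w * ?\<phi> w) \<le> 2 * ?\<phi> w"
      using f(2) by (intro always_eventually) (auto simp: abs_mult intro!: mult_right_mono)
    show "((\<lambda>w. 2 * ?\<phi> w) \<longlongrightarrow> 0) G"
      using tendsto_mult_right_zero[OF that] by simp
  qed
  have "\<bar>f w + h' w\<bar> \<le> 5 + L" for w
    using f(1)[of w] bnd'[of w] by linarith
  then have "\<bar>f'' w\<bar> \<le> 2 * (5 + L)" for w
    unfolding f''_def
    using der_f' lim[OF std_normal_density_at_top] lim[OF std_normal_density_at_bot]
    by (intro stein_ode_bound(2)[of f' "\<lambda>w. f w + h' w"]) (auto simp: f''_def)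
  then show thesis
    using that[of f f' f''] der_f der_f' f by (auto simp: f'_def h0_def m_def)
qed

section \<open>Smoothed indicators\<close>

lemma pos_part_square_deriv:
  "((\<lambda>y::real. (max 0 y)\<^sup>2) has_real_derivative 2 * max 0 y) (at y)"
proof -
  consider "y > 0" | "y < 0" | "y = 0"
    by linarith
  then show ?thesis
  proof cases
    case 1
    have "((\<lambda>y::real. y\<^sup>2) has_real_derivative 2 * max 0 y) (at y)"
      using 1 by (auto intro!: derivative_eq_intros)
    then show ?thesis
      by (rule has_field_derivative_transform_within_open[where S="{0<..}"]) (use 1 in auto)
  next
    case 2
    have "((\<lambda>y::real. 0) has_real_derivative 2 * max 0 y) (at y)"
      using 2 by (auto intro!: derivative_eq_intros)
    then show ?thesis
      by (rule has_field_derivative_transform_within_open[where S="{..<0}"]) (use 2 in auto)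
  next
    case 3
    have "((\<lambda>h::real. ((max 0 h)\<^sup>2 - (max 0 0)\<^sup>2) / (h - 0)) \<longlongrightarrow> 0) (at 0)"
    proof (rule Lim_null_comparison)
      show "\<forall>\<^sub>F h in at (0::real). norm (((max 0 h)\<^sup>2 - (max 0 0)\<^sup>2) / (h - 0)) \<le> \<bar>h\<bar>"
        by (rule always_eventually) (auto simp: max_def power2_eq_square)
      show "((\<lambda>h::real. \<bar>h\<bar>) \<longlongrightarrow> 0) (at 0)"
        using tendsto_rabs[OF tendsto_ident_at[of "0::real" UNIV]] by simp
    qed
    then show ?thesis
      using 3 by (simp add: has_field_derivative_iff)
  qed
qed

text \<open>A quadratic spline falling from 1 to 0, with knots 0, 1/2 and 1: first
  \<open>1 - 2 * y\<^sup>2\<close>, then \<open>2 * (1 - y)\<^sup>2\<close>. Truncated squares give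
  it a derivative with one formula on the whole line, as \<open>stein_solution\<close> wants; a
  linear ramp has corners.\<close>

definition smooth_step :: "real \<Rightarrow> real" where
  "smooth_step y = 1 - 2 * (max 0 y)\<^sup>2 + 4 * (max 0 (y - 1/2))\<^sup>2 - 2 * (max 0 (y - 1))\<^sup>2"

text \<open>A downward tent over \<open>[0, 1]\<close> with tip -2 at 1/2.\<close>

definition smooth_step' :: "real \<Rightarrow> real" where
  "smooth_step' y = - 4 * max 0 y + 8 * max 0 (y - 1/2) - 4 * max 0 (y - 1)"

lemma smooth_step_deriv: "(smooth_step has_real_derivative smooth_step' y) (at y)"
proof -
  have *: "((\<lambda>y::real. (max 0 (y - c))\<^sup>2) has_real_derivative 2 * max 0 (y - c)) (at y)" for c
    by (rule DERIV_cong[OF DERIV_chain2[where f = "\<lambda>y. (max 0 y)\<^sup>2", OF pos_part_square_deriv]])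
      (auto intro!: derivative_eq_intros)
  show ?thesis
    unfolding smooth_step_def[abs_def] smooth_step'_def
    by (rule derivative_eq_intros * pos_part_square_deriv refl)+ simp
qed

lemma abs_smooth_step'_le: "\<bar>smooth_step' y\<bar> \<le> 2"
  by (auto simp: smooth_step'_def max_def)

lemma smooth_step_bounds: "0 \<le> smooth_step y" "smooth_step y \<le> 1"
proof -
  consider "y \<le> 0" | "0 \<le> y" "y \<le> 1/2" | "1/2 \<le> y" "y \<le> 1" | "1 \<le> y"
    by linarith
  then have "0 \<le> smooth_step y \<and> smooth_step y \<le> 1"
  proof cases
    case 2
    then have "y\<^sup>2 \<le> (1/2)\<^sup>2"
      by (intro power_mono)
    moreover have "smooth_step y = 1 - 2 * y\<^sup>2"
      using 2 by (auto simp: smooth_step_def max_def)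
    ultimately show ?thesis
      by (simp add: power2_eq_square)
  next
    case 3
    then have "smooth_step y = 2 * (1 - y)\<^sup>2"
      by (simp add: smooth_step_def max_def power2_eq_square algebra_simps)
    moreover have "(1 - y)\<^sup>2 \<le> (1/2)\<^sup>2"
      using 3 by (intro power_mono) auto
    ultimately show ?thesis
      by (simp add: power2_eq_square)
  qed (auto simp: smooth_step_def max_def power2_eq_square algebra_simps)
  then show "0 \<le> smooth_step y" "smooth_step y \<le> 1"
    by auto
qed

lemma smooth_step_eq_1: "y \<le> 0 \<Longrightarrow> smooth_step y = 1"
  by (simp add: smooth_step_def max_def)

lemma smooth_step_eq_0: "1 \<le> y \<Longrightarrow> smooth_step y = 0"
  by (simp add: smooth_step_def max_def power2_eq_square algebra_simps)

lemma stein_smooth_step: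
  fixes x \<epsilon> :: real
  assumes \<epsilon>: "0 < \<epsilon>" "\<epsilon> \<le> 1"
  obtains f f' f'' :: "real \<Rightarrow> real" where
    "\<And>w. (f has_real_derivative f' w) (at w)"
    "\<And>w. (f' has_real_derivative f'' w) (at w)"
    "\<And>w. f' w - w * f w = smooth_step ((w - x) / \<epsilon>) -
      (\<integral>z. smooth_step ((z - x) / \<epsilon>) \<partial>std_normal_distribution)"
    "\<And>w. \<bar>f w\<bar> \<le> 5" "\<And>w. \<bar>f' w\<bar> \<le> 2" "\<And>w. \<bar>f'' w\<bar> \<le> 14 / \<epsilon>"
proof -
  have der: "((\<lambda>w. smooth_step ((w - x) / \<epsilon>)) has_real_derivative smooth_step' ((w - x) / \<epsilon>) / \<epsilon>) (at w)"
    for w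
    by (rule DERIV_cong[OF DERIV_chain2[where f = smooth_step, OF smooth_step_deriv]])
      (use \<epsilon> in \<open>auto intro!: derivative_eq_intros\<close>)
  have bnd: "0 \<le> smooth_step ((w - x) / \<epsilon>) \<and> smooth_step ((w - x) / \<epsilon>) \<le> 1" for w
    using smooth_step_bounds by auto
  have bnd': "\<bar>smooth_step' ((w - x) / \<epsilon>) / \<epsilon>\<bar> \<le> 2 / \<epsilon>" for w
    using abs_smooth_step'_le[of "(w - x) / \<epsilon>"] \<epsilon> by (simp add: abs_div divide_right_mono)
  \<comment> \<open>Here \<open>\<epsilon> \<le> 1\<close> absorbs the constant 10 into
    \<open>10 / \<epsilon>\<close>.\<close>
  have le: "2 * (5 + 2 / \<epsilon>) \<le> 14 / \<epsilon>"
    using \<epsilon> by (simp add: field_simps)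
  obtain f f' f'' :: "real \<Rightarrow> real" where
    "\<And>w. (f has_real_derivative f' w) (at w)"
    "\<And>w. (f' has_real_derivative f'' w) (at w)"
    "\<And>w. f' w - w * f w = smooth_step ((w - x) / \<epsilon>) -
      (\<integral>z. smooth_step ((z - x) / \<epsilon>) \<partial>std_normal_distribution)"
    "\<And>w. \<bar>f w\<bar> \<le> 5" "\<And>w. \<bar>f' w\<bar> \<le> 2" and f'': "\<And>w. \<bar>f'' w\<bar> \<le> 2 * (5 + 2 / \<epsilon>)"
    using stein_solution[OF der bnd bnd'] by blast
  moreover have "\<bar>f'' w\<bar> \<le> 14 / \<epsilon>" for w
    using order_trans[OF f'' le] .
  ultimately show thesis
    using that by blast
qed

section \<open>Stein's method for locally dependent sums\<close>

text \<open>This class is closed under all the arithmetic used below, so that integrability of every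
  polynomial expression in the indicators follows from one set of introduction rules.\<close>

definition bounded_rv :: "'a measure \<Rightarrow> ('a \<Rightarrow> real) \<Rightarrow> bool" where
  "bounded_rv M g \<longleftrightarrow> g \<in> borel_measurable M \<and> (\<exists>c. \<forall>\<omega>\<in>space M. \<bar>g \<omega>\<bar> \<le> c)"

lemma bounded_rvI:
  "g \<in> borel_measurable M \<Longrightarrow> (\<And>x. x \<in> space M \<Longrightarrow> \<bar>g x\<bar> \<le> c) \<Longrightarrow> bounded_rv M g"
  unfolding bounded_rv_def by auto

lemma bounded_rv_measurable[measurable_dest]: "bounded_rv M g \<Longrightarrow> g \<in> borel_measurable M"
  unfolding bounded_rv_def by simp

lemma (in finite_measure) bounded_rv_integrable: "bounded_rv M g \<Longrightarrow> integrable M g"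
  unfolding bounded_rv_def by (auto intro!: integrable_const_bound AE_I2)

lemma bounded_rv_const: "bounded_rv M (\<lambda>_. c)"
  by (rule bounded_rvI[of _ _ "\<bar>c\<bar>"]) auto

lemma bounded_rv_add:
  assumes "bounded_rv M f" "bounded_rv M g"
  shows "bounded_rv M (\<lambda>x. f x + g x)"
proof -
  obtain c d where cd: "\<And>x. x \<in> space M \<Longrightarrow> \<bar>f x\<bar> \<le> c" "\<And>x. x \<in> space M \<Longrightarrow> \<bar>g x\<bar> \<le> d"
    using assms unfolding bounded_rv_def by blast
  show ?thesis
  proof (rule bounded_rvI)
    show "(\<lambda>x. f x + g x) \<in> borel_measurable M"
      using assms by (intro borel_measurable_add bounded_rv_measurable)
    show "\<bar>f x + g x\<bar> \<le> c + d" if "x \<in> space M" for x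
      using cd[OF that] by linarith
  qed
qed

lemma bounded_rv_mult:
  assumes "bounded_rv M f" "bounded_rv M g"
  shows "bounded_rv M (\<lambda>x. f x * g x)"
proof -
  obtain c d where cd: "\<And>x. x \<in> space M \<Longrightarrow> \<bar>f x\<bar> \<le> c" "\<And>x. x \<in> space M \<Longrightarrow> \<bar>g x\<bar> \<le> d"
    using assms unfolding bounded_rv_def by blast
  show ?thesis
  proof (rule bounded_rvI)
    show "(\<lambda>x. f x * g x) \<in> borel_measurable M"
      using assms by (intro borel_measurable_times bounded_rv_measurable)
    show "\<bar>f x * g x\<bar> \<le> \<bar>c\<bar> * \<bar>d\<bar>" if "x \<in> space M" for x
      unfolding abs_mult using cd[OF that] by (intro mult_mono) linarith+
  qed
qed

lemma bounded_rv_uminus: "bounded_rv M f \<Longrightarrow> bounded_rv M (\<lambda>x. - f x)"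
  using bounded_rv_mult[OF bounded_rv_const[of M "-1"], of f] by simp

lemma bounded_rv_diff: "bounded_rv M f \<Longrightarrow> bounded_rv M g \<Longrightarrow> bounded_rv M (\<lambda>x. f x - g x)"
  using bounded_rv_add[of M f "\<lambda>x. - g x"] bounded_rv_uminus[of M g] by simp

lemma bounded_rv_abs: "bounded_rv M f \<Longrightarrow> bounded_rv M (\<lambda>x. \<bar>f x\<bar>)"
  unfolding bounded_rv_def by auto

lemma bounded_rv_power: "bounded_rv M f \<Longrightarrow> bounded_rv M (\<lambda>x. f x ^ m)"
  by (induction m) (auto intro: bounded_rv_const bounded_rv_mult)

lemma bounded_rv_divide: "bounded_rv M f \<Longrightarrow> bounded_rv M (\<lambda>x. f x / c)"
  using bounded_rv_mult[OF bounded_rv_const[of M "1 / c"], of f] by simp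

lemma bounded_rv_sum:
  "(\<And>i. i \<in> I \<Longrightarrow> bounded_rv M (f i)) \<Longrightarrow> bounded_rv M (\<lambda>x. \<Sum>i\<in>I. f i x)"
  by (induction I rule: infinite_finite_induct) (auto intro: bounded_rv_const bounded_rv_add)

lemma bounded_rv_compose:
  assumes "g \<in> borel_measurable M" "f \<in> borel_measurable borel" "\<And>x. \<bar>f x\<bar> \<le> c"
  shows "bounded_rv M (\<lambda>x. f (g x))"
  using assms by (intro bounded_rvI[of _ _ c]) auto

lemmas bounded_rv_intros =
  bounded_rv_const bounded_rv_add bounded_rv_mult bounded_rv_uminus bounded_rv_diff
  bounded_rv_abs bounded_rv_power bounded_rv_divide bounded_rv_sum

lemma (in prob_space) expectation_mono_bounded:
  assumes "bounded_rv M f" "bounded_rv M g" "\<And>x. x \<in> space M \<Longrightarrow> f x \<le> g x"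
  shows "expectation f \<le> expectation g"
  using assms by (intro integral_mono bounded_rv_integrable)

lemma (in prob_space) abs_expectation_le:
  assumes "bounded_rv M f" "bounded_rv M g" "\<And>x. x \<in> space M \<Longrightarrow> \<bar>f x\<bar> \<le> g x"
  shows "\<bar>expectation f\<bar> \<le> expectation g"
proof -
  have "\<bar>expectation f\<bar> \<le> expectation (\<lambda>x. \<bar>f x\<bar>)"
    by (rule integral_abs_bound)
  also have "\<dots> \<le> expectation g"
    using assms by (intro expectation_mono_bounded bounded_rv_intros)
  finally show ?thesis .
qed

lemma (in prob_space) expectation_indep_mult:
  assumes "indep_var borel X borel Y" "bounded_rv M X" "bounded_rv M Y"
  shows "expectation (\<lambda>x. X x * Y x) = expectation X * expectation Y"
  using indep_var_lebesgue_integral[OF assms(1)] assms(2,3) bounded_rv_integrable by auto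

section \<open>The Stein error under local dependence\<close>

text \<open>The mean value theorem, used for \<open>f\<close> and then for \<open>f'\<close>. The
  expansion is taken at \<open>b\<close> because the Stein argument needs the derivative at the full
  sum \<open>W\<close>, not at the reduced sum.\<close>

lemma lipschitz_taylor:
  fixes f f' f'' :: "real \<Rightarrow> real"
  assumes f: "\<And>w. (f has_real_derivative f' w) (at w)"
    and f': "\<And>w. (f' has_real_derivative f'' w) (at w)"
    and L: "\<And>w. \<bar>f'' w\<bar> \<le> L"
  shows "\<bar>f' b - f' a\<bar> \<le> L * \<bar>b - a\<bar>" and "\<bar>f b - f a - (b - a) * f' b\<bar> \<le> L * (b - a)\<^sup>2"
proof -
  have *: "\<exists>z. \<bar>z - b\<bar> \<le> \<bar>b - a\<bar> \<and> g b - g a = (b - a) * g' z"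
    if g: "\<And>w. (g has_real_derivative g' w) (at w)" for g g' :: "real \<Rightarrow> real" and a b
  proof -
    consider "a = b" | "a < b" | "b < a"
      by linarith
    then show ?thesis
    proof cases
      case 2
      then obtain z where "a < z" "z < b" "g b - g a = (b - a) * g' z"
        using MVT2[OF 2 g] by blast
      then show ?thesis
        by (intro exI[of _ z]) auto
    next
      case 3
      then obtain z where "b < z" "z < a" "g a - g b = (a - b) * g' z"
        using MVT2[OF 3 g] by blast
      then show ?thesis
        by (intro exI[of _ z]) (auto simp: algebra_simps)
    qed auto
  qed
  have lip: "\<bar>f' b - f' a\<bar> \<le> L * \<bar>b - a\<bar>" for a b
  proof -
    obtain z where "f' b - f' a = (b - a) * f'' z"
      using *[OF f', of b a] by auto
    then show ?thesis
      using L[of z] by (simp add: abs_mult mult.commute mult_right_mono)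
  qed
  then show "\<bar>f' b - f' a\<bar> \<le> L * \<bar>b - a\<bar>" .
  obtain z where z: "\<bar>z - b\<bar> \<le> \<bar>b - a\<bar>" "f b - f a = (b - a) * f' z"
    using *[OF f, of b a] by auto
  have L0: "0 \<le> L"
    using L[of 0] abs_ge_zero[of "f'' 0"] by linarith
  have "\<bar>f b - f a - (b - a) * f' b\<bar> = \<bar>b - a\<bar> * \<bar>f' z - f' b\<bar>"
    unfolding abs_mult[symmetric] using z(2) by (simp add: right_diff_distrib)
  also have "\<dots> \<le> \<bar>b - a\<bar> * (L * \<bar>z - b\<bar>)"
    using lip[of z b] by (intro mult_left_mono) auto
  also have "\<dots> \<le> \<bar>b - a\<bar> * (L * \<bar>b - a\<bar>)"
    using z(1) L0 by (intro mult_left_mono) auto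
  also have "\<dots> = L * \<bar>b - a\<bar>\<^sup>2"
    by (simp only: power2_eq_square mult.left_commute)
  finally show "\<bar>f b - f a - (b - a) * f' b\<bar> \<le> L * (b - a)\<^sup>2"
    by simp
qed

text \<open>Two decouplings do the work. Removing the neighbours of \<open>i\<close> from
  \<open>W\<close> leaves a sum independent of \<open>\<xi> i\<close>, so only a first-order term
  and a Taylor remainder survive. Removing the neighbours of \<open>i\<close> and \<open>j\<close>
  leaves a sum independent of \<open>\<xi> i x * \<xi> j x\<close>, so the first-order term nearly
  cancels against the expectation of \<open>f' (W x)\<close>.\<close>

theorem (in prob_space) stein_local_dependence:
  fixes \<xi> :: "'i \<Rightarrow> 'a \<Rightarrow> real" and D :: "'i \<Rightarrow> 'i \<Rightarrow> bool"
    and I :: "'i set" and f f' f'' :: "real \<Rightarrow> real"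
  defines "W \<equiv> \<lambda>x. \<Sum>i\<in>I. \<xi> i x"
  assumes fin: "finite I"
    and bnd: "\<And>i. i \<in> I \<Longrightarrow> bounded_rv M (\<xi> i)"
    and mean: "\<And>i. i \<in> I \<Longrightarrow> expectation (\<xi> i) = 0"
    and var: "expectation (\<lambda>x. (W x)\<^sup>2) = 1"
    and indep1: "\<And>i. i \<in> I \<Longrightarrow>
      indep_var borel (\<xi> i) borel (\<lambda>x. \<Sum>j\<in>{j\<in>I. \<not> D i j}. \<xi> j x)"
    and indep2: "\<And>i j. i \<in> I \<Longrightarrow> j \<in> I \<Longrightarrow> D i j \<Longrightarrow>
      indep_var borel (\<lambda>x. \<xi> i x * \<xi> j x) borel
        (\<lambda>x. \<Sum>l\<in>{l\<in>I. \<not> (D i l \<or> D j l)}. \<xi> l x)"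
    and f: "\<And>w. (f has_real_derivative f' w) (at w)"
    and f': "\<And>w. (f' has_real_derivative f'' w) (at w)"
    and fb: "\<And>w. \<bar>f w\<bar> \<le> c" and fb': "\<And>w. \<bar>f' w\<bar> \<le> c'" and L: "\<And>w. \<bar>f'' w\<bar> \<le> L"
  shows "\<bar>expectation (\<lambda>x. f' (W x) - W x * f (W x))\<bar> \<le>
    L * (\<Sum>i\<in>I. \<Sum>j\<in>{j\<in>I. D i j}. \<Sum>l\<in>{l\<in>I. D i l \<or> D j l}.
      2 * expectation (\<lambda>x. \<bar>\<xi> i x * \<xi> j x * \<xi> l x\<bar>) +
      expectation (\<lambda>x. \<bar>\<xi> i x * \<xi> j x\<bar>) * expectation (\<lambda>x. \<bar>\<xi> l x\<bar>))"
proof -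
  have contf: "isCont f x" "isCont f' x" for x
    using f f' DERIV_isCont by blast+
  have [measurable]: "f \<in> borel_measurable borel" "f' \<in> borel_measurable borel"
    using contf by (auto intro!: borel_measurable_continuous_onI continuous_at_imp_continuous_on)
  have L0: "0 \<le> L"
    using L[of 0] abs_ge_zero[of "f'' 0"] by linarith
  note lip = lipschitz_taylor[of f f' f'' L, OF f f' L]
  note int = bounded_rv_integrable
  define Wi where "Wi i x = (\<Sum>j\<in>{j\<in>I. \<not> D i j}. \<xi> j x)" for i x
  define Z where "Z i x = (\<Sum>j\<in>{j\<in>I. D i j}. \<xi> j x)" for i x
  define Wij where "Wij i j x = (\<Sum>l\<in>{l\<in>I. \<not> (D i l \<or> D j l)}. \<xi> l x)" for i j x
  define V where "V i j x = (\<Sum>l\<in>{l\<in>I. D i l \<or> D j l}. \<bar>\<xi> l x\<bar>)" for i j x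
  have split: "W x = (\<Sum>j\<in>{j\<in>I. \<not> P j}. \<xi> j x) + (\<Sum>j\<in>{j\<in>I. P j}. \<xi> j x)" for P x
    unfolding W_def using fin by (subst sum.union_disjoint[symmetric]) (auto intro!: sum.cong)
  have bW: "bounded_rv M W"
    unfolding W_def by (intro bounded_rv_sum bnd)
  have bWi: "bounded_rv M (Wi i)" and bZ: "bounded_rv M (Z i)"
    and bWij: "bounded_rv M (Wij i j)" and bV: "bounded_rv M (V i j)" for i j
    unfolding Wi_def[abs_def] Z_def[abs_def] Wij_def[abs_def] V_def[abs_def]
    by (auto intro!: bounded_rv_sum bounded_rv_abs bnd)
  have bf: "bounded_rv M (\<lambda>x. f (g x))" "bounded_rv M (\<lambda>x. f' (g x))" if "bounded_rv M g" for g
    using bounded_rv_compose[of g M f c] bounded_rv_compose[of g M f' c'] bounded_rv_measurable[OF that] fb fb'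
    by simp_all
  note bI = bounded_rv_intros bnd bW bWi bZ bWij bV bf

  \<comment> \<open>The term with \<open>Wi\<close> has expectation 0 by independence and centring;
    subtracting it turns the left side into a second-order remainder with
    \<open>Z i = W - Wi i\<close>.\<close>
  have step1: "\<bar>expectation (\<lambda>x. \<xi> i x * f (W x)) - expectation (\<lambda>x. \<xi> i x * (Z i x * f' (W x)))\<bar>
      \<le> L * (\<Sum>j\<in>{j\<in>I. D i j}. expectation (\<lambda>x. \<bar>\<xi> i x * \<xi> j x\<bar> * V i j x))"
    if i: "i \<in> I" for i
  proof -
    have "expectation (\<lambda>x. \<xi> i x * f (Wi i x)) = 0"
    proof -
      have "indep_var borel (\<xi> i) borel (f \<circ> Wi i)"
        using indep_var_compose[OF indep1[OF i], of "\<lambda>x. x" borel f borel]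
        by (simp add: comp_def Wi_def[abs_def])
      then show ?thesis
        using expectation_indep_mult[of "\<xi> i" "f \<circ> Wi i"] mean[OF i] i by (simp add: comp_def bI)
    qed
    then have "expectation (\<lambda>x. \<xi> i x * f (W x)) - expectation (\<lambda>x. \<xi> i x * (Z i x * f' (W x)))
        = expectation (\<lambda>x. \<xi> i x * f (W x)) - expectation (\<lambda>x. \<xi> i x * f (Wi i x))
          - expectation (\<lambda>x. \<xi> i x * (Z i x * f' (W x)))"
      by simp
    also have "\<dots> = expectation (\<lambda>x. \<xi> i x * f (W x) - \<xi> i x * f (Wi i x) - \<xi> i x * (Z i x * f' (W x)))"
      using i by (simp add: int bI)
    also have "\<bar>\<dots>\<bar> \<le> expectation (\<lambda>x. L * (\<Sum>j\<in>{j\<in>I. D i j}. \<bar>\<xi> i x * \<xi> j x\<bar> * V i j x))"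
    proof (rule abs_expectation_le)
      fix x assume "x \<in> space M"
      have eq: "W x - Wi i x = Z i x"
        using split[of x "D i"] by (simp add: Wi_def Z_def)
      have "\<bar>\<xi> i x * f (W x) - \<xi> i x * f (Wi i x) - \<xi> i x * (Z i x * f' (W x))\<bar>
          = \<bar>\<xi> i x\<bar> * \<bar>f (W x) - f (Wi i x) - Z i x * f' (W x)\<bar>"
        by (simp add: abs_mult[symmetric] algebra_simps)
      also have "\<dots> \<le> \<bar>\<xi> i x\<bar> * (L * (Z i x)\<^sup>2)"
        using lip(2)[of "W x" "Wi i x"] unfolding eq by (intro mult_left_mono) auto
      also have "\<dots> = L * (\<bar>\<xi> i x\<bar> * (\<bar>Z i x\<bar> * \<bar>Z i x\<bar>))"
        by (simp add: power2_eq_square abs_mult_self_eq mult.left_commute)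
      also have "\<dots> \<le> L * (\<bar>\<xi> i x\<bar> * (\<Sum>j\<in>{j\<in>I. D i j}. \<bar>\<xi> j x\<bar> * V i j x))"
      proof -
        have Zle: "\<bar>Z i x\<bar> \<le> (\<Sum>j\<in>{j\<in>I. D i j}. \<bar>\<xi> j x\<bar>)"
          unfolding Z_def by (rule sum_abs)
        have "\<bar>Z i x\<bar> * \<bar>Z i x\<bar> \<le> (\<Sum>j\<in>{j\<in>I. D i j}. \<bar>\<xi> j x\<bar>) * \<bar>Z i x\<bar>"
          using Zle by (intro mult_right_mono) auto
        also have "\<dots> = (\<Sum>j\<in>{j\<in>I. D i j}. \<bar>\<xi> j x\<bar> * \<bar>Z i x\<bar>)"
          by (rule sum_distrib_right)
        \<comment> \<open>\<open>V i j\<close> also runs over the neighbours of \<open>j\<close>.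
          This coarsening gives the remainder the same shape as the one in
          \<open>step2\<close>.\<close>
        also have "\<dots> \<le> (\<Sum>j\<in>{j\<in>I. D i j}. \<bar>\<xi> j x\<bar> * V i j x)"
        proof (intro sum_mono mult_left_mono)
          fix j
          have "(\<Sum>j\<in>{j\<in>I. D i j}. \<bar>\<xi> j x\<bar>) \<le> V i j x"
            unfolding V_def using fin by (intro sum_mono2) auto
          with Zle show "\<bar>Z i x\<bar> \<le> V i j x"
            by linarith
        qed auto
        finally show ?thesis
          by (intro mult_left_mono L0) auto
      qed
      also have "\<dots> = L * (\<Sum>j\<in>{j\<in>I. D i j}. \<bar>\<xi> i x * \<xi> j x\<bar> * V i j x)"
        by (simp add: sum_distrib_left abs_mult mult.assoc)
      finally show "\<bar>\<xi> i x * f (W x) - \<xi> i x * f (Wi i x) - \<xi> i x * (Z i x * f' (W x))\<bar> \<le> \<dots>" .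
    qed (use i in \<open>auto intro!: bI\<close>)
    also have "\<dots> = L * (\<Sum>j\<in>{j\<in>I. D i j}. expectation (\<lambda>x. \<bar>\<xi> i x * \<xi> j x\<bar> * V i j x))"
      using i by (simp add: int bI)
    finally show ?thesis .
  qed

  \<comment> \<open>\<open>f' (W x)\<close> is replaced by \<open>f' (Wij i j x)\<close> both inside
    the joint expectation and inside the separate factor; the two replacement errors are the two
    terms on the right.\<close>
  have step2: "\<bar>expectation (\<lambda>x. \<xi> i x * \<xi> j x * f' (W x))
        - expectation (\<lambda>x. \<xi> i x * \<xi> j x) * expectation (\<lambda>x. f' (W x))\<bar>
      \<le> L * (expectation (\<lambda>x. \<bar>\<xi> i x * \<xi> j x\<bar> * V i j x)
          + expectation (\<lambda>x. \<bar>\<xi> i x * \<xi> j x\<bar>) * expectation (V i j))"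
    if i: "i \<in> I" and j: "j \<in> I" and Dij: "D i j" for i j
  proof -
    let ?A = "\<lambda>x. \<xi> i x * \<xi> j x"
    have diff: "\<bar>f' (W x) - f' (Wij i j x)\<bar> \<le> L * V i j x" for x
    proof -
      have "W x - Wij i j x = (\<Sum>l\<in>{l\<in>I. D i l \<or> D j l}. \<xi> l x)"
        using split[of x "\<lambda>l. D i l \<or> D j l"] by (simp add: Wij_def)
      then have "\<bar>W x - Wij i j x\<bar> \<le> V i j x"
        unfolding V_def using sum_abs by metis
      then show ?thesis
        using lip(1)[of "W x" "Wij i j x"] mult_left_mono[OF _ L0] by (meson order_trans)
    qed
    have "indep_var borel ?A borel (f' \<circ> Wij i j)"
      using indep_var_compose[OF indep2[OF i j Dij], of "\<lambda>x. x" borel f' borel]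
      by (simp add: comp_def Wij_def[abs_def])
    then have "expectation (\<lambda>x. ?A x * f' (Wij i j x)) = expectation ?A * expectation (\<lambda>x. f' (Wij i j x))"
      using expectation_indep_mult[of ?A "f' \<circ> Wij i j"] i j by (simp add: comp_def bI)
    then have "expectation (\<lambda>x. ?A x * f' (W x)) - expectation ?A * expectation (\<lambda>x. f' (W x))
        = (expectation (\<lambda>x. ?A x * f' (W x)) - expectation (\<lambda>x. ?A x * f' (Wij i j x)))
          - expectation ?A * (expectation (\<lambda>x. f' (W x)) - expectation (\<lambda>x. f' (Wij i j x)))"
      by (simp add: algebra_simps)
    also have "\<dots> = expectation (\<lambda>x. ?A x * (f' (W x) - f' (Wij i j x)))
          - expectation ?A * expectation (\<lambda>x. f' (W x) - f' (Wij i j x))"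
      using i j by (simp add: int bI right_diff_distrib)
    finally have "\<bar>expectation (\<lambda>x. ?A x * f' (W x)) - expectation ?A * expectation (\<lambda>x. f' (W x))\<bar>
        \<le> \<bar>expectation (\<lambda>x. ?A x * (f' (W x) - f' (Wij i j x)))\<bar>
          + \<bar>expectation ?A\<bar> * \<bar>expectation (\<lambda>x. f' (W x) - f' (Wij i j x))\<bar>"
      by (simp only: abs_mult[symmetric] abs_triangle_ineq4)
    also have "\<dots> \<le> expectation (\<lambda>x. L * (\<bar>?A x\<bar> * V i j x))
          + expectation (\<lambda>x. \<bar>?A x\<bar>) * expectation (\<lambda>x. L * V i j x)"
    proof (intro add_mono mult_mono)
      show "\<bar>expectation (\<lambda>x. ?A x * (f' (W x) - f' (Wij i j x)))\<bar> \<le> expectation (\<lambda>x. L * (\<bar>?A x\<bar> * V i j x))"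
      proof (rule abs_expectation_le)
        fix x 
        have "\<bar>?A x * (f' (W x) - f' (Wij i j x))\<bar> \<le> \<bar>?A x\<bar> * (L * V i j x)"
          using diff[of x] unfolding abs_mult[of "?A x"] by (intro mult_left_mono) auto
        then show "\<bar>?A x * (f' (W x) - f' (Wij i j x))\<bar> \<le> L * (\<bar>?A x\<bar> * V i j x)"
          by (simp only: mult.left_commute)
      qed (use i j in \<open>auto intro!: bI\<close>)
      show "\<bar>expectation (\<lambda>x. f' (W x) - f' (Wij i j x))\<bar> \<le> expectation (\<lambda>x. L * V i j x)"
        using diff by (intro abs_expectation_le) (auto intro!: bI)
      show "\<bar>expectation ?A\<bar> \<le> expectation (\<lambda>x. \<bar>?A x\<bar>)"
        by (rule integral_abs_bound)
    qed auto
    finally show ?thesis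
      by (simp add: algebra_simps)
  qed

  \<comment> \<open>The far part of \<open>W\<close> is uncorrelated with \<open>\<xi> i\<close>, so
    the neighbouring covariances already add up to the second moment of \<open>W\<close>.\<close>
  have step3: "(\<Sum>i\<in>I. \<Sum>j\<in>{j\<in>I. D i j}. expectation (\<lambda>x. \<xi> i x * \<xi> j x)) = 1"
  proof -
    have "expectation (\<lambda>x. \<xi> i x * W x) = (\<Sum>j\<in>{j\<in>I. D i j}. expectation (\<lambda>x. \<xi> i x * \<xi> j x))"
      if i: "i \<in> I" for i
    proof -
      have "expectation (\<lambda>x. \<xi> i x * W x) = expectation (\<lambda>x. \<xi> i x * Wi i x + (\<Sum>j\<in>{j\<in>I. D i j}. \<xi> i x * \<xi> j x))"
        by (intro Bochner_Integration.integral_cong)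
          (auto simp: split[of _ "D i"] Wi_def sum_distrib_left distrib_left)
      also have "\<dots> = expectation (\<lambda>x. \<xi> i x * Wi i x)
          + expectation (\<lambda>x. \<Sum>j\<in>{j\<in>I. D i j}. \<xi> i x * \<xi> j x)"
        using i by (intro Bochner_Integration.integral_add int) (auto intro!: bI)
      also have "expectation (\<lambda>x. \<Sum>j\<in>{j\<in>I. D i j}. \<xi> i x * \<xi> j x)
          = (\<Sum>j\<in>{j\<in>I. D i j}. expectation (\<lambda>x. \<xi> i x * \<xi> j x))"
        using i by (intro Bochner_Integration.integral_sum int) (auto intro!: bI)
      also have "expectation (\<lambda>x. \<xi> i x * Wi i x) = 0"
        using expectation_indep_mult[OF indep1[OF i]] mean[OF i] i bnd[OF i] bWi
        by (simp add: Wi_def[abs_def])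
      finally show ?thesis
        by simp
    qed
    then have "(\<Sum>i\<in>I. \<Sum>j\<in>{j\<in>I. D i j}. expectation (\<lambda>x. \<xi> i x * \<xi> j x))
        = (\<Sum>i\<in>I. expectation (\<lambda>x. \<xi> i x * W x))"
      by simp
    also have "\<dots> = expectation (\<lambda>x. \<Sum>i\<in>I. \<xi> i x * W x)"
      by (simp add: int bI)
    also have "\<dots> = expectation (\<lambda>x. (W x)\<^sup>2)"
      by (simp add: W_def power2_eq_square sum_distrib_right)
    finally show ?thesis
      using var by simp
  qed

  let ?E3 = "\<lambda>i j. expectation (\<lambda>x. \<bar>\<xi> i x * \<xi> j x\<bar> * V i j x)"
  let ?E21 = "\<lambda>i j. expectation (\<lambda>x. \<bar>\<xi> i x * \<xi> j x\<bar>) * expectation (V i j)"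
  let ?N = "\<lambda>i. {j\<in>I. D i j}"
  have "expectation (\<lambda>x. f' (W x) - W x * f (W x))
      = expectation (\<lambda>x. f' (W x)) - (\<Sum>i\<in>I. expectation (\<lambda>x. \<xi> i x * f (W x)))"
  proof -
    have "expectation (\<lambda>x. f' (W x) - W x * f (W x))
        = expectation (\<lambda>x. f' (W x)) - expectation (\<lambda>x. W x * f (W x))"
      by (intro Bochner_Integration.integral_diff int) (auto intro!: bI)
    also have "expectation (\<lambda>x. W x * f (W x)) = expectation (\<lambda>x. \<Sum>i\<in>I. \<xi> i x * f (W x))"
      by (simp only: W_def sum_distrib_right)
    also have "\<dots> = (\<Sum>i\<in>I. expectation (\<lambda>x. \<xi> i x * f (W x)))"
      by (intro Bochner_Integration.integral_sum int) (auto intro!: bI)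
    finally show ?thesis .
  qed
  \<comment> \<open>The factor 1 in front of the expectation of \<open>f' (W x)\<close> is expanded
    by \<open>step3\<close>, which spreads that expectation over the neighbouring pairs.\<close>
  also have "\<dots> = (\<Sum>i\<in>I. \<Sum>j\<in>?N i. expectation (\<lambda>x. \<xi> i x * \<xi> j x) * expectation (\<lambda>x. f' (W x)))
      - (\<Sum>i\<in>I. expectation (\<lambda>x. \<xi> i x * f (W x)))"
    using step3 by (simp add: sum_distrib_right[symmetric])
  also have "\<dots> = (\<Sum>i\<in>I.
      - (expectation (\<lambda>x. \<xi> i x * f (W x)) - expectation (\<lambda>x. \<xi> i x * (Z i x * f' (W x))))
      - (\<Sum>j\<in>?N i. expectation (\<lambda>x. \<xi> i x * \<xi> j x * f' (W x))
        - expectation (\<lambda>x. \<xi> i x * \<xi> j x) * expectation (\<lambda>x. f' (W x))))" (is "_ = ?S")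
  proof -
    have "expectation (\<lambda>x. \<xi> i x * (Z i x * f' (W x))) = (\<Sum>j\<in>?N i. expectation (\<lambda>x. \<xi> i x * \<xi> j x * f' (W x)))"
      if "i \<in> I" for i
    proof -
      have "expectation (\<lambda>x. \<xi> i x * (Z i x * f' (W x))) = expectation (\<lambda>x. \<Sum>j\<in>?N i. \<xi> i x * \<xi> j x * f' (W x))"
        by (simp add: Z_def sum_distrib_left sum_distrib_right mult.assoc)
      then show ?thesis
        using that by (simp add: int bI)
    qed
    then show ?thesis
      by (simp add: sum_subtractf sum_negf)
  qed
  finally have eq: "expectation (\<lambda>x. f' (W x) - W x * f (W x)) = ?S" .
  have "\<bar>expectation (\<lambda>x. f' (W x) - W x * f (W x))\<bar> \<le> (\<Sum>i\<in>I. L * (\<Sum>j\<in>?N i. ?E3 i j) + (\<Sum>j\<in>?N i. L * (?E3 i j + ?E21 i j)))"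
    unfolding eq
  proof (intro order_trans[OF sum_abs] sum_mono)
    fix i assume i: "i \<in> I"
    have tri: "\<bar>- a - b\<bar> \<le> A + B" if "\<bar>a\<bar> \<le> A" "\<bar>b\<bar> \<le> B" for a b A B :: real
      using that by linarith
    show "\<bar>- (expectation (\<lambda>x. \<xi> i x * f (W x)) - expectation (\<lambda>x. \<xi> i x * (Z i x * f' (W x))))
      - (\<Sum>j\<in>?N i. expectation (\<lambda>x. \<xi> i x * \<xi> j x * f' (W x))
        - expectation (\<lambda>x. \<xi> i x * \<xi> j x) * expectation (\<lambda>x. f' (W x)))\<bar>
      \<le> L * (\<Sum>j\<in>?N i. ?E3 i j) + (\<Sum>j\<in>?N i. L * (?E3 i j + ?E21 i j))"
    proof (rule tri)
      show "\<bar>\<Sum>j\<in>?N i. expectation (\<lambda>x. \<xi> i x * \<xi> j x * f' (W x))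
          - expectation (\<lambda>x. \<xi> i x * \<xi> j x) * expectation (\<lambda>x. f' (W x))\<bar>
          \<le> (\<Sum>j\<in>?N i. L * (?E3 i j + ?E21 i j))"
        by (intro order_trans[OF sum_abs] sum_mono step2 i) auto
    qed (rule step1[OF i])
  qed
  \<comment> \<open>The coefficient 2 arises because \<open>?E3\<close> occurs once as the Taylor
    remainder and once as a decoupling error.\<close>
  also have "\<dots> = L * (\<Sum>i\<in>I. \<Sum>j\<in>?N i. 2 * ?E3 i j + ?E21 i j)"
  proof -
    have "L * sum a J + (\<Sum>j\<in>J. L * (a j + b j)) = L * (\<Sum>j\<in>J. 2 * a j + b j)"
      for a b :: "'i \<Rightarrow> real" and J
      by (simp add: sum.distrib sum_distrib_left[symmetric] distrib_left)
    then show ?thesis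
      by (simp only: sum_distrib_left[symmetric])
  qed
  also have "(\<Sum>i\<in>I. \<Sum>j\<in>?N i. 2 * ?E3 i j + ?E21 i j) = (\<Sum>i\<in>I. \<Sum>j\<in>?N i. \<Sum>l\<in>{l\<in>I. D i l \<or> D j l}.
      2 * expectation (\<lambda>x. \<bar>\<xi> i x * \<xi> j x * \<xi> l x\<bar>) +
      expectation (\<lambda>x. \<bar>\<xi> i x * \<xi> j x\<bar>) * expectation (\<lambda>x. \<bar>\<xi> l x\<bar>))"
  proof (intro sum.cong refl)
    fix i j assume "i \<in> I" "j \<in> ?N i"
    then have ij: "i \<in> I" "j \<in> I"
      by auto
    have "?E3 i j = expectation (\<lambda>x. \<Sum>l\<in>{l\<in>I. D i l \<or> D j l}. \<bar>\<xi> i x * \<xi> j x * \<xi> l x\<bar>)"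
      by (simp only: V_def sum_distrib_left abs_mult)
    also have "\<dots> = (\<Sum>l\<in>{l\<in>I. D i l \<or> D j l}. expectation (\<lambda>x. \<bar>\<xi> i x * \<xi> j x * \<xi> l x\<bar>))"
      using ij by (intro Bochner_Integration.integral_sum int) (auto intro!: bI)
    finally have E3: "?E3 i j = \<dots>" .
    have EV: "expectation (V i j) = (\<Sum>l\<in>{l\<in>I. D i l \<or> D j l}. expectation (\<lambda>x. \<bar>\<xi> l x\<bar>))"
      unfolding V_def[abs_def] by (intro Bochner_Integration.integral_sum int) (auto intro!: bI)
    show "2 * ?E3 i j + ?E21 i j = (\<Sum>l\<in>{l\<in>I. D i l \<or> D j l}.
      2 * expectation (\<lambda>x. \<bar>\<xi> i x * \<xi> j x * \<xi> l x\<bar>) +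
      expectation (\<lambda>x. \<bar>\<xi> i x * \<xi> j x\<bar>) * expectation (\<lambda>x. \<bar>\<xi> l x\<bar>))"
      unfolding E3 EV by (simp only: sum.distrib sum_distrib_left)
  qed
  finally show ?thesis .
qed

section \<open>From smooth test functions to the Kolmogorov distance\<close>

lemma (in prob_space) kolmogorov_dist_le:
  assumes bd: "\<And>x. cdf std_normal_distribution x - r \<le> prob {\<omega> \<in> space M. Y \<omega> \<le> x} \<and>
      prob {\<omega> \<in> space M. Y \<omega> \<le> x} \<le> cdf std_normal_distribution x + r"
  shows "kolmogorov_dist_normal M Y \<le> r"
  unfolding kolmogorov_dist_normal_def
proof (rule cSUP_least)
  fix x show "\<bar>prob {\<omega> \<in> space M. Y \<omega> \<le> x} - cdf std_normal_distribution x\<bar> \<le> r"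
    using bd[of x] by (simp add: abs_le_iff)
qed simp

lemma (in prob_space) kolmogorov_dist_le_1: "kolmogorov_dist_normal M Y \<le> 1"
proof (rule kolmogorov_dist_le)
  fix x
  show "cdf std_normal_distribution x - 1 \<le> prob {\<omega> \<in> space M. Y \<omega> \<le> x} \<and>
      prob {\<omega> \<in> space M. Y \<omega> \<le> x} \<le> cdf std_normal_distribution x + 1"
    using std_normal.cdf_bounded_prob[of x] std_normal.cdf_nonneg[of x]
      prob_le_1[of "{\<omega> \<in> space M. Y \<omega> \<le> x}"] measure_nonneg[of M "{\<omega> \<in> space M. Y \<omega> \<le> x}"]
    by linarith
qed

text \<open>A step smoothed over width \<open>\<epsilon>\<close> has Stein error
  \<open>14 / \<epsilon> * R\<close>, and the smoothing itself moves the normal distribution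
  function by at most \<open>\<epsilon>\<close>. The choice \<open>\<epsilon> = sqrt R\<close>
  balances the two and adds up to \<open>15 * sqrt R\<close>. If \<open>R > 1\<close> the bound
  exceeds 1 and is trivial, so \<open>\<epsilon> \<le> 1\<close> may be assumed.\<close>

theorem (in prob_space) stein_kolmogorov:
  assumes W: "bounded_rv M W" and R: "0 < R"
    and stein: "\<And>f f' f'' c c' L. (\<And>w. (f has_real_derivative f' w) (at w)) \<Longrightarrow>
      (\<And>w. (f' has_real_derivative f'' w) (at w)) \<Longrightarrow>
      (\<And>w. \<bar>f w\<bar> \<le> c) \<Longrightarrow> (\<And>w. \<bar>f' w\<bar> \<le> c') \<Longrightarrow> (\<And>w. \<bar>f'' w\<bar> \<le> L) \<Longrightarrow>
      \<bar>expectation (\<lambda>\<omega>. f' (W \<omega>) - W \<omega> * f (W \<omega>))\<bar> \<le> L * R"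
  shows "kolmogorov_dist_normal M W \<le> 15 * sqrt R"
proof (cases "R \<le> 1")
  case False
  then have "1 \<le> 15 * sqrt R"
    using real_sqrt_ge_one[of R] by linarith
  then show ?thesis
    using kolmogorov_dist_le_1[of W] by linarith
next
  case True
  define \<epsilon> where "\<epsilon> = sqrt R"
  have \<epsilon>: "0 < \<epsilon>" "\<epsilon> \<le> 1" "R = \<epsilon> * \<epsilon>"
    using R True by (auto simp: \<epsilon>_def)
  let ?\<Phi> = "cdf std_normal_distribution" and ?N = std_normal_distribution
  define s where "s x w = smooth_step ((w - x) / \<epsilon>)" for x w
  have [measurable]: "W \<in> borel_measurable M"
    using W by (rule bounded_rv_measurable)
  have "isCont smooth_step y" for y
    using smooth_step_deriv DERIV_isCont by blast
  then have [measurable]: "smooth_step \<in> borel_measurable borel"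
    by (intro borel_measurable_continuous_onI continuous_at_imp_continuous_on) auto
  have sb: "0 \<le> s x w" "s x w \<le> 1" for x w
    using smooth_step_bounds by (auto simp: s_def)
  have s1: "s x w = 1" if "w \<le> x" for x w
    using that \<epsilon> unfolding s_def by (intro smooth_step_eq_1) (auto simp: divide_le_0_iff)
  have s0: "s x w = 0" if "x + \<epsilon> \<le> w" for x w
    using that \<epsilon> unfolding s_def by (intro smooth_step_eq_0) (auto simp: field_simps)
  have [measurable]: "s x \<in> borel_measurable borel" for x
    unfolding s_def[abs_def] by measurable
  have ints: "integrable M (\<lambda>\<omega>. s x (W \<omega>))" and intN: "integrable ?N (s x)" for x
    using sb by (auto intro!: integrable_const_bound[of _ 1] integrable_bounded_std_normal[of _ 1])
  have close: "\<bar>expectation (\<lambda>\<omega>. s x (W \<omega>)) - (\<integral>z. s x z \<partial>?N)\<bar> \<le> 14 * \<epsilon>" for x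
  proof -
    obtain f f' f'' :: "real \<Rightarrow> real" where f:
      "\<And>w. (f has_real_derivative f' w) (at w)"
      "\<And>w. (f' has_real_derivative f'' w) (at w)"
      "\<And>w. f' w - w * f w = s x w - (\<integral>z. s x z \<partial>?N)"
      "\<And>w. \<bar>f w\<bar> \<le> 5" "\<And>w. \<bar>f' w\<bar> \<le> 2" "\<And>w. \<bar>f'' w\<bar> \<le> 14 / \<epsilon>"
      using stein_smooth_step[OF \<epsilon>(1,2), of x] unfolding s_def by blast
    have "expectation (\<lambda>\<omega>. s x (W \<omega>)) - (\<integral>z. s x z \<partial>?N) = expectation (\<lambda>\<omega>. f' (W \<omega>) - W \<omega> * f (W \<omega>))"
      unfolding f(3) using ints by (simp add: prob_space)
    also have "\<bar>\<dots>\<bar> \<le> 14 / \<epsilon> * R"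
      by (rule stein[OF f(1,2,4,5,6)])
    finally show ?thesis
      using \<epsilon> by simp
  qed
  have lower: "prob {\<omega> \<in> space M. W \<omega> \<le> x} \<le> expectation (\<lambda>\<omega>. s x (W \<omega>))"
    and upper: "expectation (\<lambda>\<omega>. s x (W \<omega>)) \<le> prob {\<omega> \<in> space M. W \<omega> \<le> x + \<epsilon>}" for x
  proof -
    have "prob {\<omega> \<in> space M. W \<omega> \<le> y} = expectation (indicator {\<omega> \<in> space M. W \<omega> \<le> y})" for y
      by simp
    moreover have "expectation (indicator {\<omega> \<in> space M. W \<omega> \<le> x}) \<le> expectation (\<lambda>\<omega>. s x (W \<omega>))"
      using sb s1 by (intro integral_mono ints) (auto simp: indicator_def emeasure_eq_measure)
    moreover have "expectation (\<lambda>\<omega>. s x (W \<omega>)) \<le> expectation (indicator {\<omega> \<in> space M. W \<omega> \<le> x + \<epsilon>})"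
      using sb s0 by (intro integral_mono ints) (auto simp: indicator_def emeasure_eq_measure)
    ultimately show "prob {\<omega> \<in> space M. W \<omega> \<le> x} \<le> expectation (\<lambda>\<omega>. s x (W \<omega>))"
      "expectation (\<lambda>\<omega>. s x (W \<omega>)) \<le> prob {\<omega> \<in> space M. W \<omega> \<le> x + \<epsilon>}"
      by simp_all
  qed
  have Nlower: "?\<Phi> x \<le> (\<integral>z. s x z \<partial>?N)" and Nupper: "(\<integral>z. s x z \<partial>?N) \<le> ?\<Phi> (x + \<epsilon>)" for x
  proof -
    have "?\<Phi> y = (\<integral>z. indicator {..y} z \<partial>?N)" for y
      by (simp add: cdf_def)
    moreover have "integrable ?N (indicat_real {..y})" for y
      by (rule integrable_bounded_std_normal[of _ 1]) (auto simp: indicator_def)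
    note int_ind = this
    moreover have "(\<integral>z. indicator {..x} z \<partial>?N) \<le> (\<integral>z. s x z \<partial>?N)"
      using sb s1 by (intro integral_mono intN int_ind) (auto simp: indicator_def)
    moreover have "(\<integral>z. s x z \<partial>?N) \<le> (\<integral>z. indicator {..x + \<epsilon>} z \<partial>?N)"
      using sb s0 by (intro integral_mono intN int_ind) (auto simp: indicator_def)
    ultimately show "?\<Phi> x \<le> (\<integral>z. s x z \<partial>?N)" "(\<integral>z. s x z \<partial>?N) \<le> ?\<Phi> (x + \<epsilon>)"
      by simp_all
  qed
  have "kolmogorov_dist_normal M W \<le> 15 * \<epsilon>"
  proof (rule kolmogorov_dist_le)
    fix x
    have "prob {\<omega> \<in> space M. W \<omega> \<le> x} \<le> ?\<Phi> x + 15 * \<epsilon>"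
      using lower[of x] close[of x] Nupper[of x] cdf_std_normal_lipschitz[of x "x + \<epsilon>"] \<epsilon>
      by (simp add: abs_le_iff)
    \<comment> \<open>For the lower bound the smoothed step is shifted to the left by
      \<open>\<epsilon>\<close>, so that it already vanishes beyond \<open>x\<close>.\<close>
    moreover have "?\<Phi> x - 15 * \<epsilon> \<le> prob {\<omega> \<in> space M. W \<omega> \<le> x}"
      using upper[of "x - \<epsilon>"] close[of "x - \<epsilon>"] Nlower[of "x - \<epsilon>"] cdf_std_normal_lipschitz[of "x - \<epsilon>" x] \<epsilon>
      by (simp add: abs_le_iff)
    ultimately show "?\<Phi> x - 15 * \<epsilon> \<le> prob {\<omega> \<in> space M. W \<omega> \<le> x} \<and>
      prob {\<omega> \<in> space M. W \<omega> \<le> x} \<le> ?\<Phi> x + 15 * \<epsilon>"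
      by simp
  qed
  then show ?thesis
    by (simp add: \<epsilon>_def)
qed

section \<open>Placements of the pattern graph\<close>

definition placements :: "nat \<Rightarrow> nat \<Rightarrow> (nat \<Rightarrow> nat) set" where
  "placements k n = {\<beta> \<in> {1..k} \<rightarrow>\<^sub>E {1..n}. inj_on \<beta> {1..k}}"

text \<open>A plain set of host edges: the joint presence of several copies is then the presence of
  the union of their edge sets, and its probability is controlled by the cardinality of that union
  alone.\<close>

definition copy_edges :: "nat set set \<Rightarrow> (nat \<Rightarrow> nat) \<Rightarrow> nat set set" where
  "copy_edges E \<beta> = (\<lambda>e. \<beta> ` e) ` E"

lemma finite_placements: "finite (placements k n)"
  unfolding placements_def by (rule finite_subset[OF _ finite_PiE[of "{1..k}" "\<lambda>_. {1..n}"]]) auto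

lemma placementsD:
  assumes "\<beta> \<in> placements k n"
  shows "inj_on \<beta> {1..k}" "\<beta> ` {1..k} \<subseteq> {1..n}" "\<beta> \<in> {1..k} \<rightarrow>\<^sub>E {1..n}"
  using assms unfolding placements_def by auto

lemma card_placements: "card (placements k n) = (\<Prod>i<k. n - i)"
proof -
  have "card {\<beta> \<in> {1..k} \<rightarrow>\<^sub>E {1..n}. inj_on \<beta> {1..k}} = (\<Prod>i = 0..<card {1..k}. card {1..n} - i)"
    using card_inj_on_subset_funcset[of "{1..k}" "{1..n}" "{1..k}"] by simp
  then show ?thesis
    by (simp add: placements_def lessThan_atLeast0)
qed

lemma card_placements_le: "card (placements k n) \<le> n ^ k"
  unfolding card_placements using prod_mono[of "{..<k}" "\<lambda>i. n - i" "\<lambda>_. n"] by simp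

lemma card_placements_ge:
  assumes "2 * k \<le> n"
  shows "(real n / 2) ^ k \<le> real (card (placements k n))"
proof -
  have "(real n / 2) ^ k = (\<Prod>i<k. real n / 2)"
    by simp
  also have "\<dots> \<le> (\<Prod>i<k. real (n - i))"
    using assms by (intro prod_mono) (auto simp: of_nat_diff)
  finally show ?thesis
    by (simp add: card_placements)
qed

lemma mem_vertex_pairs_iff: "e \<in> vertex_pairs V \<longleftrightarrow> e \<subseteq> V \<and> card e = 2"
proof
  assume "e \<in> vertex_pairs V"
  then show "e \<subseteq> V \<and> card e = 2"
    unfolding vertex_pairs_def by auto
next
  assume e: "e \<subseteq> V \<and> card e = 2"
  then obtain u v where "e = {u, v}" "u \<noteq> v"
    by (auto simp: card_2_iff)
  with e show "e \<in> vertex_pairs V"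
    unfolding vertex_pairs_def by auto
qed

lemma finite_vertex_pairs:
  assumes "finite V"
  shows "finite (vertex_pairs V)"
  by (rule finite_subset[of _ "Pow V"]) (use assms in \<open>auto simp: mem_vertex_pairs_iff\<close>)

lemma vertex_pairs_mono: "U \<subseteq> V \<Longrightarrow> vertex_pairs U \<subseteq> vertex_pairs V"
  by (meson mem_vertex_pairs_iff subset_iff)

lemma vertex_pairs_disjoint: "U \<inter> V = {} \<Longrightarrow> vertex_pairs U \<inter> vertex_pairs V = {}"
  unfolding vertex_pairs_def by (auto simp: doubleton_eq_iff)

lemma copy_edges_vertex_pairs:
  assumes "E \<subseteq> vertex_pairs V" "inj_on \<beta> V"
  shows "copy_edges E \<beta> \<subseteq> vertex_pairs (\<beta> ` V)"
proof
  fix f assume "f \<in> copy_edges E \<beta>"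
  then obtain e where e: "e \<in> E" "f = \<beta> ` e"
    unfolding copy_edges_def by auto
  then have "e \<in> vertex_pairs V"
    using assms(1) by auto
  then have "e \<subseteq> V" "card e = 2"
    unfolding mem_vertex_pairs_iff by simp_all
  then show "f \<in> vertex_pairs (\<beta> ` V)"
    using e card_image[of \<beta> e] inj_on_subset[OF assms(2)] by (auto simp: mem_vertex_pairs_iff)
qed

lemma inj_on_image_vertex_pairs:
  assumes "E \<subseteq> vertex_pairs V" "inj_on \<beta> V"
  shows "inj_on (\<lambda>e. \<beta> ` e) E"
  using assms inj_on_image_eq_iff[OF assms(2)]
  by (intro inj_onI) (metis mem_vertex_pairs_iff subsetD)

lemma card_copy_edges:
  assumes "E \<subseteq> vertex_pairs V" "inj_on \<beta> V"
  shows "card (copy_edges E \<beta>) = card E"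
  unfolding copy_edges_def by (rule card_image[OF inj_on_image_vertex_pairs[OF assms]])

text \<open>\<open>\<Psi>\<close> bounds the expected number of copies of every induced subgraph of the pattern from below.\<close>

lemma sum_meeting_placements:
  fixes p \<Psi> :: real
  assumes E: "E \<subseteq> vertex_pairs {1..k}" and p: "0 < p" "p \<le> 1" and \<Psi>: "0 < \<Psi>"
    and dense: "\<And>I. I \<subseteq> {1..k} \<Longrightarrow> I \<noteq> {} \<Longrightarrow> \<Psi> \<le> real n ^ card I * p ^ card (E \<inter> vertex_pairs I)"
    and A: "finite A" "card A \<le> a" "1 \<le> a" and F: "F \<subseteq> vertex_pairs A"
  shows "(\<Sum>\<delta> | \<delta> \<in> placements k n \<and> \<delta> ` {1..k} \<inter> A \<noteq> {}. p ^ card (F \<union> copy_edges E \<delta>))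
    \<le> p ^ card F * ((2 * real a) ^ k * (real n ^ k * p ^ card E) / \<Psi>)"
proof -
  have finE: "finite E"
    using E finite_vertex_pairs[of "{1..k}"] finite_subset by auto
  have finF: "finite F"
    using F A(1) finite_vertex_pairs finite_subset by blast
  let ?S = "{\<delta> \<in> placements k n. \<delta> ` {1..k} \<inter> A \<noteq> {}}"
  \<comment> \<open>\<open>h \<delta>\<close> records which pattern vertices are placed into
    \<open>A\<close>; the sum is grouped by this overlap type.\<close>
  define h where "h \<delta> = {u \<in> {1..k}. \<delta> u \<in> A}" for \<delta> :: "nat \<Rightarrow> nat"
  \<comment> \<open>An edge of \<open>F\<close> lies inside \<open>A\<close>, so a copy edge shared
    with \<open>F\<close> comes from a pattern edge with both ends in \<open>h \<delta>\<close>.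
    Hence at most \<open>card (E \<inter> vertex_pairs (h \<delta>))\<close> edges of the copy are
    not new.\<close>
  have le: "p ^ card (F \<union> copy_edges E \<delta>) \<le> p ^ card F * (p ^ card E / p ^ card (E \<inter> vertex_pairs (h \<delta>)))"
    if \<delta>: "\<delta> \<in> placements k n" for \<delta>
  proof -
    let ?C = "copy_edges E \<delta>" and ?EI = "E \<inter> vertex_pairs (h \<delta>)"
    have finC: "finite ?C"
      unfolding copy_edges_def using finE by simp
    have "?C \<inter> F \<subseteq> (\<lambda>e. \<delta> ` e) ` ?EI"
    proof
      fix f assume f: "f \<in> ?C \<inter> F"
      then obtain e where e: "e \<in> E" "f = \<delta> ` e"
        unfolding copy_edges_def by auto
      have "e \<in> vertex_pairs {1..k}" "f \<in> vertex_pairs A"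
        using e f E F by auto
      then have "e \<subseteq> {1..k}" "card e = 2" "\<delta> ` e \<subseteq> A"
        unfolding mem_vertex_pairs_iff e(2) by simp_all
      then have "e \<subseteq> h \<delta>"
        unfolding h_def by auto
      then show "f \<in> (\<lambda>e. \<delta> ` e) ` ?EI"
        using e \<open>card e = 2\<close> by (auto simp: mem_vertex_pairs_iff)
    qed
    then have "card (?C \<inter> F) \<le> card ?EI"
      using finE by (meson card_image_le card_mono finite_Int finite_imageI order_trans)
    moreover have "card ?C = card E"
      by (rule card_copy_edges[OF E placementsD(1)[OF \<delta>]])
    moreover have "card (F \<union> ?C) + card (?C \<inter> F) = card F + card ?C"
      using card_Un_Int[OF finF finC] by (simp add: Int_commute)
    ultimately have "card F + card E \<le> card (F \<union> ?C) + card ?EI"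
      by linarith
    then have "p ^ (card (F \<union> ?C) + card ?EI) \<le> p ^ (card F + card E)"
      using p by (intro power_decreasing) auto
    then show ?thesis
      using p by (simp add: power_add field_simps)
  qed
  \<comment> \<open>Vertices in \<open>I\<close> have at most \<open>a\<close> possible images, all
    others at most \<open>n\<close>. Writing \<open>n ^ (k - card I)\<close> as a quotient prepares
    the comparison with \<open>\<Psi>\<close>, at the price of excluding
    \<open>n = 0\<close>.\<close>
  have fiber: "real (card {\<delta> \<in> placements k n. h \<delta> = I}) \<le> real a ^ k * (real n ^ k / real n ^ card I)"
    if I: "I \<subseteq> {1..k}" "n \<noteq> 0" for I
  proof -
    have finI: "finite I" and cI: "card I \<le> k"
      using I finite_subset[OF I(1)] card_mono[OF _ I(1)] by auto
    have "{\<delta> \<in> placements k n. h \<delta> = I} \<subseteq> (\<Pi>\<^sub>E u\<in>{1..k}. if u \<in> I then A else {1..n})"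
    proof
      fix \<delta> assume "\<delta> \<in> {\<delta> \<in> placements k n. h \<delta> = I}"
      then have "\<delta> \<in> {1..k} \<rightarrow>\<^sub>E {1..n}" "h \<delta> = I"
        using placementsD(3) by auto
      then show "\<delta> \<in> (\<Pi>\<^sub>E u\<in>{1..k}. if u \<in> I then A else {1..n})"
        unfolding h_def by (intro PiE_I) (auto simp: PiE_def extensional_def split: if_splits)
    qed
    then have "card {\<delta> \<in> placements k n. h \<delta> = I} \<le> card (\<Pi>\<^sub>E u\<in>{1..k}. if u \<in> I then A else {1..n})"
      using A(1) by (intro card_mono finite_PiE) auto
    also have "\<dots> = (\<Prod>u\<in>{1..k}. card (if u \<in> I then A else {1..n}))"
      by (simp add: card_PiE)
    also have "\<dots> = (\<Prod>u\<in>{1..k}. if u \<in> I then card A else n)"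
      by (intro prod.cong) auto
    also have "\<dots> = card A ^ card I * n ^ (k - card I)"
    proof -
      have "{1..k} \<inter> {u. u \<in> I} = I" "{1..k} \<inter> - {u. u \<in> I} = {1..k} - I"
        using I by auto
      then show ?thesis
        using I finI by (simp add: prod.If_cases card_Diff_subset)
    qed
    finally have "card {\<delta> \<in> placements k n. h \<delta> = I} \<le> card A ^ card I * n ^ (k - card I)" .
    also have "\<dots> \<le> a ^ k * n ^ (k - card I)"
    proof (rule mult_right_mono)
      have "card A ^ card I \<le> a ^ card I"
        using A by (intro power_mono) auto
      also have "\<dots> \<le> a ^ k"
        using A cI by (intro power_increasing) auto
      finally show "card A ^ card I \<le> a ^ k" .
    qed simp
    finally have "real (card {\<delta> \<in> placements k n. h \<delta> = I}) \<le> real (a ^ k * n ^ (k - card I))"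
      by (rule of_nat_mono)
    also have "\<dots> = real a ^ k * (real n ^ k / real n ^ card I)"
      using power_diff[of "real n" "card I" k] cI I by simp
    finally show ?thesis .
  qed
  show ?thesis
  proof (cases "n = 0 \<or> k = 0")
    case True
    then have "?S = {}"
      using placementsD(2) by (cases "k = 0") fastforce+
    then show ?thesis
      using p \<Psi> by (simp only: sum.empty) simp
  next
    case False
    then have n: "0 < real n" "n \<noteq> 0"
      by auto
    let ?w = "\<lambda>I. p ^ card F * (p ^ card E / p ^ card (E \<inter> vertex_pairs I))"
    let ?II = "Pow {1..k} - {{}}"
    have img: "h ` ?S \<subseteq> ?II"
      unfolding h_def by auto
    have "(\<Sum>\<delta>\<in>?S. p ^ card (F \<union> copy_edges E \<delta>)) \<le> (\<Sum>\<delta>\<in>?S. ?w (h \<delta>))"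
      by (intro sum_mono le) auto
    also have "\<dots> = (\<Sum>I\<in>?II. \<Sum>\<delta>\<in>{\<delta>\<in>?S. h \<delta> = I}. ?w (h \<delta>))"
      using finite_placements img by (intro sum.group[symmetric]) auto
    \<comment> \<open>The number of placements of type \<open>I\<close> times their weight is
      governed by \<open>n ^ k * p ^ card E\<close> divided by exactly the quantity that
      \<open>dense\<close> bounds below by \<open>\<Psi>\<close>, so every type obeys the same
      bound.\<close>
    also have "\<dots> \<le> (\<Sum>I\<in>?II. p ^ card F * (real a ^ k * (real n ^ k * p ^ card E) / \<Psi>))"
    proof (rule sum_mono)
      fix I assume I: "I \<in> ?II"
      have "(\<Sum>\<delta>\<in>{\<delta>\<in>?S. h \<delta> = I}. ?w (h \<delta>)) = real (card {\<delta>\<in>?S. h \<delta> = I}) * ?w I"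
        by (simp add: sum.cong[of _ _ "\<lambda>\<delta>. ?w (h \<delta>)" "\<lambda>\<delta>. ?w I"])
      also have "\<dots> \<le> (real a ^ k * (real n ^ k / real n ^ card I)) * ?w I"
      proof (intro mult_right_mono)
        have "card {\<delta>\<in>?S. h \<delta> = I} \<le> card {\<delta> \<in> placements k n. h \<delta> = I}"
          using finite_placements by (intro card_mono) auto
        then show "real (card {\<delta>\<in>?S. h \<delta> = I}) \<le> real a ^ k * (real n ^ k / real n ^ card I)"
          using fiber[of I] I n by (meson DiffD1 PowD of_nat_mono order_trans)
      qed (use p in auto)
      also have "\<dots> = p ^ card F * (real a ^ k * (real n ^ k * p ^ card E)
          / (real n ^ card I * p ^ card (E \<inter> vertex_pairs I)))"
        by (simp add: field_simps)
      also have "\<dots> \<le> p ^ card F * (real a ^ k * (real n ^ k * p ^ card E) / \<Psi>)"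
        using dense[of I] I p \<Psi> by (intro mult_left_mono divide_left_mono) auto
      finally show "(\<Sum>\<delta>\<in>{\<delta>\<in>?S. h \<delta> = I}. ?w (h \<delta>)) \<le> \<dots>" .
    qed
    also have "\<dots> = real (card ?II) * (p ^ card F * (real a ^ k * (real n ^ k * p ^ card E) / \<Psi>))"
      by simp
    \<comment> \<open>There are fewer than \<open>2 ^ k\<close> nonempty overlap types; this is the
      2 in \<open>(2 * real a) ^ k\<close>.\<close>
    also have "\<dots> \<le> 2 ^ k * (p ^ card F * (real a ^ k * (real n ^ k * p ^ card E) / \<Psi>))"
    proof (intro mult_right_mono)
      have "card ?II \<le> card (Pow {1..k})"
        by (intro card_mono) auto
      then show "real (card ?II) \<le> 2 ^ k"
        by (simp add: card_Pow)
    qed (use p \<Psi> in auto)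
    also have "\<dots> = p ^ card F * ((2 * real a) ^ k * (real n ^ k * p ^ card E) / \<Psi>)"
      by (simp add: power_mult_distrib)
    finally show ?thesis .
  qed
qed

text \<open>The sum is evaluated from the inside. The third placement meets a union of at most
  \<open>2 * k\<close> vertices and contributes \<open>(4 * real k) ^ k\<close>, the second meets at
  most \<open>k\<close> vertices and contributes \<open>(2 * real k) ^ k\<close>; each also
  contributes \<open>n ^ k * p ^ card E / \<Psi>\<close>. The first placement is free.\<close>

lemma sum_linked_triples:
  fixes p \<Psi> :: real and k :: nat
  defines "meets \<equiv> \<lambda>\<beta> \<gamma> :: nat \<Rightarrow> nat. \<beta> ` {1..k} \<inter> \<gamma> ` {1..k} \<noteq> {}"
  assumes E: "E \<subseteq> vertex_pairs {1..k}" and p: "0 < p" "p \<le> 1" and \<Psi>: "0 < \<Psi>" and k: "1 \<le> k"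
    and dense: "\<And>I. I \<subseteq> {1..k} \<Longrightarrow> I \<noteq> {} \<Longrightarrow> \<Psi> \<le> real n ^ card I * p ^ card (E \<inter> vertex_pairs I)"
  shows "(\<Sum>\<beta>\<in>placements k n. \<Sum>\<gamma> | \<gamma> \<in> placements k n \<and> meets \<beta> \<gamma>.
      \<Sum>\<delta> | \<delta> \<in> placements k n \<and> (meets \<beta> \<delta> \<or> meets \<gamma> \<delta>).
        p ^ card (copy_edges E \<beta> \<union> copy_edges E \<gamma> \<union> copy_edges E \<delta>))
    \<le> (8 * real k ^ 2) ^ k * (real n ^ k * p ^ card E) ^ 3 / \<Psi>\<^sup>2"
proof -
  let ?V = "\<lambda>\<beta>::nat \<Rightarrow> nat. \<beta> ` {1..k}" and ?C = "copy_edges E" and ?x = "real n ^ k * p ^ card E"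
  have Cv: "?C \<beta> \<subseteq> vertex_pairs (?V \<beta>)" if "\<beta> \<in> placements k n" for \<beta>
    by (rule copy_edges_vertex_pairs[OF E placementsD(1)[OF that]])
  have cV: "card (?V \<beta>) \<le> k" for \<beta>
    using card_image_le[of "{1..k}" \<beta>] by simp
  have third: "(\<Sum>\<delta> | \<delta> \<in> placements k n \<and> (meets \<beta> \<delta> \<or> meets \<gamma> \<delta>). p ^ card (?C \<beta> \<union> ?C \<gamma> \<union> ?C \<delta>))
      \<le> p ^ card (?C \<beta> \<union> ?C \<gamma>) * ((4 * real k) ^ k * ?x / \<Psi>)"
    if \<beta>: "\<beta> \<in> placements k n" and \<gamma>: "\<gamma> \<in> placements k n" for \<beta> \<gamma>
  proof -
    have "card (?V \<beta> \<union> ?V \<gamma>) \<le> 2 * k"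
      using card_Un_le[of "?V \<beta>" "?V \<gamma>"] cV[of \<beta>] cV[of \<gamma>] by linarith
    moreover have "?C \<beta> \<union> ?C \<gamma> \<subseteq> vertex_pairs (?V \<beta> \<union> ?V \<gamma>)"
      by (intro Un_least order_trans[OF Cv[OF \<beta>] vertex_pairs_mono]
          order_trans[OF Cv[OF \<gamma>] vertex_pairs_mono]) auto
    ultimately have "(\<Sum>\<delta> | \<delta> \<in> placements k n \<and> ?V \<delta> \<inter> (?V \<beta> \<union> ?V \<gamma>) \<noteq> {}. p ^ card (?C \<beta> \<union> ?C \<gamma> \<union> ?C \<delta>))
        \<le> p ^ card (?C \<beta> \<union> ?C \<gamma>) * ((2 * real (2 * k)) ^ k * ?x / \<Psi>)"
      using k by (intro sum_meeting_placements[OF E p \<Psi> dense]) auto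
    moreover have "{\<delta>. \<delta> \<in> placements k n \<and> ?V \<delta> \<inter> (?V \<beta> \<union> ?V \<gamma>) \<noteq> {}}
        = {\<delta>. \<delta> \<in> placements k n \<and> (meets \<beta> \<delta> \<or> meets \<gamma> \<delta>)}"
      unfolding meets_def by blast
    ultimately show ?thesis
      by simp
  qed
  have second: "(\<Sum>\<gamma> | \<gamma> \<in> placements k n \<and> meets \<beta> \<gamma>. p ^ card (?C \<beta> \<union> ?C \<gamma>))
      \<le> p ^ card E * ((2 * real k) ^ k * ?x / \<Psi>)"
    if \<beta>: "\<beta> \<in> placements k n" for \<beta>
  proof -
    have "(\<Sum>\<gamma> | \<gamma> \<in> placements k n \<and> ?V \<gamma> \<inter> ?V \<beta> \<noteq> {}. p ^ card (?C \<beta> \<union> ?C \<gamma>))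
        \<le> p ^ card (?C \<beta>) * ((2 * real k) ^ k * ?x / \<Psi>)"
      using k cV Cv[OF \<beta>] by (intro sum_meeting_placements[OF E p \<Psi> dense]) auto
    moreover have "{\<gamma>. \<gamma> \<in> placements k n \<and> ?V \<gamma> \<inter> ?V \<beta> \<noteq> {}} = {\<gamma>. \<gamma> \<in> placements k n \<and> meets \<beta> \<gamma>}"
      unfolding meets_def by blast
    ultimately show ?thesis
      unfolding card_copy_edges[OF E placementsD(1)[OF \<beta>]] by simp
  qed
  have pos: "0 \<le> (4 * real k) ^ k * ?x / \<Psi>" "0 \<le> (2 * real k) ^ k * ?x / \<Psi>"
    using p \<Psi> by auto
  have "(\<Sum>\<beta>\<in>placements k n. \<Sum>\<gamma> | \<gamma> \<in> placements k n \<and> meets \<beta> \<gamma>.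
      \<Sum>\<delta> | \<delta> \<in> placements k n \<and> (meets \<beta> \<delta> \<or> meets \<gamma> \<delta>). p ^ card (?C \<beta> \<union> ?C \<gamma> \<union> ?C \<delta>))
    \<le> (\<Sum>\<beta>\<in>placements k n. \<Sum>\<gamma> | \<gamma> \<in> placements k n \<and> meets \<beta> \<gamma>.
      p ^ card (?C \<beta> \<union> ?C \<gamma>) * ((4 * real k) ^ k * ?x / \<Psi>))"
    by (intro sum_mono third) auto
  also have "\<dots> = (\<Sum>\<beta>\<in>placements k n. \<Sum>\<gamma> | \<gamma> \<in> placements k n \<and> meets \<beta> \<gamma>.
      p ^ card (?C \<beta> \<union> ?C \<gamma>)) * ((4 * real k) ^ k * ?x / \<Psi>)"
    by (simp only: sum_distrib_right)
  also have "\<dots> \<le> (\<Sum>\<beta>\<in>placements k n. p ^ card E * ((2 * real k) ^ k * ?x / \<Psi>)) * ((4 * real k) ^ k * ?x / \<Psi>)"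
    by (intro mult_right_mono sum_mono second pos)
  also have "\<dots> = real (card (placements k n)) * (p ^ card E * ((2 * real k) ^ k * ?x / \<Psi>)) * ((4 * real k) ^ k * ?x / \<Psi>)"
    by simp
  also have "\<dots> \<le> real n ^ k * (p ^ card E * ((2 * real k) ^ k * ?x / \<Psi>)) * ((4 * real k) ^ k * ?x / \<Psi>)"
  proof (intro mult_right_mono pos)
    show "real (card (placements k n)) \<le> real n ^ k"
      using of_nat_mono[OF card_placements_le[of k n], where 'a=real] by simp
    show "0 \<le> p ^ card E * ((2 * real k) ^ k * ?x / \<Psi>)"
      using p by (intro mult_nonneg_nonneg pos) auto
  qed
  also have "\<dots> = ((2 * real k) ^ k * (4 * real k) ^ k) * ?x ^ 3 / \<Psi>\<^sup>2"
    by (simp add: power2_eq_square power3_eq_cube)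
  also have "(2 * real k) ^ k * (4 * real k) ^ k = (8 * real k ^ 2) ^ k"
    by (subst power_mult_distrib[symmetric]) (simp add: power2_eq_square)
  finally show ?thesis .
qed

section \<open>Independence and moments in the random-connection model\<close>

lemma bij_betw_oriented_edges:
  fixes V :: "nat set"
  assumes "S \<subseteq> vertex_pairs V"
  shows "bij_betw (\<lambda>(i, j). {i, j}) (oriented_edges S) S"
proof (rule bij_betwI')
  fix x y assume "x \<in> oriented_edges S" "y \<in> oriented_edges S"
  then show "((case x of (i, j) \<Rightarrow> {i, j}) = (case y of (i, j) \<Rightarrow> {i, j})) = (x = y)"
    by (auto simp: oriented_edges_def doubleton_eq_iff)
next
  fix x assume "x \<in> oriented_edges S"
  then show "(case x of (i, j) \<Rightarrow> {i, j}) \<in> S"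
    by (auto simp: oriented_edges_def)
next
  fix e assume e: "e \<in> S"
  then obtain u v where uv: "e = {u, v}" "u \<noteq> v"
    using assms unfolding vertex_pairs_def by blast
  show "\<exists>x\<in>oriented_edges S. e = (case x of (i, j) \<Rightarrow> {i, j})"
  proof (cases "u < v")
    case True
    then show ?thesis
      using e uv by (intro bexI[of _ "(u, v)"]) (auto simp: oriented_edges_def)
  next
    case False
    then show ?thesis
      using e uv by (intro bexI[of _ "(v, u)"]) (auto simp: oriented_edges_def insert_commute)
  qed
qed

lemma card_oriented_edges: "S \<subseteq> vertex_pairs V \<Longrightarrow> card (oriented_edges S) = card S"
  for V :: "nat set"
  by (rule bij_betw_same_card[OF bij_betw_oriented_edges])

lemma finite_oriented_edges: "S \<subseteq> vertex_pairs V \<Longrightarrow> finite V \<Longrightarrow> finite (oriented_edges S)"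
  for V :: "nat set"
  using bij_betw_finite[OF bij_betw_oriented_edges] finite_vertex_pairs finite_subset by blast

lemma prod_oriented_edges:
  fixes V :: "nat set" and h :: "nat \<Rightarrow> nat \<Rightarrow> 'b::comm_monoid_mult"
  assumes S: "S \<subseteq> vertex_pairs V" and sym: "\<And>i j. h i j = h j i"
  shows "(\<Prod>(i, j)\<in>oriented_edges S. h i j) = (\<Prod>e\<in>S. h (Min e) (Max e))"
proof -
  have "(\<Prod>e\<in>S. h (Min e) (Max e))
      = (\<Prod>x\<in>oriented_edges S. h (Min (case x of (i, j) \<Rightarrow> {i, j})) (Max (case x of (i, j) \<Rightarrow> {i, j})))"
    using bij_betw_oriented_edges[OF S] by (rule prod.reindex_bij_betw[symmetric])
  also have "\<dots> = (\<Prod>(i, j)\<in>oriented_edges S. h i j)"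
    by (intro prod.cong) (auto simp: oriented_edges_def)
  finally show ?thesis
    by simp
qed

text \<open>A placement may reverse the order of the endpoints of an edge, so oriented
  representatives are not mapped to oriented representatives. The product therefore passes through
  unordered edges, where reindexing is injective; \<open>Min\<close> and \<open>Max\<close> name the
  endpoints and symmetry absorbs a swap.\<close>

lemma prod_oriented_copy_edges:
  fixes V :: "nat set" and \<beta> :: "nat \<Rightarrow> nat" and h :: "nat \<Rightarrow> nat \<Rightarrow> 'b::comm_monoid_mult"
  assumes E: "E \<subseteq> vertex_pairs V" and inj: "inj_on \<beta> V" and sym: "\<And>i j. h i j = h j i"
  shows "(\<Prod>(i, j)\<in>oriented_edges (copy_edges E \<beta>). h i j) = (\<Prod>(u, v)\<in>oriented_edges E. h (\<beta> u) (\<beta> v))"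
proof -
  have "(\<Prod>(i, j)\<in>oriented_edges (copy_edges E \<beta>). h i j) = (\<Prod>e\<in>copy_edges E \<beta>. h (Min e) (Max e))"
    by (rule prod_oriented_edges[OF copy_edges_vertex_pairs[OF E inj] sym])
  also have "\<dots> = (\<Prod>e\<in>E. h (Min (\<beta> ` e)) (Max (\<beta> ` e)))"
    unfolding copy_edges_def by (subst prod.reindex[OF inj_on_image_vertex_pairs[OF E inj]]) simp
  also have "\<dots> = (\<Prod>e\<in>E. h (\<beta> (Min e)) (\<beta> (Max e)))"
  proof (rule prod.cong[OF refl])
    fix e assume "e \<in> E"
    then obtain u v where e: "e = {u, v}"
      using E unfolding vertex_pairs_def by blast
    show "h (Min (\<beta> ` e)) (Max (\<beta> ` e)) = h (\<beta> (Min e)) (\<beta> (Max e))"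
      unfolding e by (cases "u \<le> v"; cases "\<beta> u \<le> \<beta> v") (auto simp: min_def max_def sym)
  qed
  also have "\<dots> = (\<Prod>(u, v)\<in>oriented_edges E. h (\<beta> u) (\<beta> v))"
    using prod_oriented_edges[OF E, of "\<lambda>u v. h (\<beta> u) (\<beta> v)"] sym by simp
  finally show ?thesis .
qed

locale connection =
  fixes \<mu> :: "(real ^ 'd) measure" and H :: "real ^ 'd \<Rightarrow> real ^ 'd \<Rightarrow> real"
  assumes setting: "connection_setting \<mu> H"
begin

lemma H_bounds: "0 \<le> H x y" "H x y \<le> 1" and H_sym: "H x y = H y x"
  using setting unfolding connection_setting_def by auto

lemma prob_space_\<mu>: "prob_space \<mu>" and sets_\<mu>: "sets \<mu> = sets borel"
  using setting unfolding connection_setting_def by auto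

lemma H_measurable:
  assumes [measurable]: "f \<in> borel_measurable N" "g \<in> borel_measurable N"
  shows "(\<lambda>x. H (f x) (g x)) \<in> borel_measurable N"
proof -
  have [measurable]: "(\<lambda>(x, y). H x y) \<in> borel_measurable (borel \<Otimes>\<^sub>M borel)"
    using setting unfolding connection_setting_def by auto
  have "(\<lambda>x. (\<lambda>(x, y). H x y) (f x, g x)) \<in> borel_measurable N"
    by measurable
  then show ?thesis
    by simp
qed

end

locale rcm = binomial_rcm M n \<mu> H p X \<E> + connection \<mu> H
  for M :: "'w measure" and n :: nat and \<mu> :: "(real ^ 'd) measure"
    and H :: "real ^ 'd \<Rightarrow> real ^ 'd \<Rightarrow> real" and p :: real
    and X :: "nat \<Rightarrow> 'w \<Rightarrow> real ^ 'd" and \<E> :: "'w \<Rightarrow> nat set set" +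
  assumes p01: "0 < p" "p < 1"
begin

section \<open>Edge probabilities given the points\<close>

lemma X_measurable: "i \<in> {1..n} \<Longrightarrow> random_variable borel (X i)"
  using points_indep unfolding indep_vars_def by auto

abbreviation edge_pairs :: "nat set set" where
  "edge_pairs \<equiv> vertex_pairs {1..n}"

text \<open>The right-hand side of \<open>edge_law\<close> as a function of a deterministic point
  configuration, so that the law of the points can be applied to it.\<close>

definition edge_prob :: "nat set set \<Rightarrow> (nat \<Rightarrow> real ^ 'd) \<Rightarrow> real" where
  "edge_prob S x = (\<Prod>(i, j)\<in>oriented_edges S. p * H (x i) (x j))"

lemma edge_prob_bounds:
  assumes "S \<subseteq> vertex_pairs V"
  shows "0 \<le> edge_prob S x" "edge_prob S x \<le> p ^ card S"
proof -
  show "0 \<le> edge_prob S x"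
    unfolding edge_prob_def using p01 H_bounds by (intro prod_nonneg) auto
  have "edge_prob S x \<le> (\<Prod>e\<in>oriented_edges S. p)"
    unfolding edge_prob_def using p01 H_bounds by (intro prod_mono) (auto simp: mult_left_le)
  then show "edge_prob S x \<le> p ^ card S"
    using card_oriented_edges[OF assms] by simp
qed

lemma edge_prob_le_1: "S \<subseteq> vertex_pairs V \<Longrightarrow> edge_prob S x \<le> 1"
  using edge_prob_bounds(2)[of S V x] p01 power_le_one[of p "card S"] by linarith

lemma edge_prob_measurable:
  assumes "\<And>i. i \<in> V \<Longrightarrow> (\<lambda>x. f x i) \<in> borel_measurable N" and S: "S \<subseteq> vertex_pairs V"
  shows "(\<lambda>x. edge_prob S (f x)) \<in> borel_measurable N"
proof -
  have "i \<in> V \<and> j \<in> V" if "(i, j) \<in> oriented_edges S" for i j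
  proof -
    have "{i, j} \<in> vertex_pairs V"
      using that S by (auto simp: oriented_edges_def)
    then show ?thesis
      by (auto simp: mem_vertex_pairs_iff)
  qed
  then show ?thesis
    unfolding edge_prob_def
    by (intro borel_measurable_prod) (auto intro!: borel_measurable_times H_measurable assms(1))
qed

lemma edge_prob_Un:
  assumes "S \<subseteq> vertex_pairs A" "T \<subseteq> vertex_pairs B" "finite A" "finite B" "A \<inter> B = {}"
  shows "edge_prob (S \<union> T) x = edge_prob S x * edge_prob T x"
proof -
  have "S \<inter> T = {}"
    using assms vertex_pairs_disjoint[of A B] by auto
  then have "oriented_edges (S \<union> T) = oriented_edges S \<union> oriented_edges T"
      "oriented_edges S \<inter> oriented_edges T = {}"
    by (auto simp: oriented_edges_def)
  then show ?thesis
    unfolding edge_prob_def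
    using finite_oriented_edges[OF assms(1,3)] finite_oriented_edges[OF assms(2,4)]
    by (simp add: prod.union_disjoint)
qed

lemma edges_event:
  assumes "S \<subseteq> edge_pairs"
  shows "{\<omega> \<in> space M. S \<subseteq> \<E> \<omega>} \<in> events"
proof -
  have "finite S"
    using assms finite_vertex_pairs[of "{1..n}"] finite_subset by auto
  moreover have "{\<omega> \<in> space M. S \<subseteq> \<E> \<omega>} = {\<omega> \<in> space M. \<forall>e\<in>S. e \<in> \<E> \<omega>}"
    by auto
  ultimately show ?thesis
    using assms edge_events by (auto intro!: sets.sets_Collect_finite_All)
qed

lemma points_map_measurable: "(\<lambda>\<omega>. \<lambda>i\<in>{1..n}. X i \<omega>) \<in> M \<rightarrow>\<^sub>M (\<Pi>\<^sub>M i\<in>{1..n}. borel)"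
  by (intro measurable_restrict X_measurable)

lemma sigma_finite_points: "sigma_finite_subalgebra M (points_algebra M n X)"
proof -
  have "subalgebra M (points_algebra M n X)"
    unfolding subalgebra_def points_algebra_def
    using measurable_sets[OF points_map_measurable] by (auto simp: sets_vimage_algebra2 space_PiM)
  then have "finite_measure_subalgebra M (points_algebra M n X)"
    by (intro finite_measure_subalgebra.intro finite_measure_axioms finite_measure_subalgebra_axioms.intro)
  then show ?thesis
    by (rule finite_measure_subalgebra_is_sigma_finite)
qed

definition edges_present :: "nat set set \<Rightarrow> 'w \<Rightarrow> real" where
  "edges_present S \<omega> = of_bool (S \<subseteq> \<E> \<omega>)"

lemma bounded_rv_edges_present: "S \<subseteq> edge_pairs \<Longrightarrow> bounded_rv M (edges_present S)"
proof (rule bounded_rvI[of _ _ 1])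
  assume "S \<subseteq> edge_pairs"
  then have "indicat_real {\<omega> \<in> space M. S \<subseteq> \<E> \<omega>} \<in> borel_measurable M"
    using edges_event by simp
  then show "edges_present S \<in> borel_measurable M"
    by (rule measurable_cong[THEN iffD1, rotated]) (auto simp: edges_present_def indicator_def)
qed (auto simp: edges_present_def)

text \<open>A factor measurable with respect to the points can be pulled out of the conditional
  expectation. The case \<open>g = 1\<close> gives presence probabilities; taking for
  \<open>g\<close> a function of one point gives the correlations with the projection.\<close>

lemma expectation_edges_present:
  assumes S: "S \<subseteq> edge_pairs" and g: "g \<in> borel_measurable (points_algebra M n X)"
    and bnd: "\<And>\<omega>. \<omega> \<in> space M \<Longrightarrow> \<bar>g \<omega>\<bar> \<le> c"
  shows "expectation (\<lambda>\<omega>. g \<omega> * edges_present S \<omega>) = expectation (\<lambda>\<omega>. g \<omega> * edge_prob S (\<lambda>i. X i \<omega>))"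
proof -
  interpret F: sigma_finite_subalgebra M "points_algebra M n X"
    by (rule sigma_finite_points)
  let ?A = "{\<omega> \<in> space M. S \<subseteq> \<E> \<omega>}"
  have gM[measurable]: "g \<in> borel_measurable M"
    by (rule measurable_from_subalg[OF F.subalg g])
  have [measurable]: "?A \<in> events"
    by (rule edges_event[OF S])
  have [measurable]: "(\<lambda>\<omega>. edge_prob S (\<lambda>i. X i \<omega>)) \<in> borel_measurable M"
    by (rule edge_prob_measurable[OF _ S]) (rule X_measurable)
  have "bounded_rv M (\<lambda>\<omega>. g \<omega> * edges_present S \<omega>)"
    using gM bnd S by (intro bounded_rv_mult bounded_rv_edges_present bounded_rvI)
  then have "integrable M (\<lambda>\<omega>. g \<omega> * edges_present S \<omega>)"
    by (rule bounded_rv_integrable)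
  moreover have eq: "g \<omega> * edges_present S \<omega> = g \<omega> * indicat_real ?A \<omega>" if "\<omega> \<in> space M" for \<omega>
    using that by (simp add: edges_present_def)
  moreover have "integrable M (\<lambda>\<omega>. g \<omega> * edges_present S \<omega>)
      \<longleftrightarrow> integrable M (\<lambda>\<omega>. g \<omega> * indicat_real ?A \<omega>)"
    by (intro Bochner_Integration.integrable_cong refl eq)
  ultimately have int: "integrable M (\<lambda>\<omega>. g \<omega> * indicat_real ?A \<omega>)"
    by simp
  have "expectation (\<lambda>\<omega>. g \<omega> * edges_present S \<omega>) = expectation (\<lambda>\<omega>. g \<omega> * indicat_real ?A \<omega>)"
    by (intro Bochner_Integration.integral_cong refl eq)
  also have "\<dots> = expectation (\<lambda>\<omega>. g \<omega> * real_cond_exp M (points_algebra M n X) (indicat_real ?A) \<omega>)"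
    by (rule F.real_cond_exp_intg(2)[OF int g, symmetric]) simp
  also have "\<dots> = expectation (\<lambda>\<omega>. g \<omega> * edge_prob S (\<lambda>i. X i \<omega>))"
  proof (rule integral_cong_AE)
    show "AE \<omega> in M. g \<omega> * real_cond_exp M (points_algebra M n X) (indicat_real ?A) \<omega> = g \<omega> * edge_prob S (\<lambda>i. X i \<omega>)"
      using edge_law[OF S] by eventually_elim (simp add: edge_prob_def)
    show "(\<lambda>\<omega>. g \<omega> * real_cond_exp M (points_algebra M n X) (indicat_real ?A) \<omega>) \<in> borel_measurable M"
      by (intro borel_measurable_times gM borel_measurable_cond_exp2)
  qed measurable
  finally show ?thesis .
qed

lemma expectation_edges_present':
  "S \<subseteq> edge_pairs \<Longrightarrow> expectation (edges_present S) = expectation (\<lambda>\<omega>. edge_prob S (\<lambda>i. X i \<omega>))"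
  using expectation_edges_present[of S "\<lambda>_. 1" 1] by simp

lemma bounded_rv_edge_prob:
  assumes "S \<subseteq> edge_pairs"
  shows "bounded_rv M (\<lambda>\<omega>. edge_prob S (\<lambda>i. X i \<omega>))"
proof (rule bounded_rvI[of _ _ 1])
  show "(\<lambda>\<omega>. edge_prob S (\<lambda>i. X i \<omega>)) \<in> borel_measurable M"
    by (rule edge_prob_measurable[OF _ assms]) (rule X_measurable)
  show "\<bar>edge_prob S (\<lambda>i. X i \<omega>)\<bar> \<le> 1" for \<omega>
    using edge_prob_bounds(1)[OF assms] edge_prob_le_1[OF assms] by simp
qed

lemma expectation_edges_present_bounds:
  assumes "S \<subseteq> edge_pairs"
  shows "0 \<le> expectation (edges_present S)" "expectation (edges_present S) \<le> p ^ card S"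
proof -
  show "0 \<le> expectation (edges_present S)"
    by (intro integral_nonneg_AE) (auto simp: edges_present_def)
  have "expectation (\<lambda>\<omega>. edge_prob S (\<lambda>i. X i \<omega>)) \<le> expectation (\<lambda>_. p ^ card S)"
    using assms edge_prob_bounds(2) by (intro expectation_mono_bounded bounded_rv_edge_prob bounded_rv_const)
  then show "expectation (edges_present S) \<le> p ^ card S"
    using expectation_edges_present'[OF assms] prob_space by simp
qed

lemma edges_present_mult: "edges_present S \<omega> * edges_present T \<omega> = edges_present (S \<union> T) \<omega>"
  by (simp add: edges_present_def)

section \<open>Independence over disjoint vertex sets\<close>

lemma prob_edges: "S \<subseteq> edge_pairs \<Longrightarrow> prob {\<omega> \<in> space M. S \<subseteq> \<E> \<omega>} = expectation (edges_present S)"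
proof -
  assume "S \<subseteq> edge_pairs"
  have "expectation (edges_present S) = expectation (indicator {\<omega> \<in> space M. S \<subseteq> \<E> \<omega>})"
    by (intro Bochner_Integration.integral_cong) (auto simp: edges_present_def indicator_def)
  moreover have "{\<omega> \<in> space M. S \<subseteq> \<E> \<omega>} \<inter> space M = {\<omega> \<in> space M. S \<subseteq> \<E> \<omega>}"
    by auto
  ultimately show ?thesis
    by simp
qed

text \<open>Given the points, the presence probability factorises because disjoint vertex sets carry
  disjoint edge sets. The two factors then involve disjoint families of independent points, so they
  are independent themselves.\<close>

lemma prob_edges_Un:
  assumes S: "S \<subseteq> vertex_pairs A" and T: "T \<subseteq> vertex_pairs B"
    and AB: "A \<subseteq> {1..n}" "B \<subseteq> {1..n}" "A \<inter> B = {}"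
  shows "prob {\<omega> \<in> space M. S \<union> T \<subseteq> \<E> \<omega>} =
    prob {\<omega> \<in> space M. S \<subseteq> \<E> \<omega>} * prob {\<omega> \<in> space M. T \<subseteq> \<E> \<omega>}"
proof -
  have fin: "finite A" "finite B"
    using finite_subset[OF AB(1)] finite_subset[OF AB(2)] by auto
  have ST: "S \<subseteq> edge_pairs" "T \<subseteq> edge_pairs" "S \<union> T \<subseteq> edge_pairs"
    using S T vertex_pairs_mono[OF AB(1)] vertex_pairs_mono[OF AB(2)] by auto
  have ind: "indep_var borel (\<lambda>\<omega>. edge_prob S (\<lambda>i. X i \<omega>)) borel (\<lambda>\<omega>. edge_prob T (\<lambda>i. X i \<omega>))"
  proof -
    have meas: "edge_prob U \<in> borel_measurable (\<Pi>\<^sub>M i\<in>C. borel)" if "U \<subseteq> vertex_pairs C" for U C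
      by (rule edge_prob_measurable[OF _ that, of "\<lambda>x. x"]) simp
    have restr: "edge_prob U (restrict x C) = edge_prob U x" if "U \<subseteq> vertex_pairs C" for U C x
    proof -
      have "i \<in> C \<and> j \<in> C" if ij: "(i, j) \<in> oriented_edges U" for i j
      proof -
        have "{i, j} \<in> vertex_pairs C"
          using ij \<open>U \<subseteq> vertex_pairs C\<close> by (auto simp: oriented_edges_def)
        then show ?thesis
          by (auto simp: mem_vertex_pairs_iff)
      qed
      then show ?thesis
        unfolding edge_prob_def by (intro prod.cong) auto
    qed
    have "indep_var borel (edge_prob S \<circ> (\<lambda>\<omega>. restrict (\<lambda>i. X i \<omega>) A))
        borel (edge_prob T \<circ> (\<lambda>\<omega>. restrict (\<lambda>i. X i \<omega>) B))"
      by (rule indep_var_compose[OF indep_var_restrict[OF points_indep AB(3,1,2)] meas[OF S] meas[OF T]])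
    then show ?thesis
      by (simp add: comp_def restr[OF S] restr[OF T])
  qed
  have "expectation (edges_present (S \<union> T)) = expectation (\<lambda>\<omega>. edge_prob S (\<lambda>i. X i \<omega>) * edge_prob T (\<lambda>i. X i \<omega>))"
    using expectation_edges_present'[OF ST(3)] by (simp add: edge_prob_Un[OF S T fin AB(3)])
  also have "\<dots> = expectation (\<lambda>\<omega>. edge_prob S (\<lambda>i. X i \<omega>)) * expectation (\<lambda>\<omega>. edge_prob T (\<lambda>i. X i \<omega>))"
    by (rule expectation_indep_mult[OF ind bounded_rv_edge_prob[OF ST(1)] bounded_rv_edge_prob[OF ST(2)]])
  finally show ?thesis
    unfolding prob_edges[OF ST(1)] prob_edges[OF ST(2)] prob_edges[OF ST(3)]
      expectation_edges_present'[OF ST(1)] expectation_edges_present'[OF ST(2)] .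
qed

text \<open>There are only finitely many configurations on \<open>A\<close>, and each is singled out
  by a finite Boolean combination of the events that one given edge is present. The events
  \<open>S \<subseteq> \<E> \<omega>\<close> thus generate everything the restricted edge set can
  express.\<close>

lemma edges_within_sigma:
  assumes A: "A \<subseteq> {1..n}"
  shows "{(\<lambda>\<omega>. \<E> \<omega> \<inter> vertex_pairs A) -` U \<inter> space M | U. U \<in> sets (count_space (Pow (vertex_pairs A)))}
    \<subseteq> sigma_sets (space M) {{\<omega> \<in> space M. S \<subseteq> \<E> \<omega>} | S. S \<subseteq> vertex_pairs A}"
proof -
  let ?G = "{{\<omega> \<in> space M. S \<subseteq> \<E> \<omega>} | S. S \<subseteq> vertex_pairs A}"
  define N where "N = sigma (space M) ?G"
  have sp: "space N = space M" and sets: "sets N = sigma_sets (space M) ?G"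
    unfolding N_def by (auto intro!: space_measure_of sets_measure_of)
  have fin: "finite (vertex_pairs A)"
    using A finite_subset by (intro finite_vertex_pairs) auto
  have ev: "{\<omega> \<in> space N. e \<in> \<E> \<omega>} \<in> sets N" if "e \<in> vertex_pairs A" for e
  proof -
    have "{\<omega> \<in> space M. e \<in> \<E> \<omega>} = {\<omega> \<in> space M. {e} \<subseteq> \<E> \<omega>}" "{e} \<subseteq> vertex_pairs A"
      using that by auto
    then have "{\<omega> \<in> space M. e \<in> \<E> \<omega>} \<in> ?G"
      by blast
    then show ?thesis
      unfolding sp sets by (rule sigma_sets.Basic)
  qed
  have meas: "(\<lambda>\<omega>. \<E> \<omega> \<inter> vertex_pairs A) \<in> N \<rightarrow>\<^sub>M count_space (Pow (vertex_pairs A))"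
  proof (subst measurable_count_space_eq2, simp add: fin, intro conjI ballI)
    fix Q assume "Q \<in> Pow (vertex_pairs A)"
    then have "(\<lambda>\<omega>. \<E> \<omega> \<inter> vertex_pairs A) -` {Q} \<inter> space N
        = {\<omega> \<in> space N. \<forall>e\<in>vertex_pairs A. e \<in> \<E> \<omega> \<longleftrightarrow> e \<in> Q}"
      by auto
    also have "\<dots> \<in> sets N"
    proof (rule sets.sets_Collect_finite_All[OF _ fin])
      fix e assume "e \<in> vertex_pairs A"
      then show "{\<omega> \<in> space N. e \<in> \<E> \<omega> \<longleftrightarrow> e \<in> Q} \<in> sets N"
        using ev[of e] sets.sets_Collect_neg[of N "\<lambda>\<omega>. e \<in> \<E> \<omega>"] by (cases "e \<in> Q") auto
    qed
    finally show "(\<lambda>\<omega>. \<E> \<omega> \<inter> vertex_pairs A) -` {Q} \<inter> space N \<in> sets N" .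
  qed auto
  show ?thesis
  proof
    fix Z assume "Z \<in> {(\<lambda>\<omega>. \<E> \<omega> \<inter> vertex_pairs A) -` U \<inter> space M | U.
      U \<in> sets (count_space (Pow (vertex_pairs A)))}"
    then obtain U where U: "Z = (\<lambda>\<omega>. \<E> \<omega> \<inter> vertex_pairs A) -` U \<inter> space M"
        "U \<in> sets (count_space (Pow (vertex_pairs A)))"
      by blast
    then show "Z \<in> sigma_sets (space M) ?G"
      using measurable_sets[OF meas U(2)] unfolding sp sets by simp
  qed
qed

text \<open>The events \<open>S \<subseteq> \<E>\<close> form an intersection-stable generator, so the product formula of
  the edge law extends to the whole edge configuration.\<close>

lemma indep_edges_within:
  assumes AB: "A \<subseteq> {1..n}" "B \<subseteq> {1..n}" "A \<inter> B = {}"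
  shows "indep_var (count_space (Pow (vertex_pairs A))) (\<lambda>\<omega>. \<E> \<omega> \<inter> vertex_pairs A)
    (count_space (Pow (vertex_pairs B))) (\<lambda>\<omega>. \<E> \<omega> \<inter> vertex_pairs B)"
proof -
  define G where "G C = {{\<omega> \<in> space M. S \<subseteq> \<E> \<omega>} | S. S \<subseteq> vertex_pairs C}" for C
  have Gev: "G C \<subseteq> events" if "C \<subseteq> {1..n}" for C
    using edges_event vertex_pairs_mono[OF that] unfolding G_def by blast
  have stable: "Int_stable (G C)" for C
  proof (rule Int_stableI)
    fix a b assume "a \<in> G C" "b \<in> G C"
    then obtain S T where "a = {\<omega> \<in> space M. S \<subseteq> \<E> \<omega>}" "S \<subseteq> vertex_pairs C"
        "b = {\<omega> \<in> space M. T \<subseteq> \<E> \<omega>}" "T \<subseteq> vertex_pairs C"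
      unfolding G_def by blast
    then show "a \<inter> b \<in> G C"
      unfolding G_def by (intro CollectI exI[of _ "S \<union> T"]) auto
  qed
  have "indep_set (G A) (G B)"
    unfolding indep_sets2_eq
  proof (intro conjI ballI Gev AB)
    fix a b assume "a \<in> G A" "b \<in> G B"
    then obtain S T where a: "a = {\<omega> \<in> space M. S \<subseteq> \<E> \<omega>}" "S \<subseteq> vertex_pairs A"
        and b: "b = {\<omega> \<in> space M. T \<subseteq> \<E> \<omega>}" "T \<subseteq> vertex_pairs B"
      unfolding G_def by blast
    have "a \<inter> b = {\<omega> \<in> space M. S \<union> T \<subseteq> \<E> \<omega>}"
      unfolding a b by auto
    then show "prob (a \<inter> b) = prob a * prob b"
      using prob_edges_Un[OF a(2) b(2) AB] a b by simp
  qed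
  then have ind: "indep_set (sigma_sets (space M) (G A)) (sigma_sets (space M) (G B))"
    by (intro indep_set_sigma_sets stable)
  \<comment> \<open>The sigma-algebra generated by the restricted configuration, in the form in
    which \<open>indep_var_eq\<close> expresses independence.\<close>
  define K where "K C = sigma_sets (space M) {(\<lambda>\<omega>. \<E> \<omega> \<inter> vertex_pairs C) -` U \<inter> space M | U.
      U \<in> sets (count_space (Pow (vertex_pairs C)))}" for C
  have sub: "K C \<subseteq> sigma_sets (space M) (G C)" if "C \<subseteq> {1..n}" for C
    unfolding K_def G_def by (intro sigma_sets_mono edges_within_sigma that)
  have rv: "random_variable (count_space (Pow (vertex_pairs C))) (\<lambda>\<omega>. \<E> \<omega> \<inter> vertex_pairs C)"
    if C: "C \<subseteq> {1..n}" for C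
  proof (rule measurableI)
    fix U assume "U \<in> sets (count_space (Pow (vertex_pairs C)))"
    then have "(\<lambda>\<omega>. \<E> \<omega> \<inter> vertex_pairs C) -` U \<inter> space M \<in> sigma_sets (space M) (G C)"
      using edges_within_sigma[OF C] unfolding G_def by blast
    also have "\<dots> \<subseteq> events"
      using Gev[OF C] by (rule sets.sigma_sets_subset)
    finally show "(\<lambda>\<omega>. \<E> \<omega> \<inter> vertex_pairs C) -` U \<inter> space M \<in> events" .
  qed auto
  have "indep_set (K A) (K B)"
    using ind sub[OF AB(1)] sub[OF AB(2)] unfolding indep_sets2_eq by blast
  then show ?thesis
    unfolding indep_var_eq K_def using rv AB by blast
qed

text \<open>On a count space every real function is measurable, so independence passes to arbitrary
  functions of the two configurations. The equations for \<open>f\<close> and \<open>g\<close> let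
  \<open>F\<close> and \<open>G\<close> be given in their natural form, reading the full edge
  set.\<close>

lemma indep_edge_functions:
  fixes f g :: "nat set set \<Rightarrow> real"
  assumes AB: "A \<subseteq> {1..n}" "B \<subseteq> {1..n}" "A \<inter> B = {}"
    and f: "\<And>\<omega>. f (\<E> \<omega> \<inter> vertex_pairs A) = F \<omega>" and g: "\<And>\<omega>. g (\<E> \<omega> \<inter> vertex_pairs B) = G \<omega>"
  shows "indep_var borel F borel G"
proof -
  have "indep_var borel (f \<circ> (\<lambda>\<omega>. \<E> \<omega> \<inter> vertex_pairs A)) borel (g \<circ> (\<lambda>\<omega>. \<E> \<omega> \<inter> vertex_pairs B))"
    by (rule indep_var_compose[OF indep_edges_within[OF AB]]) auto
  then show ?thesis
    by (simp add: comp_def f g)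
qed

end

section \<open>First-order projections and the variance\<close>

lemma placements_mem: "\<beta> \<in> placements k n \<Longrightarrow> u \<in> {1..k} \<Longrightarrow> \<beta> u \<in> {1..n}"
  by (rule PiE_mem[OF placementsD(3)])

section \<open>Deterministic quantities of the pattern\<close>

text \<open>Kept apart from the random model because nothing here depends on \<open>n\<close>: the
  constants of the final bound can be fixed before \<open>n\<close> is chosen.\<close>

locale pattern = connection \<mu> H
  for \<mu> :: "(real ^ 'd) measure" and H :: "real ^ 'd \<Rightarrow> real ^ 'd \<Rightarrow> real" +
  fixes k :: nat and E :: "nat set set"
  assumes E: "E \<subseteq> vertex_pairs {1..k}" and k: "1 \<le> k"
begin

definition weight :: "(nat \<Rightarrow> real ^ 'd) \<Rightarrow> real" where
  "weight x = (\<Prod>(u, v)\<in>oriented_edges E. H (x u) (x v))"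

text \<open>The homomorphism density of the pattern in the kernel \<open>H\<close> with respect to
  \<open>\<mu>\<close>.\<close>

definition pattern_density :: real where
  "pattern_density = (\<integral>x. weight x \<partial>(\<Pi>\<^sub>M i\<in>{1..k}. \<mu>))"

text \<open>The density with vertex \<open>l\<close> pinned at \<open>x\<close>;
  \<open>first_order_fun\<close> is this times \<open>p ^ card E\<close> over the number of
  automorphisms.\<close>

definition rooted :: "nat \<Rightarrow> real ^ 'd \<Rightarrow> real" where
  "rooted l x = (\<integral>y. weight (y(l := x)) \<partial>(\<Pi>\<^sub>M i\<in>{1..k} - {l}. \<mu>))"

definition root_sum :: "real ^ 'd \<Rightarrow> real" where
  "root_sum x = (\<Sum>l\<in>{1..k}. rooted l x)"

definition root_dev :: "real ^ 'd \<Rightarrow> real" where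
  "root_dev x = root_sum x - (\<integral>z. root_sum z \<partial>\<mu>)"

text \<open>The variance in the hypothesis of the theorem, stripped of the square of the scalar
  factor of \<open>first_order_fun\<close>.\<close>

definition root_var :: real where
  "root_var = (\<integral>x. (root_dev x)\<^sup>2 \<partial>\<mu>)"

lemma oriented_edges_E:
  assumes "(u, v) \<in> oriented_edges E"
  shows "u \<in> {1..k}" "v \<in> {1..k}"
proof -
  have "{u, v} \<in> vertex_pairs {1..k}"
    using assms E by (auto simp: oriented_edges_def)
  then show "u \<in> {1..k}" "v \<in> {1..k}"
    by (auto simp: mem_vertex_pairs_iff)
qed

lemma weight_bounds: "0 \<le> weight x" "weight x \<le> 1"
proof -
  show "0 \<le> weight x"
    unfolding weight_def by (intro prod_nonneg) (auto simp: H_bounds)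
  show "weight x \<le> 1"
    unfolding weight_def by (intro prod_le_1) (auto simp: H_bounds)
qed

lemma weight_cong:
  assumes "\<And>u. u \<in> {1..k} \<Longrightarrow> x u = y u"
  shows "weight x = weight y"
  unfolding weight_def
proof (intro prod.cong refl)
  fix e assume "e \<in> oriented_edges E"
  then obtain u v where "e = (u, v)" "u \<in> {1..k}" "v \<in> {1..k}"
    using oriented_edges_E by (cases e) blast
  then show "(case e of (u, v) \<Rightarrow> H (x u) (x v)) = (case e of (u, v) \<Rightarrow> H (y u) (y v))"
    using assms by simp
qed

lemma weight_measurable:
  assumes "\<And>u. u \<in> {1..k} \<Longrightarrow> (\<lambda>x. f x u) \<in> borel_measurable N"
  shows "(\<lambda>x. weight (f x)) \<in> borel_measurable N"
  unfolding weight_def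
  by (intro borel_measurable_prod) (auto intro!: H_measurable assms dest: oriented_edges_E)

lemma borel_measurable_\<mu>: "borel_measurable \<mu> = borel_measurable borel"
  by (rule measurable_cong_sets[OF sets_\<mu> refl])

lemma component_measurable:
  assumes "u \<in> I"
  shows "(\<lambda>x. x u) \<in> borel_measurable (\<Pi>\<^sub>M i\<in>I. \<mu>)"
proof -
  have "(\<lambda>x. x u) \<in> (\<Pi>\<^sub>M i\<in>I. \<mu>) \<rightarrow>\<^sub>M \<mu>"
    by (rule measurable_component_singleton[OF assms])
  then show ?thesis
    by (simp only: measurable_cong_sets[OF refl sets_\<mu>])
qed

lemma prob_space_points: "prob_space (\<Pi>\<^sub>M i\<in>I. \<mu>)"
  by (rule prob_space_PiM) (rule prob_space_\<mu>)

lemma product_sigma_finite_\<mu>: "product_sigma_finite (\<lambda>_::nat. \<mu>)"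
  by (simp add: product_sigma_finite_def prob_space_imp_sigma_finite prob_space_\<mu>)

lemma rooted_measurable:
  assumes l: "l \<in> {1..k}"
  shows "rooted l \<in> borel_measurable borel"
proof -
  let ?J = "\<Pi>\<^sub>M i\<in>{1..k} - {l}. \<mu>"
  interpret J: prob_space ?J
    by (rule prob_space_points)
  have "(\<lambda>z. weight ((snd z)(l := fst z))) \<in> borel_measurable (\<mu> \<Otimes>\<^sub>M ?J)"
  proof (rule weight_measurable)
    fix u assume u: "u \<in> {1..k}"
    show "(\<lambda>z. ((snd z)(l := fst z)) u) \<in> borel_measurable (\<mu> \<Otimes>\<^sub>M ?J)"
    proof (cases "u = l")
      case True
      have "fst \<in> \<mu> \<Otimes>\<^sub>M ?J \<rightarrow>\<^sub>M \<mu>"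
        by simp
      then show ?thesis
        using True by (simp add: measurable_cong_sets[OF refl sets_\<mu>])
    next
      case False
      then have "u \<in> {1..k} - {l}"
        using u by simp
      from measurable_compose[OF measurable_snd component_measurable[OF this]] show ?thesis
        using False by simp
    qed
  qed
  then have "(\<lambda>(x, y). weight (y(l := x))) \<in> borel_measurable (\<mu> \<Otimes>\<^sub>M ?J)"
    by (simp add: case_prod_beta')
  then have "(\<lambda>x. \<integral>y. weight (y(l := x)) \<partial>?J) \<in> borel_measurable \<mu>"
    by (rule J.borel_measurable_lebesgue_integral)
  then show ?thesis
    unfolding rooted_def[abs_def] borel_measurable_\<mu> .
qed

lemma weight_upd_measurable:
  assumes l: "l \<in> {1..k}"
  shows "(\<lambda>y. weight (y(l := x))) \<in> borel_measurable (\<Pi>\<^sub>M i\<in>{1..k} - {l}. \<mu>)"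
proof (rule weight_measurable)
  fix u assume u: "u \<in> {1..k}"
  show "(\<lambda>y. (y(l := x)) u) \<in> borel_measurable (\<Pi>\<^sub>M i\<in>{1..k} - {l}. \<mu>)"
    using component_measurable[of u "{1..k} - {l}"] u by (cases "u = l") auto
qed

lemma rooted_bounds:
  assumes l: "l \<in> {1..k}"
  shows "0 \<le> rooted l x" "rooted l x \<le> 1"
proof -
  interpret J: prob_space "\<Pi>\<^sub>M i\<in>{1..k} - {l}. \<mu>"
    by (rule prob_space_points)
  show "0 \<le> rooted l x"
    unfolding rooted_def by (intro integral_nonneg_AE) (auto simp: weight_bounds)
  have "bounded_rv (\<Pi>\<^sub>M i\<in>{1..k} - {l}. \<mu>) (\<lambda>y. weight (y(l := x)))"
    using weight_upd_measurable[OF l] weight_bounds by (intro bounded_rvI[of _ _ 1]) auto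
  then have "rooted l x \<le> (\<integral>y. 1 \<partial>(\<Pi>\<^sub>M i\<in>{1..k} - {l}. \<mu>))"
    unfolding rooted_def using weight_bounds
    by (intro J.expectation_mono_bounded bounded_rv_const) auto
  then show "rooted l x \<le> 1"
    using J.prob_space by simp
qed

text \<open>Fubini, splitting off coordinate \<open>l\<close>. The test function
  \<open>F = 1\<close> yields the density itself, and \<open>F = root_dev\<close> the correlation of
  a copy with the deviation at its root.\<close>

lemma integral_rooted:
  fixes F :: "real ^ 'd \<Rightarrow> real"
  assumes l: "l \<in> {1..k}" and F: "F \<in> borel_measurable borel" and bnd: "\<And>x. \<bar>F x\<bar> \<le> c"
  shows "(\<integral>x. F (x l) * weight x \<partial>(\<Pi>\<^sub>M i\<in>{1..k}. \<mu>)) = (\<integral>x. F x * rooted l x \<partial>\<mu>)"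
proof -
  interpret product_sigma_finite "\<lambda>_::nat. \<mu>"
    by (rule product_sigma_finite_\<mu>)
  interpret P: prob_space "\<Pi>\<^sub>M i\<in>{1..k}. \<mu>"
    by (rule prob_space_points)
  let ?J = "{1..k} - {l}"
  have un: "{l} \<union> ?J = {1..k}"
    using l by auto
  have Fl: "(\<lambda>x. F (x l)) \<in> borel_measurable (\<Pi>\<^sub>M i\<in>{1..k}. \<mu>)"
    by (rule measurable_compose[OF component_measurable[OF l] F])
  have int: "integrable (\<Pi>\<^sub>M i\<in>{1..k}. \<mu>) (\<lambda>x. F (x l) * weight x)"
  proof (intro P.bounded_rv_integrable bounded_rv_mult)
    show "bounded_rv (\<Pi>\<^sub>M i\<in>{1..k}. \<mu>) (\<lambda>x. F (x l))"
      using Fl bnd by (rule bounded_rvI)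
    show "bounded_rv (\<Pi>\<^sub>M i\<in>{1..k}. \<mu>) weight"
    proof (rule bounded_rvI[of _ _ 1])
      show "weight \<in> borel_measurable (\<Pi>\<^sub>M i\<in>{1..k}. \<mu>)"
        by (rule weight_measurable[of "\<lambda>x. x"]) (rule component_measurable)
    qed (simp add: weight_bounds abs_le_iff order_trans[OF _ weight_bounds(1)])
  qed
  have "(\<integral>x. F (x l) * weight x \<partial>(\<Pi>\<^sub>M i\<in>{l} \<union> ?J. \<mu>))
      = (\<integral>x. (\<integral>y. F (merge {l} ?J (x, y) l) * weight (merge {l} ?J (x, y)) \<partial>(\<Pi>\<^sub>M i\<in>?J. \<mu>)) \<partial>(\<Pi>\<^sub>M i\<in>{l}. \<mu>))"
    by (rule product_integral_fold) (use int un in auto)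
  also have "\<dots> = (\<integral>x. F (x l) * rooted l (x l) \<partial>(\<Pi>\<^sub>M i\<in>{l}. \<mu>))"
  proof (intro Bochner_Integration.integral_cong refl)
    fix x :: "nat \<Rightarrow> real ^ 'd"
    \<comment> \<open>\<open>merge\<close> is \<open>undefined\<close> outside \<open>{1..k}\<close>
      whereas the update keeps the values of \<open>y\<close> there; \<open>weight\<close> reads
      only the coordinates in \<open>{1..k}\<close>.\<close>
    have "weight (merge {l} ?J (x, y)) = weight (y(l := x l))" for y
      by (rule weight_cong) (auto simp: merge_def)
    then show "(\<integral>y. F (merge {l} ?J (x, y) l) * weight (merge {l} ?J (x, y)) \<partial>(\<Pi>\<^sub>M i\<in>?J. \<mu>))
        = F (x l) * rooted l (x l)"
      unfolding rooted_def by (simp add: merge_def)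
  qed
  also have "\<dots> = (\<integral>x. F x * rooted l x \<partial>\<mu>)"
    using F rooted_measurable[OF l]
    by (intro product_integral_singleton) (simp add: borel_measurable_\<mu>)
  finally show ?thesis
    unfolding un .
qed

lemma integral_rooted_eq_pattern_density:
  assumes "l \<in> {1..k}"
  shows "(\<integral>x. rooted l x \<partial>\<mu>) = pattern_density"
  using integral_rooted[OF assms, of "\<lambda>_. 1" 1] by (simp add: pattern_density_def)

lemma root_sum_measurable: "root_sum \<in> borel_measurable borel"
  unfolding root_sum_def[abs_def] by (intro borel_measurable_sum rooted_measurable)

lemma root_sum_bounds: "0 \<le> root_sum x" "root_sum x \<le> k"
proof -
  show "0 \<le> root_sum x"
    unfolding root_sum_def by (intro sum_nonneg rooted_bounds)
  have "root_sum x \<le> (\<Sum>l\<in>{1..k}. 1)"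
    unfolding root_sum_def by (intro sum_mono rooted_bounds)
  then show "root_sum x \<le> k"
    by simp
qed

lemma integral_root_sum: "(\<integral>x. root_sum x \<partial>\<mu>) = k * pattern_density"
proof -
  interpret prob_space \<mu>
    by (rule prob_space_\<mu>)
  have "integrable \<mu> (rooted l)" if "l \<in> {1..k}" for l
    using rooted_measurable[OF that] rooted_bounds[OF that]
    by (intro bounded_rv_integrable bounded_rvI[of _ _ 1]) (auto simp: borel_measurable_\<mu>)
  then show ?thesis
    unfolding root_sum_def by (simp add: integral_rooted_eq_pattern_density)
qed

lemma pattern_density_bounds: "0 \<le> pattern_density" "pattern_density \<le> 1"
proof -
  show "0 \<le> pattern_density"
    unfolding pattern_density_def by (intro integral_nonneg_AE) (auto simp: weight_bounds)
  interpret prob_space \<mu>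
    by (rule prob_space_\<mu>)
  have l: "1 \<in> {1..k}"
    using k by simp
  have "pattern_density \<le> (\<integral>x. 1 \<partial>\<mu>)"
    unfolding integral_rooted_eq_pattern_density[OF l, symmetric]
    using rooted_measurable[OF l] rooted_bounds[OF l]
    by (intro expectation_mono_bounded bounded_rv_const bounded_rvI[of _ _ 1]) (auto simp: borel_measurable_\<mu>)
  then show "pattern_density \<le> 1"
    using prob_space by simp
qed

lemma root_dev_measurable: "root_dev \<in> borel_measurable borel"
  unfolding root_dev_def[abs_def] using root_sum_measurable by simp

lemma root_dev_bound: "\<bar>root_dev x\<bar> \<le> k"
proof -
  have "0 \<le> k * pattern_density" "k * pattern_density \<le> k"
    using pattern_density_bounds by (auto simp: mult_left_le)
  then show ?thesis
    using root_sum_bounds[of x] unfolding root_dev_def integral_root_sum by linarith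
qed

lemma bounded_rv_root_dev: "bounded_rv \<mu> root_dev"
  using root_dev_measurable root_dev_bound by (intro bounded_rvI[of _ _ k]) (auto simp: borel_measurable_\<mu>)

lemma integral_root_dev: "(\<integral>x. root_dev x \<partial>\<mu>) = 0"
proof -
  interpret prob_space \<mu>
    by (rule prob_space_\<mu>)
  have "bounded_rv \<mu> root_sum"
    using root_sum_measurable root_sum_bounds
    by (intro bounded_rvI[of _ _ k]) (auto simp: borel_measurable_\<mu>)
  then show ?thesis
    unfolding root_dev_def by (simp add: bounded_rv_integrable prob_space)
qed

lemma integral_root_dev_root_sum: "(\<integral>x. root_dev x * root_sum x \<partial>\<mu>) = root_var"
proof -
  interpret prob_space \<mu>
    by (rule prob_space_\<mu>)
  have "(\<integral>x. root_dev x * root_sum x \<partial>\<mu>) = (\<integral>x. (root_dev x)\<^sup>2 + root_dev x * (k * pattern_density) \<partial>\<mu>)"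
    by (intro Bochner_Integration.integral_cong)
      (auto simp: root_dev_def integral_root_sum power2_eq_square algebra_simps)
  also have "\<dots> = root_var + (\<integral>x. root_dev x * (k * pattern_density) \<partial>\<mu>)"
    unfolding root_var_def
    by (intro Bochner_Integration.integral_add bounded_rv_integrable bounded_rv_intros bounded_rv_root_dev)
  finally show ?thesis
    by (simp add: integral_root_dev)
qed

text \<open>\<open>root_sum\<close> is nonnegative with integral \<open>k * pattern_density\<close>.
  If this were 0, \<open>root_sum\<close> would vanish almost everywhere and could not have positive
  variance.\<close>

lemma pattern_density_pos:
  assumes "0 < root_var"
  shows "0 < pattern_density"
proof (rule ccontr)
  assume "\<not> 0 < pattern_density"
  then have d0: "pattern_density = 0"
    using pattern_density_bounds by simp
  interpret prob_space \<mu>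
    by (rule prob_space_\<mu>)
  have int: "integrable \<mu> root_sum"
    using root_sum_measurable root_sum_bounds
    by (intro bounded_rv_integrable bounded_rvI[of _ _ k]) (auto simp: borel_measurable_\<mu>)
  have "AE x in \<mu>. root_sum x = 0"
    using integral_nonneg_eq_0_iff_AE[OF int] integral_root_sum d0 root_sum_bounds(1) by simp
  then have "AE x in \<mu>. (root_dev x)\<^sup>2 = 0"
    unfolding root_dev_def integral_root_sum d0 by eventually_elim simp
  then have "root_var = 0"
    unfolding root_var_def by (rule integral_eq_zero_AE)
  with assms show False
    by simp
qed

end

locale rcm_pattern = rcm M n \<mu> H p X \<E> + pattern \<mu> H k E
  for M :: "'w measure" and n :: nat and \<mu> :: "(real ^ 'd) measure"
    and H :: "real ^ 'd \<Rightarrow> real ^ 'd \<Rightarrow> real" and p :: real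
    and X :: "nat \<Rightarrow> 'w \<Rightarrow> real ^ 'd" and \<E> :: "'w \<Rightarrow> nat set set"
    and k :: nat and E :: "nat set set"
begin

section \<open>Copies, their means and their correlation with single points\<close>

abbreviation copy :: "(nat \<Rightarrow> nat) \<Rightarrow> 'w \<Rightarrow> real" where
  "copy \<beta> \<equiv> edges_present (copy_edges E \<beta>)"

abbreviation hits :: "(nat \<Rightarrow> nat) \<Rightarrow> (nat \<Rightarrow> nat) \<Rightarrow> bool" where
  "hits \<beta> \<gamma> \<equiv> \<beta> ` {1..k} \<inter> \<gamma> ` {1..k} \<noteq> {}"

text \<open>Counts labelled placements, hence exceeds the subgraph count by the number of
  automorphisms, a factor that normalisation removes.\<close>

definition copies :: "'w \<Rightarrow> real" where
  "copies \<omega> = (\<Sum>\<beta>\<in>placements k n. copy \<beta> \<omega>)"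

lemma copy_edges_within: "\<beta> \<in> placements k n \<Longrightarrow> copy_edges E \<beta> \<subseteq> vertex_pairs (\<beta> ` {1..k})"
  by (intro copy_edges_vertex_pairs[OF E] placementsD)

lemma copy_edges_edge_pairs: "\<beta> \<in> placements k n \<Longrightarrow> copy_edges E \<beta> \<subseteq> edge_pairs"
  using copy_edges_within vertex_pairs_mono[OF placementsD(2)] by (rule order_trans)

lemma bounded_rv_copy: "\<beta> \<in> placements k n \<Longrightarrow> bounded_rv M (copy \<beta>)"
  by (intro bounded_rv_edges_present copy_edges_edge_pairs)

lemma bounded_rv_copies: "bounded_rv M copies"
  unfolding copies_def[abs_def] by (intro bounded_rv_sum bounded_rv_copy)

lemma edge_prob_copy:
  assumes "\<beta> \<in> placements k n"
  shows "edge_prob (copy_edges E \<beta>) x = p ^ card E * weight (\<lambda>u. x (\<beta> u))"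
proof -
  have "edge_prob (copy_edges E \<beta>) x = (\<Prod>(u, v)\<in>oriented_edges E. p * H (x (\<beta> u)) (x (\<beta> v)))"
    unfolding edge_prob_def
    by (rule prod_oriented_copy_edges[OF E placementsD(1)[OF assms]]) (simp add: H_sym)
  also have "\<dots> = (\<Prod>e\<in>oriented_edges E. p) * weight (\<lambda>u. x (\<beta> u))"
    unfolding weight_def by (subst prod.distrib[symmetric]) (simp add: case_prod_beta')
  finally show ?thesis
    using card_oriented_edges[OF E] by simp
qed

text \<open>A placement is injective, so it selects distinct points of an i.i.d. family: the
  selected points again have a product law, whichever placement is used.\<close>

lemma placed_points_distr:
  assumes \<beta>: "\<beta> \<in> placements k n"
  shows "distr M (\<Pi>\<^sub>M u\<in>{1..k}. \<mu>) (\<lambda>\<omega>. \<lambda>u\<in>{1..k}. X (\<beta> u) \<omega>) = (\<Pi>\<^sub>M u\<in>{1..k}. \<mu>)"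
proof -
  have n: "{1..n} \<noteq> {}"
    using placementsD(2)[OF \<beta>] k by fastforce
  have "distr M (\<Pi>\<^sub>M i\<in>{1..n}. borel) (\<lambda>\<omega>. \<lambda>i\<in>{1..n}. X i \<omega>) = (\<Pi>\<^sub>M i\<in>{1..n}. distr M borel (X i))"
    using points_indep by (subst (asm) indep_vars_iff_distr_eq_PiM'[OF n X_measurable]) auto
  also have "\<dots> = (\<Pi>\<^sub>M i\<in>{1..n}. \<mu>)"
    by (intro PiM_cong refl points_law)
  finally have all: "distr M (\<Pi>\<^sub>M i\<in>{1..n}. borel) (\<lambda>\<omega>. \<lambda>i\<in>{1..n}. X i \<omega>) = (\<Pi>\<^sub>M i\<in>{1..n}. \<mu>)" .
  have maps: "\<beta> \<in> {1..k} \<rightarrow> {1..n}"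
    using placementsD(2)[OF \<beta>] by auto
  have sets_eq: "sets (\<Pi>\<^sub>M i\<in>I. \<mu>) = sets (\<Pi>\<^sub>M i\<in>I. borel)" for I :: "nat set"
    by (intro sets_PiM_cong refl sets_\<mu>)
  have re: "(\<lambda>x. \<lambda>u\<in>{1..k}. x (\<beta> u)) \<in> (\<Pi>\<^sub>M i\<in>{1..n}. borel) \<rightarrow>\<^sub>M (\<Pi>\<^sub>M u\<in>{1..k}. \<mu>)"
    unfolding measurable_cong_sets[OF refl sets_eq]
    by (intro measurable_restrict measurable_component_singleton) (use maps in auto)
  have "(\<Pi>\<^sub>M u\<in>{1..k}. \<mu>) = distr (\<Pi>\<^sub>M i\<in>{1..n}. \<mu>) (\<Pi>\<^sub>M u\<in>{1..k}. \<mu>) (\<lambda>x. \<lambda>u\<in>{1..k}. x (\<beta> u))"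
    using distr_PiM_reindex[of "{1..n}" "\<lambda>_. \<mu>" \<beta> "{1..k}"] prob_space_\<mu> maps placementsD(1)[OF \<beta>] by simp
  also have "\<dots> = distr M (\<Pi>\<^sub>M u\<in>{1..k}. \<mu>) ((\<lambda>x. \<lambda>u\<in>{1..k}. x (\<beta> u)) \<circ> (\<lambda>\<omega>. \<lambda>i\<in>{1..n}. X i \<omega>))"
    unfolding all[symmetric] by (rule distr_distr[OF re points_map_measurable])
  also have "(\<lambda>x. \<lambda>u\<in>{1..k}. x (\<beta> u)) \<circ> (\<lambda>\<omega>. \<lambda>i\<in>{1..n}. X i \<omega>) = (\<lambda>\<omega>. \<lambda>u\<in>{1..k}. X (\<beta> u) \<omega>)"
    using maps by (auto simp: fun_eq_iff restrict_def Pi_iff)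
  finally show ?thesis
    by (rule sym)
qed

lemma point_measurable_points_algebra:
  assumes i: "i \<in> {1..n}" and F: "F \<in> borel_measurable borel"
  shows "(\<lambda>\<omega>. F (X i \<omega>)) \<in> borel_measurable (points_algebra M n X)"
proof -
  have "(\<lambda>\<omega>. \<lambda>i\<in>{1..n}. X i \<omega>) \<in> points_algebra M n X \<rightarrow>\<^sub>M (\<Pi>\<^sub>M i\<in>{1..n}. borel)"
    unfolding points_algebra_def
    by (rule measurable_vimage_algebra1) (use measurable_space[OF points_map_measurable] in auto)
  from measurable_compose[OF this measurable_compose[OF measurable_component_singleton[OF i] F]] show ?thesis
    using i by simp
qed

text \<open>Conditioning on the points replaces the copy by its edge probability, the law of the
  placed points turns the expectation into an integral over the pattern vertices, and Fubini
  isolates the root.\<close>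

lemma expectation_rooted_copy:
  assumes \<beta>: "\<beta> \<in> placements k n" and l: "l \<in> {1..k}"
    and F: "F \<in> borel_measurable borel" and bnd: "\<And>x. \<bar>F x\<bar> \<le> c"
  shows "expectation (\<lambda>\<omega>. F (X (\<beta> l) \<omega>) * copy \<beta> \<omega>) = p ^ card E * (\<integral>x. F x * rooted l x \<partial>\<mu>)"
proof -
  have i: "\<beta> l \<in> {1..n}"
    using placements_mem[OF \<beta> l] .
  let ?Y = "\<lambda>\<omega>. \<lambda>u\<in>{1..k}. X (\<beta> u) \<omega>"
  have "expectation (\<lambda>\<omega>. F (X (\<beta> l) \<omega>) * copy \<beta> \<omega>)
      = expectation (\<lambda>\<omega>. F (X (\<beta> l) \<omega>) * edge_prob (copy_edges E \<beta>) (\<lambda>i. X i \<omega>))"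
    by (rule expectation_edges_present[OF copy_edges_edge_pairs[OF \<beta>] point_measurable_points_algebra[OF i F] bnd])
  also have "\<dots> = expectation (\<lambda>\<omega>. p ^ card E * (F (?Y \<omega> l) * weight (?Y \<omega>)))"
  proof (intro Bochner_Integration.integral_cong refl)
    fix \<omega>
    have "weight (\<lambda>u. X (\<beta> u) \<omega>) = weight (?Y \<omega>)"
      by (rule weight_cong) simp
    then show "F (X (\<beta> l) \<omega>) * edge_prob (copy_edges E \<beta>) (\<lambda>i. X i \<omega>) = p ^ card E * (F (?Y \<omega> l) * weight (?Y \<omega>))"
      using l by (simp add: edge_prob_copy[OF \<beta>])
  qed
  also have "\<dots> = p ^ card E * expectation (\<lambda>\<omega>. F (?Y \<omega> l) * weight (?Y \<omega>))"
    by (rule integral_mult_right_zero)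
  also have "expectation (\<lambda>\<omega>. F (?Y \<omega> l) * weight (?Y \<omega>))
      = (\<integral>x. F (x l) * weight x \<partial>(distr M (\<Pi>\<^sub>M u\<in>{1..k}. \<mu>) ?Y))"
  proof (rule integral_distr[symmetric])
    have sets_eq: "sets (\<Pi>\<^sub>M i\<in>{1..k}. \<mu>) = sets (\<Pi>\<^sub>M i\<in>{1..k}. borel)"
      by (intro sets_PiM_cong refl sets_\<mu>)
    show "?Y \<in> M \<rightarrow>\<^sub>M (\<Pi>\<^sub>M u\<in>{1..k}. \<mu>)"
      unfolding measurable_cong_sets[OF refl sets_eq]
      by (intro measurable_restrict X_measurable) (rule placements_mem[OF \<beta>])
    show "(\<lambda>x. F (x l) * weight x) \<in> borel_measurable (\<Pi>\<^sub>M u\<in>{1..k}. \<mu>)"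
      by (intro borel_measurable_times measurable_compose[OF component_measurable[OF l] F]
          weight_measurable[of "\<lambda>x. x"] component_measurable)
  qed
  also have "\<dots> = (\<integral>x. F x * rooted l x \<partial>\<mu>)"
    unfolding placed_points_distr[OF \<beta>] by (rule integral_rooted[OF l F bnd])
  finally show ?thesis .
qed

lemma expectation_copy:
  assumes "\<beta> \<in> placements k n"
  shows "expectation (copy \<beta>) = p ^ card E * pattern_density"
  using expectation_rooted_copy[OF assms, of 1 "\<lambda>_. 1" 1] k integral_rooted_eq_pattern_density[of 1] by simp

lemma expectation_point:
  fixes F :: "real ^ 'd \<Rightarrow> real"
  assumes i: "i \<in> {1..n}" and F: "F \<in> borel_measurable borel"
  shows "expectation (\<lambda>\<omega>. F (X i \<omega>)) = (\<integral>x. F x \<partial>\<mu>)"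
  unfolding points_law[OF i, symmetric] by (rule integral_distr[OF X_measurable[OF i] F, symmetric])

lemma bounded_rv_point:
  fixes F :: "real ^ 'd \<Rightarrow> real"
  assumes "i \<in> {1..n}" "F \<in> borel_measurable borel" "\<And>x. \<bar>F x\<bar> \<le> c"
  shows "bounded_rv M (\<lambda>\<omega>. F (X i \<omega>))"
  using assms X_measurable by (intro bounded_rv_compose)

lemma expectation_unrooted_copy:
  assumes \<beta>: "\<beta> \<in> placements k n" and i: "i \<in> {1..n}" "i \<notin> \<beta> ` {1..k}"
    and F: "F \<in> borel_measurable borel" and bnd: "\<And>x. \<bar>F x\<bar> \<le> c" and mean: "(\<integral>x. F x \<partial>\<mu>) = 0"
  shows "expectation (\<lambda>\<omega>. F (X i \<omega>) * copy \<beta> \<omega>) = 0"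
proof -
  let ?B = "\<beta> ` {1..k}" and ?S = "copy_edges E \<beta>"
  have S: "?S \<subseteq> edge_pairs" and SB: "?S \<subseteq> vertex_pairs ?B"
    by (rule copy_edges_edge_pairs[OF \<beta>], rule copy_edges_within[OF \<beta>])
  have indXY: "indep_var borel (\<lambda>\<omega>. F (X i \<omega>)) borel (\<lambda>\<omega>. edge_prob ?S (\<lambda>i. X i \<omega>))"
  proof -
    have ind: "indep_var (\<Pi>\<^sub>M i\<in>{i}. borel) (\<lambda>\<omega>. restrict (\<lambda>i. X i \<omega>) {i})
        (\<Pi>\<^sub>M i\<in>?B. borel) (\<lambda>\<omega>. restrict (\<lambda>i. X i \<omega>) ?B)"
      using i placementsD(2)[OF \<beta>] by (intro indep_var_restrict[OF points_indep]) auto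
    have m1: "(\<lambda>x. F (x i)) \<in> borel_measurable (\<Pi>\<^sub>M i\<in>{i}. borel)"
      by (rule measurable_compose[where f = "\<lambda>x. x i" and N = borel, OF measurable_component_singleton F]) simp
    have m2: "edge_prob ?S \<in> borel_measurable (\<Pi>\<^sub>M i\<in>?B. borel)"
      by (rule edge_prob_measurable[OF _ SB, of "\<lambda>x. x"]) simp
    have restr: "edge_prob ?S (restrict x ?B) = edge_prob ?S x" for x
    proof -
      have "weight (\<lambda>u. restrict x ?B (\<beta> u)) = weight (\<lambda>u. x (\<beta> u))"
        by (rule weight_cong) auto
      then show ?thesis
        by (simp only: edge_prob_copy[OF \<beta>])
    qed
    show ?thesis
      using indep_var_compose[OF ind m1 m2] unfolding comp_def restr by simp
  qed
  have "expectation (\<lambda>\<omega>. F (X i \<omega>) * copy \<beta> \<omega>) = expectation (\<lambda>\<omega>. F (X i \<omega>) * edge_prob ?S (\<lambda>i. X i \<omega>))"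
    by (rule expectation_edges_present[OF S point_measurable_points_algebra[OF i(1) F] bnd])
  also have "\<dots> = expectation (\<lambda>\<omega>. F (X i \<omega>)) * expectation (\<lambda>\<omega>. edge_prob ?S (\<lambda>i. X i \<omega>))"
    by (intro expectation_indep_mult[OF indXY] bounded_rv_point[OF i(1) F bnd] bounded_rv_edge_prob S)
  finally show ?thesis
    by (simp add: expectation_point[OF i(1) F] mean)
qed

section \<open>Lower bounds for the variance\<close>

text \<open>Up to a scalar, the Hajek projection of the copy count: the best approximation of the
  centred count by a sum of functions of single points.\<close>

definition projection :: "'w \<Rightarrow> real" where
  "projection \<omega> = (\<Sum>i\<in>{1..n}. root_dev (X i \<omega>))"

lemma bounded_rv_root_dev_point: "i \<in> {1..n} \<Longrightarrow> bounded_rv M (\<lambda>\<omega>. root_dev (X i \<omega>))"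
  by (rule bounded_rv_point[OF _ root_dev_measurable root_dev_bound])

lemma bounded_rv_projection: "bounded_rv M projection"
  unfolding projection_def[abs_def] by (intro bounded_rv_sum bounded_rv_root_dev_point)

lemma expectation_projection: "expectation projection = 0"
proof -
  have "expectation projection = (\<Sum>i\<in>{1..n}. expectation (\<lambda>\<omega>. root_dev (X i \<omega>)))"
    unfolding projection_def
    by (intro Bochner_Integration.integral_sum bounded_rv_integrable bounded_rv_root_dev_point)
  also have "\<dots> = (\<Sum>i\<in>{1..n}. 0)"
    by (intro sum.cong refl) (simp add: expectation_point root_dev_measurable integral_root_dev)
  finally show ?thesis
    by simp
qed

lemma expectation_projection_square: "expectation (\<lambda>\<omega>. (projection \<omega>)\<^sup>2) = n * root_var"
proof -
  have "expectation (\<lambda>\<omega>. (projection \<omega>)\<^sup>2)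
      = expectation (\<lambda>\<omega>. \<Sum>i\<in>{1..n}. \<Sum>j\<in>{1..n}. root_dev (X i \<omega>) * root_dev (X j \<omega>))"
    by (simp only: projection_def power2_eq_square sum_product)
  also have "\<dots> = (\<Sum>i\<in>{1..n}. expectation (\<lambda>\<omega>. \<Sum>j\<in>{1..n}. root_dev (X i \<omega>) * root_dev (X j \<omega>)))"
    by (intro Bochner_Integration.integral_sum bounded_rv_integrable bounded_rv_sum bounded_rv_mult
        bounded_rv_root_dev_point)
  also have "\<dots> = (\<Sum>i\<in>{1..n}. \<Sum>j\<in>{1..n}. expectation (\<lambda>\<omega>. root_dev (X i \<omega>) * root_dev (X j \<omega>)))"
    by (intro sum.cong refl Bochner_Integration.integral_sum bounded_rv_integrable bounded_rv_mult
        bounded_rv_root_dev_point)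
  also have "\<dots> = (\<Sum>i\<in>{1..n}. \<Sum>j\<in>{1..n}. if j = i then root_var else 0)"
  proof (intro sum.cong refl)
    fix i j assume ij: "i \<in> {1..n}" "j \<in> {1..n}"
    show "expectation (\<lambda>\<omega>. root_dev (X i \<omega>) * root_dev (X j \<omega>)) = (if j = i then root_var else 0)"
    proof (cases "i = j")
      case True
      have "(\<lambda>x. (root_dev x)\<^sup>2) \<in> borel_measurable borel"
        using root_dev_measurable by simp
      then show ?thesis
        using True expectation_point[OF ij(1), of "\<lambda>x. (root_dev x)\<^sup>2"]
        by (simp add: root_var_def power2_eq_square)
    next
      case False
      have dev: "(\<lambda>x. root_dev (x l)) \<in> borel_measurable (\<Pi>\<^sub>M i\<in>{l}. borel)" for l :: nat
        by (rule measurable_compose[where f = "\<lambda>x. x l" and N = borel,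
              OF measurable_component_singleton root_dev_measurable]) simp
      have ij_ind: "indep_var (\<Pi>\<^sub>M i\<in>{i}. borel) (\<lambda>\<omega>. restrict (\<lambda>i. X i \<omega>) {i})
          (\<Pi>\<^sub>M i\<in>{j}. borel) (\<lambda>\<omega>. restrict (\<lambda>i. X i \<omega>) {j})"
        using ij False by (intro indep_var_restrict[OF points_indep]) auto
      have ind: "indep_var borel (root_dev \<circ> X i) borel (root_dev \<circ> X j)"
        using indep_var_compose[OF ij_ind dev[of i] dev[of j]] by (simp add: comp_def)
      have "expectation (\<lambda>\<omega>. root_dev (X i \<omega>) * root_dev (X j \<omega>))
          = expectation (\<lambda>\<omega>. root_dev (X i \<omega>)) * expectation (\<lambda>\<omega>. root_dev (X j \<omega>))"
        using expectation_indep_mult[OF ind] bounded_rv_root_dev_point ij by (simp add: comp_def)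
      then show ?thesis
        using False ij by (simp add: expectation_point root_dev_measurable integral_root_dev)
    qed
  qed
  also have "\<dots> = (\<Sum>i\<in>{1..n}. root_var)"
    by (intro sum.cong refl) (simp add: sum.delta)
  finally show ?thesis
    by simp
qed

text \<open>Points outside the copy are independent of it and drop out. The remaining sum over roots
  reassembles \<open>root_sum\<close>, whose covariance with its own deviation is
  \<open>root_var\<close>.\<close>

lemma expectation_projection_copy:
  assumes \<beta>: "\<beta> \<in> placements k n"
  shows "expectation (\<lambda>\<omega>. projection \<omega> * copy \<beta> \<omega>) = p ^ card E * root_var"
proof -
  let ?B = "\<beta> ` {1..k}"
  interpret \<mu>: prob_space \<mu>
    by (rule prob_space_\<mu>)
  have "expectation (\<lambda>\<omega>. projection \<omega> * copy \<beta> \<omega>) = expectation (\<lambda>\<omega>. \<Sum>i\<in>{1..n}. root_dev (X i \<omega>) * copy \<beta> \<omega>)"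
    by (simp only: projection_def sum_distrib_right)
  also have "\<dots> = (\<Sum>i\<in>{1..n}. expectation (\<lambda>\<omega>. root_dev (X i \<omega>) * copy \<beta> \<omega>))"
    by (intro Bochner_Integration.integral_sum bounded_rv_integrable bounded_rv_mult
        bounded_rv_root_dev_point bounded_rv_copy \<beta>)
  also have "\<dots> = (\<Sum>i\<in>?B. expectation (\<lambda>\<omega>. root_dev (X i \<omega>) * copy \<beta> \<omega>))"
    using placementsD(2)[OF \<beta>]
    by (intro sum.mono_neutral_right)
      (auto intro!: expectation_unrooted_copy[OF \<beta> _ _ root_dev_measurable root_dev_bound integral_root_dev])
  also have "\<dots> = (\<Sum>l\<in>{1..k}. expectation (\<lambda>\<omega>. root_dev (X (\<beta> l) \<omega>) * copy \<beta> \<omega>))"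
    using placementsD(1)[OF \<beta>] by (simp add: sum.reindex)
  also have "\<dots> = (\<Sum>l\<in>{1..k}. p ^ card E * (\<integral>x. root_dev x * rooted l x \<partial>\<mu>))"
    by (intro sum.cong refl expectation_rooted_copy[OF \<beta> _ root_dev_measurable root_dev_bound])
  also have "\<dots> = p ^ card E * (\<integral>x. (\<Sum>l\<in>{1..k}. root_dev x * rooted l x) \<partial>\<mu>)"
  proof -
    have "bounded_rv \<mu> (rooted l)" if "l \<in> {1..k}" for l
      using rooted_measurable[OF that] rooted_bounds[OF that]
      by (intro bounded_rvI[of _ _ 1]) (auto simp: borel_measurable_\<mu>)
    then have "(\<integral>x. (\<Sum>l\<in>{1..k}. root_dev x * rooted l x) \<partial>\<mu>) = (\<Sum>l\<in>{1..k}. \<integral>x. root_dev x * rooted l x \<partial>\<mu>)"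
      by (intro Bochner_Integration.integral_sum \<mu>.bounded_rv_integrable bounded_rv_mult bounded_rv_root_dev)
    then show ?thesis
      by (simp add: sum_distrib_left)
  qed
  also have "(\<integral>x. (\<Sum>l\<in>{1..k}. root_dev x * rooted l x) \<partial>\<mu>) = root_var"
    by (simp only: sum_distrib_left[symmetric] root_sum_def[symmetric] integral_root_dev_root_sum)
  finally show ?thesis .
qed

text \<open>The second moment of the copy count minus its best multiple of \<open>projection\<close> is nonnegative.\<close>

lemma variance_copies_ge_projection:
  assumes n: "0 < n"
  shows "(real (card (placements k n)) * p ^ card E)\<^sup>2 * root_var / n \<le> variance copies"
proof -
  let ?m = "real (card (placements k n))" and ?q = "p ^ card E"
  \<comment> \<open>The minimiser of the quadratic: the covariance \<open>?m * ?q * root_var\<close>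
    divided by the second moment \<open>n * root_var\<close> of the projection.\<close>
  define lam where "lam = ?m * ?q / n"
  define D where "D \<omega> = copies \<omega> - expectation copies" for \<omega>
  have bD: "bounded_rv M D"
    unfolding D_def[abs_def] by (intro bounded_rv_intros bounded_rv_copies)
  have cov: "expectation (\<lambda>\<omega>. projection \<omega> * D \<omega>) = ?m * (?q * root_var)"
  proof -
    have "expectation (\<lambda>\<omega>. projection \<omega> * D \<omega>)
        = expectation (\<lambda>\<omega>. (\<Sum>\<beta>\<in>placements k n. projection \<omega> * copy \<beta> \<omega>) - projection \<omega> * expectation copies)"
      by (simp only: D_def right_diff_distrib sum_distrib_left copies_def)
    also have "\<dots> = expectation (\<lambda>\<omega>. \<Sum>\<beta>\<in>placements k n. projection \<omega> * copy \<beta> \<omega>)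
        - expectation (\<lambda>\<omega>. projection \<omega> * expectation copies)"
      by (intro Bochner_Integration.integral_diff bounded_rv_integrable bounded_rv_intros
          bounded_rv_projection bounded_rv_copy)
    also have "expectation (\<lambda>\<omega>. projection \<omega> * expectation copies) = 0"
      by (simp add: expectation_projection)
    also have "expectation (\<lambda>\<omega>. \<Sum>\<beta>\<in>placements k n. projection \<omega> * copy \<beta> \<omega>)
        = (\<Sum>\<beta>\<in>placements k n. expectation (\<lambda>\<omega>. projection \<omega> * copy \<beta> \<omega>))"
      by (intro Bochner_Integration.integral_sum bounded_rv_integrable bounded_rv_mult
          bounded_rv_projection bounded_rv_copy)
    also have "\<dots> = ?m * (?q * root_var)"
      by (simp add: expectation_projection_copy)
    finally show ?thesis
      by simp
  qed
  have "0 \<le> expectation (\<lambda>\<omega>. (D \<omega> - lam * projection \<omega>)\<^sup>2)"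
    by (intro integral_nonneg_AE) auto
  also have "\<dots> = expectation (\<lambda>\<omega>. ((D \<omega>)\<^sup>2 - 2 * lam * (projection \<omega> * D \<omega>)) + lam\<^sup>2 * (projection \<omega>)\<^sup>2)"
    by (intro Bochner_Integration.integral_cong) (auto simp: power2_eq_square algebra_simps)
  also have "\<dots> = expectation (\<lambda>\<omega>. (D \<omega>)\<^sup>2 - 2 * lam * (projection \<omega> * D \<omega>))
      + expectation (\<lambda>\<omega>. lam\<^sup>2 * (projection \<omega>)\<^sup>2)"
    by (intro Bochner_Integration.integral_add bounded_rv_integrable bounded_rv_intros
          bounded_rv_projection bD)
  also have "expectation (\<lambda>\<omega>. (D \<omega>)\<^sup>2 - 2 * lam * (projection \<omega> * D \<omega>))
      = expectation (\<lambda>\<omega>. (D \<omega>)\<^sup>2) - expectation (\<lambda>\<omega>. 2 * lam * (projection \<omega> * D \<omega>))"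
    by (intro Bochner_Integration.integral_diff bounded_rv_integrable bounded_rv_intros
          bounded_rv_projection bD)
  finally have "0 \<le> variance copies - 2 * lam * (?m * (?q * root_var)) + lam\<^sup>2 * (n * root_var)"
    by (simp only: cov expectation_projection_square integral_mult_right_zero D_def[symmetric])
  moreover have "lam\<^sup>2 * (n * root_var) = lam * (?m * (?q * root_var))"
    using n by (simp add: lam_def power2_eq_square)
  moreover have "lam * (?m * (?q * root_var)) = (?m * ?q)\<^sup>2 * root_var / n"
    by (simp add: lam_def power2_eq_square)
  ultimately show ?thesis
    by linarith
qed

text \<open>The sums far from \<open>A\<close> in Stein's argument have exactly this shape. All
  their copies live in the complement of \<open>A\<close>, so the whole sum reads only edges
  disjoint from those seen by \<open>F\<close>.\<close>

lemma indep_copy_functions: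
  fixes f g :: "nat set set \<Rightarrow> real"
  assumes A: "A \<subseteq> {1..n}"
    and f: "\<And>\<omega>. f (\<E> \<omega> \<inter> vertex_pairs A) = F \<omega>"
    and c: "\<And>\<delta>. \<delta> \<in> D \<Longrightarrow> \<delta> \<in> placements k n \<and> \<delta> ` {1..k} \<inter> A = {}"
  shows "indep_var borel F borel (\<lambda>\<omega>. \<Sum>\<delta>\<in>D. (copy \<delta> \<omega> - c \<delta>) / s)"
proof (rule indep_edge_functions[where f = f and A = A and B = "{1..n} - A"
      and g = "\<lambda>S. \<Sum>\<delta>\<in>D. (of_bool (copy_edges E \<delta> \<subseteq> S) - c \<delta>) / s"])
  show "A \<subseteq> {1..n}" "f (\<E> \<omega> \<inter> vertex_pairs A) = F \<omega>" for \<omega>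
    by (rule A, rule f)
  show "{1..n} - A \<subseteq> {1..n}" "A \<inter> ({1..n} - A) = {}"
    by auto
  show "(\<Sum>\<delta>\<in>D. (of_bool (copy_edges E \<delta> \<subseteq> \<E> \<omega> \<inter> vertex_pairs ({1..n} - A)) - c \<delta>) / s)
      = (\<Sum>\<delta>\<in>D. (copy \<delta> \<omega> - c \<delta>) / s)" for \<omega>
  proof (intro sum.cong refl)
    fix \<delta> assume "\<delta> \<in> D"
    then have \<delta>: "\<delta> \<in> placements k n" "\<delta> ` {1..k} \<inter> A = {}"
      using c by auto
    then have "\<delta> ` {1..k} \<subseteq> {1..n} - A"
      using placementsD(2)[OF \<delta>(1)] by auto
    then have "copy_edges E \<delta> \<subseteq> vertex_pairs ({1..n} - A)"
      using copy_edges_within[OF \<delta>(1)] vertex_pairs_mono by blast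
    then show "(of_bool (copy_edges E \<delta> \<subseteq> \<E> \<omega> \<inter> vertex_pairs ({1..n} - A)) - c \<delta>) / s = (copy \<delta> \<omega> - c \<delta>) / s"
      by (simp add: edges_present_def)
  qed
qed

lemma expectation_copy_mult_disjoint:
  assumes \<beta>: "\<beta> \<in> placements k n" and \<gamma>: "\<gamma> \<in> placements k n" and "\<not> hits \<beta> \<gamma>"
  shows "expectation (\<lambda>\<omega>. copy \<beta> \<omega> * copy \<gamma> \<omega>) = expectation (copy \<beta>) * expectation (copy \<gamma>)"
proof -
  have "indep_var borel (copy \<beta>) borel (copy \<gamma>)"
  proof (rule indep_edge_functions[where f = "\<lambda>S. of_bool (copy_edges E \<beta> \<subseteq> S)"
        and g = "\<lambda>S. of_bool (copy_edges E \<gamma> \<subseteq> S)",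
        OF placementsD(2)[OF \<beta>] placementsD(2)[OF \<gamma>]])
    show "of_bool (copy_edges E \<beta> \<subseteq> \<E> \<omega> \<inter> vertex_pairs (\<beta> ` {1..k})) = copy \<beta> \<omega>" for \<omega>
      using copy_edges_within[OF \<beta>] by (simp add: edges_present_def)
    show "of_bool (copy_edges E \<gamma> \<subseteq> \<E> \<omega> \<inter> vertex_pairs (\<gamma> ` {1..k})) = copy \<gamma> \<omega>" for \<omega>
      using copy_edges_within[OF \<gamma>] by (simp add: edges_present_def)
  qed (use assms in auto)
  then show ?thesis
    by (intro expectation_indep_mult bounded_rv_copy \<beta> \<gamma>)
qed

lemma expectation_copies: "expectation copies = (\<Sum>\<beta>\<in>placements k n. p ^ card E * pattern_density)"
proof -
  have "expectation copies = (\<Sum>\<beta>\<in>placements k n. expectation (copy \<beta>))"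
    unfolding copies_def by (intro Bochner_Integration.integral_sum bounded_rv_integrable bounded_rv_copy)
  also have "\<dots> = (\<Sum>\<beta>\<in>placements k n. p ^ card E * pattern_density)"
    by (intro sum.cong refl expectation_copy)
  finally show ?thesis .
qed

text \<open>Only the diagonal of the covariance sum is kept; correlations are bounded below by
  \<open>- (expectation (copy \<beta>))\<^sup>2\<close> and vanish for disjoint placements.\<close>

lemma variance_copies_ge_diagonal:
  assumes n: "0 < n" and small: "(2 * real k) ^ k * (real n ^ k * p ^ card E / n) \<le> 1 / 2"
  shows "real (card (placements k n)) * (p ^ card E * pattern_density) / 2 \<le> variance copies"
proof -
  let ?P = "placements k n" and ?q = "p ^ card E * pattern_density"
  have q: "0 \<le> ?q" "?q \<le> p ^ card E"
    using p01 pattern_density_bounds by (auto simp: mult_left_le)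
  have sq: "expectation (\<lambda>\<omega>. (copies \<omega>)\<^sup>2) = (\<Sum>\<beta>\<in>?P. \<Sum>\<gamma>\<in>?P. expectation (\<lambda>\<omega>. copy \<beta> \<omega> * copy \<gamma> \<omega>))"
  proof -
    have "expectation (\<lambda>\<omega>. (copies \<omega>)\<^sup>2) = expectation (\<lambda>\<omega>. \<Sum>\<beta>\<in>?P. \<Sum>\<gamma>\<in>?P. copy \<beta> \<omega> * copy \<gamma> \<omega>)"
      by (simp only: copies_def power2_eq_square sum_product)
    also have "\<dots> = (\<Sum>\<beta>\<in>?P. expectation (\<lambda>\<omega>. \<Sum>\<gamma>\<in>?P. copy \<beta> \<omega> * copy \<gamma> \<omega>))"
      by (intro Bochner_Integration.integral_sum bounded_rv_integrable bounded_rv_sum bounded_rv_mult bounded_rv_copy)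
    also have "\<dots> = (\<Sum>\<beta>\<in>?P. \<Sum>\<gamma>\<in>?P. expectation (\<lambda>\<omega>. copy \<beta> \<omega> * copy \<gamma> \<omega>))"
      by (intro sum.cong refl Bochner_Integration.integral_sum bounded_rv_integrable bounded_rv_mult bounded_rv_copy)
    finally show ?thesis .
  qed
  have "variance copies = expectation (\<lambda>\<omega>. (copies \<omega>)\<^sup>2) - (expectation copies)\<^sup>2"
    by (intro variance_eq bounded_rv_integrable bounded_rv_power bounded_rv_copies)
  also have "\<dots> = (\<Sum>\<beta>\<in>?P. \<Sum>\<gamma>\<in>?P. expectation (\<lambda>\<omega>. copy \<beta> \<omega> * copy \<gamma> \<omega>) - ?q\<^sup>2)"
    unfolding sq expectation_copies by (simp add: power2_eq_square sum_product sum_subtractf)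
  also have "\<dots> \<ge> (\<Sum>\<beta>\<in>?P. ?q / 2)"
  proof (rule sum_mono)
    fix \<beta> assume \<beta>: "\<beta> \<in> ?P"
    \<comment> \<open>Counting by the weighted estimate with an empty edge set: all powers of
      \<open>1/2\<close> become 1, the sum becomes a cardinality, and \<open>\<Psi>\<close> may be
      taken to be \<open>n\<close>.\<close>
    have "card {\<gamma> \<in> ?P. hits \<gamma> \<beta>} \<le> (2 * real k) ^ k * (real n ^ k / n)"
    proof -
      have "(\<Sum>\<gamma> | \<gamma> \<in> ?P \<and> hits \<gamma> \<beta>. (1/2::real) ^ card ({} \<union> copy_edges {} \<gamma>))
          \<le> (1/2) ^ card ({} :: nat set set) *
            ((2 * real k) ^ k * (real n ^ k * (1/2) ^ card ({} :: nat set set)) / n)"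
      proof (rule sum_meeting_placements[where E = "{}" and F = "{}" and p = "1/2" and \<Psi> = "real n" and a = k])
        show "real n \<le> real n ^ card I * (1 / 2) ^ card ({} \<inter> vertex_pairs I)"
          if "I \<subseteq> {1..k}" "I \<noteq> {}" for I :: "nat set"
        proof -
          have "finite I"
            using that(1) by (rule finite_subset) simp
          then have "1 \<le> card I"
            using that(2) by (simp add: Suc_le_eq card_gt_0_iff)
          then show ?thesis
            using self_le_power[of "real n" "card I"] n by simp
        qed
        show "card (\<beta> ` {1..k}) \<le> k"
          using card_image_le[of "{1..k}" \<beta>] by simp
      qed (use n k in auto)
      then show ?thesis
        by (simp add: copy_edges_def)
    qed
    then have "card {\<gamma> \<in> ?P. hits \<gamma> \<beta>} * ?q \<le> (2 * real k) ^ k * (real n ^ k / n) * p ^ card E"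
      using q by (intro mult_mono) auto
    also have "\<dots> \<le> 1 / 2"
      using small by (simp add: field_simps)
    finally have count: "card {\<gamma> \<in> ?P. hits \<gamma> \<beta>} * ?q\<^sup>2 \<le> ?q / 2"
      using mult_right_mono[of "card {\<gamma> \<in> ?P. hits \<gamma> \<beta>} * ?q" "1 / 2" ?q] q
      by (simp add: power2_eq_square mult.assoc)
    have diag: "expectation (\<lambda>\<omega>. copy \<beta> \<omega> * copy \<beta> \<omega>) = ?q"
      by (simp only: edges_present_mult Un_absorb expectation_copy[OF \<beta>])
    \<comment> \<open>Entrywise lower bound of the covariances: the diagonal entry contributes
      \<open>?q\<close>, every meeting placement, including \<open>\<beta>\<close> itself, loses at
      most \<open>?q\<^sup>2\<close>, and disjoint ones contribute 0. By \<open>count\<close> the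
      total loss is at most half the gain.\<close>
    have "?q / 2 \<le> (\<Sum>\<gamma>\<in>?P. (if \<gamma> = \<beta> then ?q else 0) - (if hits \<gamma> \<beta> then ?q\<^sup>2 else 0))"
    proof -
      have "(\<Sum>\<gamma>\<in>?P. if hits \<gamma> \<beta> then ?q\<^sup>2 else 0) = card {\<gamma> \<in> ?P. hits \<gamma> \<beta>} * ?q\<^sup>2"
        using finite_placements by (simp add: sum.If_cases Int_def)
      moreover have "(\<Sum>\<gamma>\<in>?P. if \<gamma> = \<beta> then ?q else 0) = ?q"
        using finite_placements \<beta> by (simp add: sum.delta)
      ultimately show ?thesis
        using count by (simp only: sum_subtractf)
    qed
    also have "\<dots> \<le> (\<Sum>\<gamma>\<in>?P. expectation (\<lambda>\<omega>. copy \<beta> \<omega> * copy \<gamma> \<omega>) - ?q\<^sup>2)"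
    proof (rule sum_mono)
      fix \<gamma> assume \<gamma>: "\<gamma> \<in> ?P"
      have nonneg: "0 \<le> expectation (\<lambda>\<omega>. copy \<beta> \<omega> * copy \<gamma> \<omega>)"
        by (intro integral_nonneg_AE) (auto simp: edges_present_def)
      have "hits \<beta> \<beta>"
        using k by auto
      show "(if \<gamma> = \<beta> then ?q else 0) - (if hits \<gamma> \<beta> then ?q\<^sup>2 else 0)
          \<le> expectation (\<lambda>\<omega>. copy \<beta> \<omega> * copy \<gamma> \<omega>) - ?q\<^sup>2"
      proof (cases "hits \<gamma> \<beta>")
        case True
        then show ?thesis
          using diag nonneg by auto
      next
        case False
        then have "expectation (\<lambda>\<omega>. copy \<beta> \<omega> * copy \<gamma> \<omega>) = ?q\<^sup>2"
          using expectation_copy_mult_disjoint[OF \<beta> \<gamma>] \<beta> \<gamma>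
          by (simp add: Int_commute expectation_copy power2_eq_square)
        then show ?thesis
          using False \<open>hits \<beta> \<beta>\<close> by auto
      qed
    qed
    finally show "?q / 2 \<le> (\<Sum>\<gamma>\<in>?P. expectation (\<lambda>\<omega>. copy \<beta> \<omega> * copy \<gamma> \<omega>) - ?q\<^sup>2)" .
  qed
  finally show ?thesis
    by simp
qed

end

section \<open>Normal approximation of the copy count\<close>

context rcm_pattern
begin

section \<open>Moments of products of centred copies\<close>

lemma power_card_Un_le: "p ^ card S * p ^ card T \<le> p ^ card (S \<union> T)"
  unfolding power_add[symmetric] using p01 card_Un_le[of S T] by (intro power_decreasing) auto

lemma expectation_edges_present_mult_le:
  assumes S: "S \<subseteq> edge_pairs" and T: "T \<subseteq> edge_pairs" and q: "0 \<le> q" "q \<le> p ^ card T"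
  shows "q * expectation (edges_present S) \<le> p ^ card (S \<union> T)"
proof -
  have "q * expectation (edges_present S) \<le> p ^ card T * p ^ card S"
    using q expectation_edges_present_bounds[OF S] p01 by (intro mult_mono) auto
  then show ?thesis
    using power_card_Un_le[of T S] by (simp add: Un_commute)
qed

text \<open>A centred copy is dominated by \<open>copy \<beta> x + q\<close>. Each of the four terms
  of the expanded product is at most \<open>p\<close> to the size of the union: replacing a copy by
  \<open>q \<le> p ^ card E\<close> amounts to counting its edges without overlap, which can only
  raise the exponent.\<close>

lemma centred_moment_2:
  assumes \<beta>: "\<beta> \<in> placements k n" and \<gamma>: "\<gamma> \<in> placements k n" and q: "0 \<le> q" "q \<le> p ^ card E"
  shows "expectation (\<lambda>x. (copy \<beta> x + q) * (copy \<gamma> x + q)) \<le> 4 * p ^ card (copy_edges E \<beta> \<union> copy_edges E \<gamma>)"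
proof -
  let ?S = "copy_edges E \<beta>" and ?T = "copy_edges E \<gamma>"
  note ST = copy_edges_edge_pairs[OF \<beta>] copy_edges_edge_pairs[OF \<gamma>]
  have STu: "?S \<union> ?T \<subseteq> edge_pairs"
    using ST by simp
  have cards: "card ?S = card E" "card ?T = card E"
    by (rule card_copy_edges[OF E placementsD(1)[OF \<beta>]], rule card_copy_edges[OF E placementsD(1)[OF \<gamma>]])
  have int: "integrable M (edges_present U)" if "U \<subseteq> edge_pairs" for U
    by (rule bounded_rv_integrable[OF bounded_rv_edges_present[OF that]])
  have "expectation (\<lambda>x. (copy \<beta> x + q) * (copy \<gamma> x + q))
      = expectation (\<lambda>x. edges_present (?S \<union> ?T) x + q * copy \<beta> x + q * copy \<gamma> x + q * q)"
    by (intro Bochner_Integration.integral_cong refl)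
      (simp only: edges_present_mult[symmetric], simp add: algebra_simps)
  also have "\<dots> = expectation (edges_present (?S \<union> ?T)) + q * expectation (copy \<beta>)
      + q * expectation (copy \<gamma>) + q * q"
    by (simp add: int[OF ST(1)] int[OF ST(2)] int[OF STu] prob_space)
  also have "\<dots> \<le> p ^ card (?S \<union> ?T) + p ^ card (?S \<union> ?T) + p ^ card (?S \<union> ?T) + p ^ card (?S \<union> ?T)"
  proof (intro add_mono)
    show "expectation (edges_present (?S \<union> ?T)) \<le> p ^ card (?S \<union> ?T)"
      by (rule expectation_edges_present_bounds(2)[OF STu])
    show "q * expectation (copy \<beta>) \<le> p ^ card (?S \<union> ?T)"
      using expectation_edges_present_mult_le[OF ST(1,2), of q] q cards by simp
    show "q * expectation (copy \<gamma>) \<le> p ^ card (?S \<union> ?T)"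
      using expectation_edges_present_mult_le[OF ST(2,1), of q] q cards by (simp add: Un_commute)
    have "q * q \<le> p ^ card E * p ^ card E"
      using q by (intro mult_mono) auto
    then show "q * q \<le> p ^ card (?S \<union> ?T)"
      using power_card_Un_le[of ?S ?T] by (simp add: cards)
  qed
  finally show ?thesis
    by simp
qed

text \<open>As for two copies, but four of the eight terms are grouped as \<open>q\<close> times the
  second-moment product, which accounts for \<open>1 + 1 + 1 + 4 + 1\<close>.\<close>

lemma centred_moment_3:
  assumes \<beta>: "\<beta> \<in> placements k n" and \<gamma>: "\<gamma> \<in> placements k n" and \<delta>: "\<delta> \<in> placements k n"
    and q: "0 \<le> q" "q \<le> p ^ card E"
  shows "expectation (\<lambda>x. (copy \<beta> x + q) * (copy \<gamma> x + q) * (copy \<delta> x + q))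
    \<le> 8 * p ^ card (copy_edges E \<beta> \<union> copy_edges E \<gamma> \<union> copy_edges E \<delta>)"
proof -
  let ?S = "copy_edges E \<beta>" and ?T = "copy_edges E \<gamma>" and ?U = "copy_edges E \<delta>"
  let ?r = "p ^ card (?S \<union> ?T \<union> ?U)"
  note STU = copy_edges_edge_pairs[OF \<beta>] copy_edges_edge_pairs[OF \<gamma>] copy_edges_edge_pairs[OF \<delta>]
  have un: "?S \<union> ?T \<subseteq> edge_pairs" "?S \<union> ?U \<subseteq> edge_pairs" "?T \<union> ?U \<subseteq> edge_pairs" "?S \<union> ?T \<union> ?U \<subseteq> edge_pairs"
    using STU by simp_all
  have cards: "card ?S = card E" "card ?T = card E" "card ?U = card E"
    using card_copy_edges[OF E placementsD(1)] \<beta> \<gamma> \<delta> by auto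
  have int: "integrable M (edges_present U)" if "U \<subseteq> edge_pairs" for U
    by (rule bounded_rv_integrable[OF bounded_rv_edges_present[OF that]])
  have "expectation (\<lambda>x. (copy \<beta> x + q) * (copy \<gamma> x + q) * (copy \<delta> x + q))
      = expectation (\<lambda>x. edges_present (?S \<union> ?T \<union> ?U) x + q * edges_present (?S \<union> ?U) x
        + q * edges_present (?T \<union> ?U) x + q * ((copy \<beta> x + q) * (copy \<gamma> x + q)) + q * q * copy \<delta> x)"
    by (intro Bochner_Integration.integral_cong refl)
      (simp only: edges_present_mult[symmetric], simp add: algebra_simps)
  also have "\<dots> = expectation (edges_present (?S \<union> ?T \<union> ?U)) + q * expectation (edges_present (?S \<union> ?U))
        + q * expectation (edges_present (?T \<union> ?U)) + q * expectation (\<lambda>x. (copy \<beta> x + q) * (copy \<gamma> x + q))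
        + q * q * expectation (copy \<delta>)"
  proof -
    have "integrable M (\<lambda>x. (copy \<beta> x + q) * (copy \<gamma> x + q))"
      by (intro bounded_rv_integrable bounded_rv_intros bounded_rv_copy \<beta> \<gamma>)
    then show ?thesis
      by (simp add: int[OF STU(3)] int[OF un(2)] int[OF un(3)] int[OF un(4)])
  qed
  also have "\<dots> \<le> ?r + ?r + ?r + 4 * ?r + ?r"
  proof (intro add_mono)
    show "expectation (edges_present (?S \<union> ?T \<union> ?U)) \<le> ?r"
      by (rule expectation_edges_present_bounds(2)[OF un(4)])
    show "q * expectation (edges_present (?S \<union> ?U)) \<le> ?r"
      using expectation_edges_present_mult_le[OF un(2) STU(2), of q] q cards
      by (simp add: Un_assoc Un_commute[of ?T])
    show "q * expectation (edges_present (?T \<union> ?U)) \<le> ?r"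
      using expectation_edges_present_mult_le[OF un(3) STU(1), of q] q cards
      by (simp add: Un_assoc Un_commute Un_left_commute)
    have "q * expectation (\<lambda>x. (copy \<beta> x + q) * (copy \<gamma> x + q)) \<le> p ^ card E * (4 * p ^ card (?S \<union> ?T))"
    proof (rule mult_mono)
      show "0 \<le> expectation (\<lambda>x. (copy \<beta> x + q) * (copy \<gamma> x + q))"
        using q by (intro integral_nonneg_AE) (auto simp: edges_present_def)
    qed (use q p01 centred_moment_2[OF \<beta> \<gamma> q] in auto)
    also have "\<dots> = 4 * p ^ (card (?S \<union> ?T) + card ?U)"
      by (simp add: power_add cards)
    also have "\<dots> \<le> 4 * ?r"
      using p01 card_Un_le[of "?S \<union> ?T" ?U] by (intro mult_left_mono power_decreasing) auto
    finally show "q * expectation (\<lambda>x. (copy \<beta> x + q) * (copy \<gamma> x + q)) \<le> 4 * ?r" .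
    have qq: "q * q \<le> p ^ card (?S \<union> ?T)"
    proof -
      have "q * q \<le> p ^ card E * p ^ card E"
        using q by (intro mult_mono) auto
      then show ?thesis
        using power_card_Un_le[of ?S ?T] by (simp add: cards)
    qed
    show "q * q * expectation (copy \<delta>) \<le> ?r"
      using expectation_edges_present_mult_le[OF STU(3) un(1) _ qq] q by (simp add: Un_commute)
  qed
  finally show ?thesis
    by simp
qed

text \<open>The edge probability and the shape of the pattern enter only through
  \<open>\<Psi>\<close> and the variance constant \<open>c\<close>, so both density regimes become
  instances of this bound.\<close>

theorem kolmogorov_normalized_copies:
  fixes \<Psi> c :: real
  assumes \<Psi>: "0 < \<Psi>"
    and dense: "\<And>I. I \<subseteq> {1..k} \<Longrightarrow> I \<noteq> {} \<Longrightarrow> \<Psi> \<le> real n ^ card I * p ^ card (E \<inter> vertex_pairs I)"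
    and c: "0 < c" and var: "c * (real n ^ k * p ^ card E)\<^sup>2 / \<Psi> \<le> variance copies"
  shows "kolmogorov_dist_normal M (normalized M copies)
    \<le> 15 * sqrt (24 * (8 * real k ^ 2) ^ k / (sqrt c ^ 3 * sqrt \<Psi>))"
proof -
  let ?P = "placements k n" and ?x = "real n ^ k * p ^ card E" and ?K = "(8 * real k ^ 2) ^ k"
  define q where "q = p ^ card E * pattern_density"
  define s where "s = sqrt (variance copies)"
  define \<xi> where "\<xi> \<beta> x = (copy \<beta> x - q) / s" for \<beta> x
  \<comment> \<open>With \<open>?x = n ^ k * p ^ card E\<close>, the quotient of the triple sum
    \<open>?K * ?x ^ 3 / \<Psi>\<^sup>2\<close> by \<open>s ^ 3\<close>, at least
    \<open>(sqrt c * ?x / sqrt \<Psi>) ^ 3\<close>. The 24 is \<open>2 * 8\<close> from third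
    moments plus \<open>4 * 2\<close> from the products of second and first moments.\<close>
  define R where "R = 24 * ?K / (sqrt c ^ 3 * sqrt \<Psi>)"
  have q: "0 \<le> q" "q \<le> p ^ card E"
    unfolding q_def using p01 pattern_density_bounds by (auto simp: mult_left_le)
  \<comment> \<open>A single vertex carries no edge; its density condition shows in particular that
    \<open>n\<close> is positive.\<close>
  have "\<Psi> \<le> real n"
  proof -
    have "E \<inter> vertex_pairs {1} = {}"
      by (auto simp: vertex_pairs_def)
    then show ?thesis
      using dense[of "{1}"] k by simp
  qed
  then have n: "0 < real n"
    using \<Psi> by linarith
  have x: "0 < ?x"
    using n p01 by simp
  have s: "sqrt c * ?x / sqrt \<Psi> \<le> s"
    using real_sqrt_le_mono[OF var] x by (simp add: s_def real_sqrt_mult real_sqrt_divide)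
  have t0: "0 < sqrt c * ?x / sqrt \<Psi>"
    using c x \<Psi> by simp
  then have s0: "0 < s"
    using s by linarith
  have W: "normalized M copies = (\<lambda>x. \<Sum>\<beta>\<in>?P. \<xi> \<beta> x)"
    unfolding normalized_def[abs_def] \<xi>_def s_def expectation_copies q_def
    by (simp only: copies_def sum_subtractf[symmetric] sum_divide_distrib)
  then have Wx: "(\<Sum>\<beta>\<in>?P. \<xi> \<beta> x) = (copies x - expectation copies) / s" for x
    unfolding normalized_def s_def by metis
  have b\<xi>: "bounded_rv M (\<xi> \<beta>)" if "\<beta> \<in> ?P" for \<beta>
    unfolding \<xi>_def[abs_def] by (intro bounded_rv_intros bounded_rv_copy that)
  have mean: "expectation (\<xi> \<beta>) = 0" if "\<beta> \<in> ?P" for \<beta>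
  proof -
    have "expectation (\<xi> \<beta>) = expectation (\<lambda>x. copy \<beta> x - q) / s"
      unfolding \<xi>_def[abs_def] by simp
    also have "expectation (\<lambda>x. copy \<beta> x - q) = expectation (copy \<beta>) - expectation (\<lambda>_. q)"
      by (intro Bochner_Integration.integral_diff bounded_rv_integrable bounded_rv_copy bounded_rv_const that)
    finally show ?thesis
      using expectation_copy[OF that] prob_space by (simp add: q_def)
  qed
  have var1: "expectation (\<lambda>x. (\<Sum>\<beta>\<in>?P. \<xi> \<beta> x)\<^sup>2) = 1"
  proof -
    have "expectation (\<lambda>x. (\<Sum>\<beta>\<in>?P. \<xi> \<beta> x)\<^sup>2) = expectation (\<lambda>x. (copies x - expectation copies)\<^sup>2 / s\<^sup>2)"
      by (simp only: Wx power_divide)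
    also have "\<dots> = variance copies / s\<^sup>2"
      by simp
    also have "variance copies = s\<^sup>2"
      using s0 unfolding s_def by simp
    finally show ?thesis
      using s0 by simp
  qed
  have present_within: "(of_bool (copy_edges E \<beta> \<subseteq> \<E> x \<inter> vertex_pairs A) - q) / s = \<xi> \<beta> x"
    if "\<beta> \<in> ?P" "\<beta> ` {1..k} \<subseteq> A" for \<beta> A x
  proof -
    have "copy_edges E \<beta> \<subseteq> vertex_pairs A"
      using copy_edges_within[OF that(1)] vertex_pairs_mono[OF that(2)] by (rule order_trans)
    then show ?thesis
      by (simp add: \<xi>_def edges_present_def)
  qed
  have indep1: "indep_var borel (\<xi> \<beta>) borel (\<lambda>x. \<Sum>\<gamma>\<in>{\<gamma>\<in>?P. \<not> hits \<beta> \<gamma>}. \<xi> \<gamma> x)" if \<beta>: "\<beta> \<in> ?P" for \<beta>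
  proof -
    have "indep_var borel (\<xi> \<beta>) borel (\<lambda>x. \<Sum>\<gamma>\<in>{\<gamma>\<in>?P. \<not> hits \<beta> \<gamma>}. (copy \<gamma> x - q) / s)"
    proof (rule indep_copy_functions[where A = "\<beta> ` {1..k}"
          and f = "\<lambda>S. (of_bool (copy_edges E \<beta> \<subseteq> S) - q) / s"])
      show "\<beta> ` {1..k} \<subseteq> {1..n}"
        by (rule placementsD(2)[OF \<beta>])
      show "(of_bool (copy_edges E \<beta> \<subseteq> \<E> x \<inter> vertex_pairs (\<beta> ` {1..k})) - q) / s = \<xi> \<beta> x" for x
        by (rule present_within[OF \<beta> order_refl])
    qed auto
    then show ?thesis
      by (simp only: \<xi>_def)
  qed
  have indep2: "indep_var borel (\<lambda>x. \<xi> \<beta> x * \<xi> \<gamma> x) borel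
      (\<lambda>x. \<Sum>\<delta>\<in>{\<delta>\<in>?P. \<not> (hits \<beta> \<delta> \<or> hits \<gamma> \<delta>)}. \<xi> \<delta> x)"
    if \<beta>: "\<beta> \<in> ?P" and \<gamma>: "\<gamma> \<in> ?P" for \<beta> \<gamma>
  proof -
    let ?A = "\<beta> ` {1..k} \<union> \<gamma> ` {1..k}"
    have "indep_var borel (\<lambda>x. \<xi> \<beta> x * \<xi> \<gamma> x) borel
        (\<lambda>x. \<Sum>\<delta>\<in>{\<delta>\<in>?P. \<not> (hits \<beta> \<delta> \<or> hits \<gamma> \<delta>)}. (copy \<delta> x - q) / s)"
    proof (rule indep_copy_functions[where A = ?A and f = "\<lambda>S. (of_bool (copy_edges E \<beta> \<subseteq> S) - q) / s
          * ((of_bool (copy_edges E \<gamma> \<subseteq> S) - q) / s)"])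
      show "?A \<subseteq> {1..n}"
        using placementsD(2)[OF \<beta>] placementsD(2)[OF \<gamma>] by simp
      show "(of_bool (copy_edges E \<beta> \<subseteq> \<E> x \<inter> vertex_pairs ?A) - q) / s
          * ((of_bool (copy_edges E \<gamma> \<subseteq> \<E> x \<inter> vertex_pairs ?A) - q) / s) = \<xi> \<beta> x * \<xi> \<gamma> x" for x
        using present_within[OF \<beta>, of ?A x] present_within[OF \<gamma>, of ?A x] by simp
    qed auto
    then show ?thesis
      by (simp only: \<xi>_def)
  qed
  have abs_\<xi>: "\<bar>\<xi> \<beta> x\<bar> \<le> (copy \<beta> x + q) / s" for \<beta> x
    unfolding \<xi>_def using s0 q by (auto simp: abs_div edges_present_def intro!: divide_right_mono)
  have nn: "0 \<le> (copy \<beta> x + q) / s" for \<beta> x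
    using s0 q by (simp add: edges_present_def)
  have summand: "2 * expectation (\<lambda>x. \<bar>\<xi> \<beta> x * \<xi> \<gamma> x * \<xi> \<delta> x\<bar>)
      + expectation (\<lambda>x. \<bar>\<xi> \<beta> x * \<xi> \<gamma> x\<bar>) * expectation (\<lambda>x. \<bar>\<xi> \<delta> x\<bar>)
      \<le> 24 / s ^ 3 * p ^ card (copy_edges E \<beta> \<union> copy_edges E \<gamma> \<union> copy_edges E \<delta>)"
    if \<beta>: "\<beta> \<in> ?P" and \<gamma>: "\<gamma> \<in> ?P" and \<delta>: "\<delta> \<in> ?P" for \<beta> \<gamma> \<delta>
  proof -
    let ?ST = "copy_edges E \<beta> \<union> copy_edges E \<gamma>" and ?U = "copy_edges E \<delta>"
    have "expectation (\<lambda>x. \<bar>\<xi> \<beta> x * \<xi> \<gamma> x * \<xi> \<delta> x\<bar>)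
        \<le> expectation (\<lambda>x. ((copy \<beta> x + q) * (copy \<gamma> x + q) * (copy \<delta> x + q)) / s ^ 3)"
    proof (rule expectation_mono_bounded)
      fix x
      have "\<bar>\<xi> \<beta> x * \<xi> \<gamma> x * \<xi> \<delta> x\<bar> \<le> ((copy \<beta> x + q) / s) * ((copy \<gamma> x + q) / s) * ((copy \<delta> x + q) / s)"
        unfolding abs_mult by (intro mult_mono abs_\<xi> mult_nonneg_nonneg nn) auto
      then show "\<bar>\<xi> \<beta> x * \<xi> \<gamma> x * \<xi> \<delta> x\<bar> \<le> ((copy \<beta> x + q) * (copy \<gamma> x + q) * (copy \<delta> x + q)) / s ^ 3"
        by (simp add: power3_eq_cube)
    qed (intro bounded_rv_intros bounded_rv_copy b\<xi> \<beta> \<gamma> \<delta>)+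
    also have "\<dots> = expectation (\<lambda>x. (copy \<beta> x + q) * (copy \<gamma> x + q) * (copy \<delta> x + q)) / s ^ 3"
      by (rule integral_divide_zero)
    also have "\<dots> \<le> 8 * p ^ card (?ST \<union> ?U) / s ^ 3"
      using s0 by (intro divide_right_mono centred_moment_3 \<beta> \<gamma> \<delta> q) auto
    finally have three: "expectation (\<lambda>x. \<bar>\<xi> \<beta> x * \<xi> \<gamma> x * \<xi> \<delta> x\<bar>) \<le> 8 * p ^ card (?ST \<union> ?U) / s ^ 3" .
    have "expectation (\<lambda>x. \<bar>\<xi> \<beta> x * \<xi> \<gamma> x\<bar>) \<le> expectation (\<lambda>x. ((copy \<beta> x + q) * (copy \<gamma> x + q)) / s ^ 2)"
    proof (rule expectation_mono_bounded)
      fix x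
      have "\<bar>\<xi> \<beta> x * \<xi> \<gamma> x\<bar> \<le> ((copy \<beta> x + q) / s) * ((copy \<gamma> x + q) / s)"
        unfolding abs_mult by (intro mult_mono abs_\<xi> nn) auto
      then show "\<bar>\<xi> \<beta> x * \<xi> \<gamma> x\<bar> \<le> ((copy \<beta> x + q) * (copy \<gamma> x + q)) / s ^ 2"
        by (simp add: power2_eq_square)
    qed (intro bounded_rv_intros bounded_rv_copy b\<xi> \<beta> \<gamma>)+
    also have "\<dots> = expectation (\<lambda>x. (copy \<beta> x + q) * (copy \<gamma> x + q)) / s ^ 2"
      by (rule integral_divide_zero)
    also have "\<dots> \<le> 4 * p ^ card ?ST / s ^ 2"
      using s0 by (intro divide_right_mono centred_moment_2 \<beta> \<gamma> q) auto
    finally have two: "expectation (\<lambda>x. \<bar>\<xi> \<beta> x * \<xi> \<gamma> x\<bar>) \<le> 4 * p ^ card ?ST / s ^ 2" .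
    have "expectation (\<lambda>x. \<bar>\<xi> \<delta> x\<bar>) \<le> expectation (\<lambda>x. (copy \<delta> x + q) / s)"
      by (rule expectation_mono_bounded) (intro bounded_rv_intros bounded_rv_copy b\<xi> \<delta> abs_\<xi>)+
    also have "\<dots> = expectation (\<lambda>x. copy \<delta> x + q) / s"
      by (rule integral_divide_zero)
    also have "expectation (\<lambda>x. copy \<delta> x + q) = expectation (copy \<delta>) + expectation (\<lambda>_. q)"
      by (intro Bochner_Integration.integral_add bounded_rv_integrable bounded_rv_copy bounded_rv_const \<delta>)
    also have "expectation (\<lambda>_. q) = q"
      by (simp add: prob_space)
    also have "expectation (copy \<delta>) = q"
      using expectation_copy[OF \<delta>] by (simp add: q_def)
    also have "(q + q) / s \<le> 2 * p ^ card E / s"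
      using q s0 by (intro divide_right_mono) auto
    finally have one: "expectation (\<lambda>x. \<bar>\<xi> \<delta> x\<bar>) \<le> 2 * p ^ card E / s" .
    \<comment> \<open>Adding the edge counts without overlap is more restrictive than taking the
      union, so the product of moments fits under the same weight as the third moment.\<close>
    have "expectation (\<lambda>x. \<bar>\<xi> \<beta> x * \<xi> \<gamma> x\<bar>) * expectation (\<lambda>x. \<bar>\<xi> \<delta> x\<bar>)
        \<le> (4 * p ^ card ?ST / s ^ 2) * (2 * p ^ card E / s)"
      using two one s0 p01 by (intro mult_mono) (auto intro!: integral_nonneg_AE)
    also have "\<dots> = 8 * p ^ (card ?ST + card ?U) / s ^ 3"
      by (simp add: power_add card_copy_edges[OF E placementsD(1)[OF \<delta>]] power3_eq_cube power2_eq_square)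
    also have "\<dots> \<le> 8 * p ^ card (?ST \<union> ?U) / s ^ 3"
      using p01 s0 card_Un_le[of ?ST ?U] by (intro divide_right_mono mult_left_mono power_decreasing) auto
    finally have "expectation (\<lambda>x. \<bar>\<xi> \<beta> x * \<xi> \<gamma> x\<bar>) * expectation (\<lambda>x. \<bar>\<xi> \<delta> x\<bar>) \<le> 8 * p ^ card (?ST \<union> ?U) / s ^ 3" .
    with three show ?thesis
      by simp
  qed
  let ?lhs = "\<Sum>\<beta>\<in>?P. \<Sum>\<gamma>\<in>{\<gamma>\<in>?P. hits \<beta> \<gamma>}. \<Sum>\<delta>\<in>{\<delta>\<in>?P. hits \<beta> \<delta> \<or> hits \<gamma> \<delta>}.
      2 * expectation (\<lambda>x. \<bar>\<xi> \<beta> x * \<xi> \<gamma> x * \<xi> \<delta> x\<bar>)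
      + expectation (\<lambda>x. \<bar>\<xi> \<beta> x * \<xi> \<gamma> x\<bar>) * expectation (\<lambda>x. \<bar>\<xi> \<delta> x\<bar>)"
  have "?lhs \<le> (\<Sum>\<beta>\<in>?P. \<Sum>\<gamma>\<in>{\<gamma>\<in>?P. hits \<beta> \<gamma>}. \<Sum>\<delta>\<in>{\<delta>\<in>?P. hits \<beta> \<delta> \<or> hits \<gamma> \<delta>}.
      24 / s ^ 3 * p ^ card (copy_edges E \<beta> \<union> copy_edges E \<gamma> \<union> copy_edges E \<delta>))"
    by (intro sum_mono summand) auto
  also have "\<dots> = 24 / s ^ 3 * (\<Sum>\<beta>\<in>?P. \<Sum>\<gamma>\<in>{\<gamma>\<in>?P. hits \<beta> \<gamma>}. \<Sum>\<delta>\<in>{\<delta>\<in>?P. hits \<beta> \<delta> \<or> hits \<gamma> \<delta>}.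
      p ^ card (copy_edges E \<beta> \<union> copy_edges E \<gamma> \<union> copy_edges E \<delta>))"
    by (simp only: sum_distrib_left)
  also have "\<dots> \<le> 24 / s ^ 3 * (?K * ?x ^ 3 / \<Psi>\<^sup>2)"
    using s0 p01 k by (intro mult_left_mono sum_linked_triples[OF E _ _ \<Psi> _ dense]) auto
  also have "\<dots> \<le> 24 / (sqrt c * ?x / sqrt \<Psi>) ^ 3 * (?K * ?x ^ 3 / \<Psi>\<^sup>2)"
    using s t0 s0 x by (intro mult_right_mono divide_left_mono power_mono) auto
  also have "\<dots> = R"
  proof -
    \<comment> \<open>The cancellation is done with \<open>r = sqrt \<Psi>\<close>, so that
      \<open>\<Psi>\<^sup>2\<close> is the polynomial \<open>(r * r)\<^sup>2\<close>.\<close>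
    have "24 / (a * y / r) ^ 3 * (K * y ^ 3 / (r * r)\<^sup>2) = 24 * K / (a ^ 3 * r)"
      if "0 < a" "0 < y" "0 < r" for a y r K :: real
      using that by (simp add: field_simps power2_eq_square power3_eq_cube)
    from this[of "sqrt c" ?x "sqrt \<Psi>" ?K] show ?thesis
      using c x \<Psi> by (simp add: R_def)
  qed
  finally have lhs: "?lhs \<le> R" .
  have R0: "0 < R"
    using k c \<Psi> by (simp add: R_def)
  have "kolmogorov_dist_normal M (\<lambda>x. \<Sum>\<beta>\<in>?P. \<xi> \<beta> x) \<le> 15 * sqrt R"
  proof (rule stein_kolmogorov[OF _ R0])
    show "bounded_rv M (\<lambda>x. \<Sum>\<beta>\<in>?P. \<xi> \<beta> x)"
      by (intro bounded_rv_sum b\<xi>)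
    fix f f' f'' :: "real \<Rightarrow> real" and c c' L
    assume f: "\<And>w. (f has_real_derivative f' w) (at w)" "\<And>w. (f' has_real_derivative f'' w) (at w)"
      "\<And>w. \<bar>f w\<bar> \<le> c" "\<And>w. \<bar>f' w\<bar> \<le> c'" "\<And>w. \<bar>f'' w\<bar> \<le> L"
    have "0 \<le> L"
      using f(5)[of 0] abs_ge_zero[of "f'' 0"] by linarith
    have "\<bar>expectation (\<lambda>x. f' (\<Sum>\<beta>\<in>?P. \<xi> \<beta> x) - (\<Sum>\<beta>\<in>?P. \<xi> \<beta> x) * f (\<Sum>\<beta>\<in>?P. \<xi> \<beta> x))\<bar> \<le> L * ?lhs"
      by (rule stein_local_dependence[where D = "\<lambda>\<beta> \<gamma>. hits \<beta> \<gamma>", OF finite_placements b\<xi> mean var1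
            indep1 indep2 f])
    also have "\<dots> \<le> L * R"
      using lhs \<open>0 \<le> L\<close> by (rule mult_left_mono)
    finally show "\<bar>expectation (\<lambda>x. f' (\<Sum>\<beta>\<in>?P. \<xi> \<beta> x) - (\<Sum>\<beta>\<in>?P. \<xi> \<beta> x) * f (\<Sum>\<beta>\<in>?P. \<xi> \<beta> x))\<bar> \<le> L * R" .
  qed
  then show ?thesis
    unfolding W R_def .
qed

section \<open>From labelled placements to the subgraph count\<close>

lemma subgraph_count_eq: "subgraph_count k E n \<E> \<omega> = 1 / card (automorphisms {1..k} E) * copies \<omega>"
proof -
  have "(\<Prod>(u, v)\<in>oriented_edges E. of_bool ({\<beta> u, \<beta> v} \<in> \<E> \<omega>)) = copy \<beta> \<omega>" for \<beta>
  proof -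
    have of_bool_prod: "(\<Prod>e\<in>S. of_bool (Q e)) = (of_bool (\<forall>e\<in>S. Q e) :: real)"
      if "finite S" for S :: "nat set set" and Q
      using that by induction auto
    have "(\<Prod>(u, v)\<in>oriented_edges E. of_bool ({\<beta> u, \<beta> v} \<in> \<E> \<omega>))
        = (\<Prod>x\<in>oriented_edges E. of_bool (\<beta> ` (case x of (u, v) \<Rightarrow> {u, v}) \<in> \<E> \<omega>) :: real)"
      by (intro prod.cong) auto
    also have "\<dots> = (\<Prod>e\<in>E. of_bool (\<beta> ` e \<in> \<E> \<omega>))"
      by (rule prod.reindex_bij_betw[OF bij_betw_oriented_edges[OF E]])
    also have "\<dots> = of_bool (\<forall>e\<in>E. \<beta> ` e \<in> \<E> \<omega>)"
      using E finite_vertex_pairs[of "{1..k}"] by (intro of_bool_prod) (auto intro: finite_subset)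
    also have "\<dots> = copy \<beta> \<omega>"
      by (auto simp: edges_present_def copy_edges_def image_subset_iff)
    finally show ?thesis .
  qed
  then show ?thesis
    by (simp add: subgraph_count_def copies_def placements_def)
qed

end

lemma card_automorphisms_pos:
  assumes "finite V"
  shows "0 < card (automorphisms V E)"
proof -
  have "id \<in> automorphisms V E"
    by (auto simp: automorphisms_def permutes_id)
  moreover have "finite (automorphisms V E)"
    by (rule finite_subset[OF _ finite_permutations[OF assms]]) (auto simp: automorphisms_def)
  ultimately show ?thesis
    by (auto simp: card_gt_0_iff)
qed

lemma normalized_scale:
  assumes "0 < a"
  shows "normalized M (\<lambda>\<omega>. a * Y \<omega>) = normalized M Y"
proof
  fix \<omega>
  let ?e = "integral\<^sup>L M Y"
  have "(\<integral>x. (a * Y x - a * ?e)\<^sup>2 \<partial>M) = (\<integral>x. a\<^sup>2 * (Y x - ?e)\<^sup>2 \<partial>M)"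
    by (simp only: right_diff_distrib[symmetric] power_mult_distrib)
  then have "sqrt (\<integral>x. (a * Y x - a * ?e)\<^sup>2 \<partial>M) = a * sqrt (\<integral>x. (Y x - ?e)\<^sup>2 \<partial>M)"
    using assms by (simp add: real_sqrt_mult)
  then show "normalized M (\<lambda>\<omega>. a * Y \<omega>) \<omega> = normalized M Y \<omega>"
    using assms by (simp add: normalized_def right_diff_distrib[symmetric])
qed

lemma (in rcm_pattern) normalized_subgraph_count:
  "normalized M (subgraph_count k E n \<E>) = normalized M copies"
  unfolding subgraph_count_eq[abs_def]
  by (rule normalized_scale) (use card_automorphisms_pos[of "{1..k}" E] in simp)

section \<open>The two density regimes\<close>

text \<open>Clearing the denominators brings in single-vertex sets, for which both sides are 0; the
  definition only speaks about at least two vertices.\<close>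

lemma strongly_balanced_induced:
  assumes E: "E \<subseteq> vertex_pairs {1..k}" and k: "2 \<le> k" and sb: "strongly_balanced {1..k} E"
    and I: "I \<subseteq> {1..k}" "I \<noteq> {}"
  shows "real (card (E \<inter> vertex_pairs I)) * (real k - 1) \<le> real (card E) * (real (card I) - 1)"
proof -
  have finI: "finite I"
    using I(1) by (rule finite_subset) simp
  show ?thesis
  proof (cases "2 \<le> card I")
    case True
    have "subgraph I (E \<inter> vertex_pairs I) {1..k} E"
      using I finI by (auto simp: subgraph_def simple_graph_def)
    then have "real (card (E \<inter> vertex_pairs I)) / (real (card I) - 1) \<le> real (card E) / (real (card {1..k}) - 1)"
      using sb True unfolding strongly_balanced_def by blast
    then show ?thesis
      using True k by (simp add: field_simps)
  next
    case False
    then have "card I = 1"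
      using I(2) finI card_gt_0_iff[of I] by linarith
    then obtain v where "I = {v}"
      by (rule card_1_singletonE)
    then have "E \<inter> vertex_pairs I = {}"
      by (auto simp: vertex_pairs_def)
    then show ?thesis
      using \<open>card I = 1\<close> by simp
  qed
qed

text \<open>With \<open>\<kappa> = k - 1\<close>, inserting the threshold value for \<open>p\<close>
  leaves \<open>n\<close> to the exponent \<open>i - \<kappa> * e' / e\<close>, which balance keeps
  at least 1.\<close>

lemma dense_regime_bound:
  fixes n p \<kappa> :: real and e e' i :: nat
  assumes n: "1 \<le> n" and p: "n powr (- \<kappa> / e) \<le> p" and e: "0 < e"
    and bal: "e' * \<kappa> \<le> e * (real i - 1)"
  shows "n \<le> n ^ i * p ^ e'"
proof -
  have "\<kappa> / e * e' \<le> real i - 1"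
    using bal e by (simp add: field_simps)
  then have "n powr 1 \<le> n powr (real i + (- \<kappa> / e) * e')"
    using n by (intro powr_mono) auto
  also have "\<dots> = n ^ i * (n powr (- \<kappa> / e)) ^ e'"
    unfolding powr_add using n by (simp add: powr_realpow[symmetric] powr_powr)
  also have "\<dots> \<le> n ^ i * p ^ e'"
    using n p by (intro mult_left_mono power_mono) auto
  finally show ?thesis
    using n by simp
qed

text \<open>After cancelling \<open>p ^ e'\<close>, the threshold bound on the remaining
  \<open>e - e'\<close> factors leaves exponent \<open>1 + (k - 1) * e' / e\<close>, at most
  \<open>i\<close> by balance.\<close>

lemma sparse_regime_bound:
  fixes n p :: real and e e' i k :: nat
  assumes n: "1 \<le> n" and p: "0 < p" "p \<le> n powr (- (real k - 1) / e)" and e: "0 < e" "e' \<le> e"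
    and bal: "e' * (real k - 1) \<le> e * (real i - 1)"
  shows "n ^ k * p ^ e \<le> n ^ i * p ^ e'"
proof -
  have "n ^ k * p ^ (e - e') \<le> n ^ k * (n powr (- (real k - 1) / e)) ^ (e - e')"
    using n p by (intro mult_left_mono power_mono) auto
  also have "\<dots> = n powr (real k + (- (real k - 1) / e) * (real e - real e'))"
    using n e by (simp add: powr_add powr_realpow[symmetric] powr_powr of_nat_diff)
  also have "\<dots> \<le> n powr (real i)"
    using n e bal by (intro powr_mono) (auto simp: field_simps)
  also have "\<dots> = n ^ i"
    using n by (simp add: powr_realpow)
  finally have "n ^ k * p ^ (e - e') * p ^ e' \<le> n ^ i * p ^ e'"
    using p by (intro mult_right_mono) auto
  then show ?thesis
    using e(2) by (simp add: mult.assoc power_add[symmetric])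
qed

text \<open>The two square roots give the exponent 1/4, which is weakened to the stated one; the
  weakening relies on \<open>\<Psi> \<ge> 1\<close>.\<close>

lemma sqrt_sqrt_rate:
  fixes A B \<Psi> :: real
  assumes A: "0 < A" "0 < B" and \<Psi>: "1 \<le> \<Psi>" and k: "2 \<le> k"
  shows "15 * sqrt (A / (B * sqrt \<Psi>)) \<le> 15 * sqrt (A / B) / \<Psi> powr (1 / (2 + 4 * real k))"
proof -
  have "\<Psi> powr (1 / (2 + 4 * real k)) \<le> \<Psi> powr (1 / 4)"
    using \<Psi> k by (intro powr_mono) (auto simp: field_simps)
  also have "\<dots> = sqrt (sqrt \<Psi>)"
    using \<Psi> by (simp add: powr_half_sqrt[symmetric] powr_powr)
  finally have "15 * sqrt (A / B) / sqrt (sqrt \<Psi>) \<le> 15 * sqrt (A / B) / \<Psi> powr (1 / (2 + 4 * real k))"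
    using A \<Psi> by (intro divide_left_mono mult_pos_pos) auto
  then show ?thesis
    by (simp add: real_sqrt_divide real_sqrt_mult)
qed

theorem corollary7p9:
  fixes \<mu> :: "(real ^ 'd) measure"
    and H :: "real ^ 'd \<Rightarrow> real ^ 'd \<Rightarrow> real"
    and p :: "nat \<Rightarrow> real"
    and M :: "nat \<Rightarrow> 'w measure"
    and X :: "nat \<Rightarrow> nat \<Rightarrow> 'w \<Rightarrow> real ^ 'd"
    and \<E> :: "nat \<Rightarrow> 'w \<Rightarrow> nat set set"
    and k :: nat and E :: "nat set set"
  assumes setting: "connection_setting \<mu> H"
    and p: "\<And>n. n \<ge> 1 \<Longrightarrow> 0 < p n \<and> p n < 1"
    and model: "\<And>n. n \<ge> 1 \<Longrightarrow> binomial_rcm (M n) n \<mu> H (p n) (X n) (\<E> n)"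
    and k: "k \<ge> 2"
    and graph: "simple_graph {1..k} E" "connected_graph {1..k} E" "strongly_balanced {1..k} E"
    and variance_pos: "\<And>n. n \<ge> 1 \<Longrightarrow>
      prob_space.variance (M n)
        (\<lambda>\<omega>. \<Sum>l\<in>{1..k}. first_order_fun \<mu> H (p n) k E l (X n 1 \<omega>)) > 0"
  shows "\<exists>C>0.
    (much_less (\<lambda>n. real n powr (- (real k - 1) / real (card E))) p \<longrightarrow>
      (\<forall>\<^sub>F n in sequentially.
        kolmogorov_dist_normal (M n) (normalized (M n) (subgraph_count k E n (\<E> n)))
          \<le> C / real n powr (1 / (2 + 4 * real k)))) \<and>
    (much_less p (\<lambda>n. real n powr (- (real k - 1) / real (card E))) \<longrightarrow>
      (\<forall>\<^sub>F n in sequentially.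
        kolmogorov_dist_normal (M n) (normalized (M n) (subgraph_count k E n (\<E> n)))
          \<le> C / (real n ^ k * p n ^ card E) powr (1 / (2 + 4 * real k))))"
proof -
  have E: "E \<subseteq> vertex_pairs {1..k}"
    using graph(1) by (simp add: simple_graph_def)
  interpret G: pattern \<mu> H k E
    using setting E k by unfold_locales auto
  have rcm: "rcm_pattern (M n) n \<mu> H (p n) (X n) (\<E> n) k E" if "1 \<le> n" for n
    using model[OF that] p[OF that] G.pattern_axioms setting
    by (intro rcm_pattern.intro rcm.intro connection.intro rcm_axioms.intro) auto
  define e where "e = card E"
  define V where "V = G.root_var"
  define \<theta> where "\<theta> = G.pattern_density"
  define Kol where "Kol n = kolmogorov_dist_normal (M n) (normalized (M n) (subgraph_count k E n (\<E> n)))" for n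
  \<comment> \<open>Vertices 1 and 2 exist because \<open>k \<ge> 2\<close>, and a path between them
    uses an edge. This keeps the threshold exponent from being a division by zero.\<close>
  have e: "0 < e"
  proof -
    have "(1, 2) \<in> {(a, b). {a, b} \<in> E}\<^sup>*"
      using graph(2) k by (auto simp: connected_graph_def)
    then have "E \<noteq> {}"
      by (auto elim: rtranclE)
    moreover have "finite E"
      using E finite_vertex_pairs[of "{1..k}"] by (auto intro: finite_subset)
    ultimately show ?thesis
      by (simp add: e_def card_gt_0_iff)
  qed
  \<comment> \<open>The case \<open>n = 1\<close> of the hypothesis is enough: the summed
    first-order functions are a scalar multiple of \<open>root_sum\<close>, and
    \<open>root_var\<close> does not involve \<open>n\<close>.\<close>
  have V: "0 < V"
  proof -
    interpret R: rcm_pattern "M 1" 1 \<mu> H "p 1" "X 1" "\<E> 1" k E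
      by (rule rcm) simp
    let ?c = "p 1 ^ card E / card (automorphisms {1..k} E)"
    have f: "(\<Sum>l\<in>{1..k}. first_order_fun \<mu> H (p 1) k E l x) = ?c * G.root_sum x" for x
      by (simp add: first_order_fun_def G.root_sum_def G.rooted_def G.weight_def sum_distrib_left)
    have mean: "R.expectation (\<lambda>\<omega>. G.root_sum (X 1 1 \<omega>)) = (\<integral>z. G.root_sum z \<partial>\<mu>)"
      by (rule R.expectation_point[OF _ G.root_sum_measurable]) simp
    have "R.variance (\<lambda>\<omega>. ?c * G.root_sum (X 1 1 \<omega>)) = R.expectation (\<lambda>\<omega>. ?c\<^sup>2 * (G.root_dev (X 1 1 \<omega>))\<^sup>2)"
      by (simp only: integral_mult_right_zero mean G.root_dev_def right_diff_distrib[symmetric] power_mult_distrib)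
    also have "\<dots> = ?c\<^sup>2 * R.expectation (\<lambda>\<omega>. (G.root_dev (X 1 1 \<omega>))\<^sup>2)"
      by (rule integral_mult_right_zero)
    also have "R.expectation (\<lambda>\<omega>. (G.root_dev (X 1 1 \<omega>))\<^sup>2) = V"
      unfolding V_def G.root_var_def
      using R.expectation_point[of 1 "\<lambda>x. (G.root_dev x)\<^sup>2"] G.root_dev_measurable by simp
    finally have "0 < ?c\<^sup>2 * V"
      using variance_pos[of 1] unfolding f by simp
    then show ?thesis
      by (simp add: zero_less_mult_iff)
  qed
  have \<theta>: "0 < \<theta>"
    unfolding \<theta>_def using V by (intro G.pattern_density_pos) (simp add: V_def)
  have main: "Kol n \<le> 15 * sqrt (24 * (8 * real k ^ 2) ^ k / (sqrt c ^ 3 * sqrt \<Psi>))"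
    if n: "1 \<le> n" and \<Psi>: "0 < \<Psi>" and c: "0 < c"
      and dense: "\<And>I. I \<subseteq> {1..k} \<Longrightarrow> I \<noteq> {} \<Longrightarrow> \<Psi> \<le> real n ^ card I * p n ^ card (E \<inter> vertex_pairs I)"
      and var: "c * (real n ^ k * p n ^ e)\<^sup>2 / \<Psi>
        \<le> prob_space.variance (M n) (rcm_pattern.copies n (\<E> n) k E)" for n \<Psi> c
  proof -
    interpret R: rcm_pattern "M n" n \<mu> H "p n" "X n" "\<E> n" k E
      by (rule rcm[OF n])
    show ?thesis
      using R.kolmogorov_normalized_copies[OF \<Psi> dense c] var
      unfolding Kol_def e_def R.normalized_subgraph_count by simp
  qed
  have trivial: "Kol n \<le> 1" if n: "1 \<le> n" for n
  proof -
    interpret R: rcm_pattern "M n" n \<mu> H "p n" "X n" "\<E> n" k E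
      by (rule rcm[OF n])
    show ?thesis
      using R.kolmogorov_dist_le_1 unfolding Kol_def by simp
  qed
  have placed: "(1/2) ^ k * (real n ^ k * p n ^ e) \<le> real (card (placements k n)) * p n ^ e"
    if "2 * k \<le> n" "1 \<le> n" for n
    using mult_right_mono[OF card_placements_ge[OF that(1)], of "p n ^ e"] p[OF that(2)]
    by (simp add: power_divide mult.assoc)
  define A where "A = 24 * (8 * real k ^ 2) ^ k"
  \<comment> \<open>\<open>(1/4) ^ k\<close> is the square of the factor \<open>(1/2) ^ k\<close>
    lost in \<open>placed\<close>, since the projection bound is quadratic in the number of
    placements. The diagonal bound is linear in it, so \<open>c2\<close> carries
    \<open>(1/2) ^ k\<close> and one further \<open>1/2\<close>.\<close>
  define c1 where "c1 = (1/4) ^ k * V"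
  define c2 where "c2 = (1/2) ^ k * \<theta> / 2"
  \<comment> \<open>Adding the constants gives one \<open>C\<close> for both regimes; the summand 1
    covers the trivial case of an expected order below 1.\<close>
  define C where "C = 1 + 15 * sqrt (A / sqrt c1 ^ 3) + 15 * sqrt (A / sqrt c2 ^ 3)"
  have pos: "0 < A" "0 < c1" "0 < c2"
    using k V \<theta> by (auto simp: A_def c1_def c2_def)
  have C: "1 \<le> C" "15 * sqrt (A / sqrt c1 ^ 3) \<le> C" "15 * sqrt (A / sqrt c2 ^ 3) \<le> C"
    using pos by (auto simp: C_def)
  have rate: "Kol n \<le> C / \<Psi> powr (1 / (2 + 4 * real k))"
    if "Kol n \<le> 15 * sqrt (A / (sqrt c ^ 3 * sqrt \<Psi>))" "1 \<le> \<Psi>" "0 < c"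
      "15 * sqrt (A / sqrt c ^ 3) \<le> C" for n \<Psi> c
  proof -
    have "Kol n \<le> 15 * sqrt (A / sqrt c ^ 3) / \<Psi> powr (1 / (2 + 4 * real k))"
      using sqrt_sqrt_rate[of A "sqrt c ^ 3" \<Psi> k] that pos(1) k by simp
    also have "\<dots> \<le> C / \<Psi> powr (1 / (2 + 4 * real k))"
      using that(4) by (intro divide_right_mono) auto
    finally show ?thesis .
  qed
  let ?g = "\<lambda>n. real n powr (- (real k - 1) / real e)"
  have balanced: "real (card (E \<inter> vertex_pairs I)) * (real k - 1) \<le> real e * (real (card I) - 1)"
    if "I \<subseteq> {1..k}" "I \<noteq> {}" for I
    unfolding e_def by (rule strongly_balanced_induced[OF E k graph(3) that])
  have dense: "\<forall>\<^sub>F n in sequentially. Kol n \<le> C / real n powr (1 / (2 + 4 * real k))"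
    if less: "much_less ?g p"
  proof -
    have "\<forall>\<^sub>F n in sequentially. ?g n / p n < 1"
      using less unfolding much_less_def by (intro order_tendstoD(2)) auto
    then show ?thesis
      using eventually_ge_at_top[of "2 * k"]
    proof eventually_elim
      case (elim n)
      have n: "1 \<le> n"
        using elim k by simp
      interpret R: rcm_pattern "M n" n \<mu> H "p n" "X n" "\<E> n" k E
        by (rule rcm[OF n])
      have gp: "?g n \<le> p n"
        using elim(1) p[OF n] by (simp add: field_simps)
      have "Kol n \<le> 15 * sqrt (A / (sqrt c1 ^ 3 * sqrt (real n)))"
        unfolding A_def
      proof (rule main[OF n _ pos(2)])
        show "0 < real n"
          using n by simp
        show "real n \<le> real n ^ card I * p n ^ card (E \<inter> vertex_pairs I)"
          if "I \<subseteq> {1..k}" "I \<noteq> {}" for I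
          using dense_regime_bound[OF _ gp e] balanced[OF that] n by simp
        have "c1 * (real n ^ k * p n ^ e)\<^sup>2 / real n = ((1/2) ^ k * (real n ^ k * p n ^ e))\<^sup>2 * V / real n"
          by (simp add: c1_def power_mult_distrib power_divide power2_eq_square power_mult_distrib[symmetric])
        also have "\<dots> \<le> (real (card (placements k n)) * p n ^ e)\<^sup>2 * V / real n"
          using placed[OF elim(2) n] V p[OF n]
          by (intro divide_right_mono mult_right_mono power_mono) auto
        also have "\<dots> \<le> R.variance R.copies"
          unfolding V_def e_def using n by (intro R.variance_copies_ge_projection) simp
        finally show "c1 * (real n ^ k * p n ^ e)\<^sup>2 / real n \<le> R.variance R.copies" .
      qed
      then show ?case
        using n pos(2) C(2) by (intro rate) auto
    qed
  qed
  have sparse: "\<forall>\<^sub>F n in sequentially. Kol n \<le> C / (real n ^ k * p n ^ e) powr (1 / (2 + 4 * real k))"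
    if less: "much_less p ?g"
  proof -
    have lim: "(\<lambda>n. p n / ?g n) \<longlonglongrightarrow> 0"
      using less by (simp add: much_less_def)
    \<comment> \<open>The power \<open>e\<close> is the right one because
      \<open>?g n ^ e = n / n ^ k\<close>, so that this ratio is \<open>n ^ k * p n ^ e / n\<close>.
      Its smallness is what makes the diagonal dominate the variance.\<close>
    then have "(\<lambda>n. (p n / ?g n) ^ e) \<longlonglongrightarrow> 0"
      using tendsto_power[OF lim, of e] e by simp
    then have "\<forall>\<^sub>F n in sequentially. (p n / ?g n) ^ e < 1 / (2 * (2 * real k) ^ k)"
      using k by (intro order_tendstoD(2)) auto
    moreover have "\<forall>\<^sub>F n in sequentially. p n / ?g n < 1"
      using lim by (intro order_tendstoD(2)) auto
    ultimately show ?thesis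
      using eventually_ge_at_top[of "2 * k"]
    proof eventually_elim
      case (elim n)
      have n: "1 \<le> n"
        using elim k by simp
      interpret R: rcm_pattern "M n" n \<mu> H "p n" "X n" "\<E> n" k E
        by (rule rcm[OF n])
      let ?x = "real n ^ k * p n ^ e"
      have x: "0 < ?x"
        using n p[OF n] by simp
      have pg: "p n \<le> ?g n"
        using elim(2) n by (simp add: field_simps)
      have small: "(2 * real k) ^ k * (?x / real n) \<le> 1 / 2"
      proof -
        have "?g n ^ e = real n powr (- (real k - 1))"
          using n e by (simp add: powr_realpow[symmetric] powr_powr)
        also have "\<dots> = real n / real n ^ k"
          using n by (simp add: powr_diff powr_realpow)
        finally have "(p n / ?g n) ^ e = ?x / real n"
          using n by (simp add: power_divide)
        then show ?thesis
          using elim(1) k by (simp add: field_simps)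
      qed
      show ?case
      \<comment> \<open>The weakening of the exponent in \<open>rate\<close> requires
        \<open>\<Psi> = ?x\<close> to be at least 1. Otherwise the denominator is at most 1 and the
        right side is at least \<open>C \<ge> 1\<close>.\<close>
      proof (cases "1 \<le> ?x")
        case True
        have "Kol n \<le> 15 * sqrt (A / (sqrt c2 ^ 3 * sqrt ?x))"
          unfolding A_def
        proof (rule main[OF n x pos(3)])
          show "?x \<le> real n ^ card I * p n ^ card (E \<inter> vertex_pairs I)"
            if "I \<subseteq> {1..k}" "I \<noteq> {}" for I
          proof (rule sparse_regime_bound[OF _ _ pg e])
            have "finite E"
              using e by (auto simp: e_def intro: card_ge_0_finite)
            then show "card (E \<inter> vertex_pairs I) \<le> e"
              unfolding e_def by (intro card_mono) auto
          qed (use balanced[OF that] n p[OF n] in auto)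
          \<comment> \<open>For \<open>\<Psi> = ?x\<close> the required quadratic bound collapses to
            a linear one, which is the order of the diagonal.\<close>
          have "c2 * ?x\<^sup>2 / ?x = (1/2) ^ k * ?x * \<theta> / 2"
            using x by (simp add: c2_def power2_eq_square)
          also have "\<dots> \<le> real (card (placements k n)) * p n ^ e * \<theta> / 2"
            using placed[OF elim(3) n] \<theta> by (intro divide_right_mono mult_right_mono) auto
          also have "\<dots> \<le> R.variance R.copies"
            using R.variance_copies_ge_diagonal n small by (simp add: \<theta>_def e_def mult.assoc)
          finally show "c2 * ?x\<^sup>2 / ?x \<le> R.variance R.copies" .
        qed
        then show ?thesis
          using True pos(3) C(3) by (intro rate)
      next
        case False
        have "?x powr (1 / (2 + 4 * real k)) \<le> 1"
          using False x by (intro powr_le1) auto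
        moreover have "0 < ?x powr (1 / (2 + 4 * real k))"
          using less_imp_neq[OF x] unfolding powr_gt_zero by (rule not_sym)
        ultimately have "1 \<le> C / ?x powr (1 / (2 + 4 * real k))"
          using C(1) by (subst pos_le_divide_eq) linarith+
        then show ?thesis
          using trivial[OF n] by linarith
      qed
    qed
  qed
  show ?thesis
    using dense sparse C(1) unfolding Kol_def e_def by (intro exI[of _ C]) auto
qed

end
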